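(* Let $\beta\in(0,1)$, $\eta\ge 0$, $\kappa\ge 0$, $\gamma>\eta^2$, and let $T$ be the closed-loop system operator in the Hilbert space $\mathbb{X}$ defined in the context. Then $T$ has a compact inverse, is maximal dissipative for $\eta,\kappa>0$, and is skewadjoint for $\eta=\kappa=0$. Thus, for $\eta,\kappa\ge 0$, $T$ is the infinitesimal generator of a contraction $C_0$-semigroup on $\mathbb{X}$.
   Context: Standing parameters: $\beta\in(0,1)$, $\eta\ge0$, $\kappa\ge0$, $\gamma>\eta^2$ (real numbers). $H^k(0,1)$ is the usual (complex) $L_2$-Sobolev space and $\mathring H^k(0,1)=\{w\in H^k(0,1): w(0)=0\}$, $k=1,2$. State space: $\mathbb{X}=\mathring H^2(0,1)\times L_2(0,1)$, with inner product, for $x=(w,v)$, $\tilde x=(\tilde w,\tilde v)$, $$\langle x,\tilde x\rangle=\int_0^1\big[w''\overline{\tilde w''}+(\gamma-\eta^2)w'\overline{\tilde w'}+v\overline{\tilde v}\big]ds,\qquad \|x\|=\langle x,x\rangle^{1/2}.$$ Operator: $T=A+B$ with $$A\begin{pmatrix}w\\ v\end{pmatrix}=\begin{pmatrix}v\\ -w^{(4)}+(\gamma-\eta^2)w''\end{pmatrix},\qquad B\begin{pmatrix}w\\ v\end{pmatrix}=\begin{pmatrix}0\\ -2\beta\eta v'\end{pmatrix},$$ where $D(A)$ is the set of $(w,v)\in\mathbb{X}$ with $w\in H^4(0,1)\cap\mathring H^2(0,1)$, $v\in\mathring H^2(0,1)$, $w''(0)=0$, $w''(1)+\kappa v'(1)=0$,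 $w^{(3)}(1)-(\gamma-\eta^2)w'(1)=0$; $D(B)=\mathring H^2(0,1)\times\mathring H^1(0,1)$; and $D(T)=D(A)$. Dissipative means $\operatorname{Re}\langle Tx,x\rangle\le 0$ for all $x\in D(T)$; maximal dissipative means dissipative with no proper dissipative extension. *)

theory Defs
  imports "HOL-Analysis.Analysis"
begin

section \<open>Complex vector spaces\<close>

class complex_vector = ab_group_add +
  fixes scaleC :: "complex \<Rightarrow> 'a \<Rightarrow> 'a"  (infixr "*\<^sub>C" 75)
  assumes scaleC_add_right: "c *\<^sub>C (x + y) = c *\<^sub>C x + c *\<^sub>C y"
    and scaleC_add_left: "(c + d) *\<^sub>C x = c *\<^sub>C x + d *\<^sub>C x"
    and scaleC_scaleC: "c *\<^sub>C (d *\<^sub>C x) = (c * d) *\<^sub>C x"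
    and scaleC_one: "1 *\<^sub>C x = x"

instantiation prod :: (complex_vector, complex_vector) complex_vector
begin

definition scaleC_prod :: "complex \<Rightarrow> 'a \<times> 'b \<Rightarrow> 'a \<times> 'b"
  where "c *\<^sub>C p = (c *\<^sub>C fst p, c *\<^sub>C snd p)"

instance
  by standard
    (simp_all add: scaleC_prod_def prod_eq_iff scaleC_add_right scaleC_add_left
      scaleC_scaleC scaleC_one)

end

definition csubspace :: "'a::complex_vector set \<Rightarrow> bool"
  where "csubspace S \<longleftrightarrow> module.subspace scaleC S"

lemma vector_space_scaleC: "vector_space (scaleC :: complex \<Rightarrow> 'a::complex_vector \<Rightarrow> 'a)"
  by standard (simp_all add: scaleC_add_right scaleC_add_left scaleC_scaleC scaleC_one)

lemma csubspace_iff: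
  "csubspace S \<longleftrightarrow> 0 \<in> S \<and> (\<forall>x\<in>S. \<forall>y\<in>S. x + y \<in> S) \<and> (\<forall>c. \<forall>x\<in>S. c *\<^sub>C x \<in> S)"
  unfolding csubspace_def
  by (rule module.subspace_def) (use vector_space_scaleC in \<open>simp add: module_iff_vector_space\<close>)


section \<open>Operators in an inner product space\<close>

text \<open>
  The inner product space is given by a carrier \<open>X\<close> inside an ambient complex vector space
  and an inner product \<open>ip\<close>, linear in its first argument. (The norm of the state space below
  depends on real parameters and hence cannot be attached to a type.) Unbounded
  operators are identified with their graphs: the domain is \<^const>\<open>Domain\<close>, inclusion of
  graphs is extension, and the inverse is \<^const>\<open>converse\<close>.
\<close>

definition ip_norm :: "('a \<Rightarrow> 'a \<Rightarrow> complex) \<Rightarrow> 'a \<Rightarrow> real"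
  where "ip_norm ip x = sqrt (Re (ip x x))"

definition op_graph :: "'a set \<Rightarrow> ('a \<Rightarrow> 'a) \<Rightarrow> 'a rel"
  where "op_graph D f = {(x, f x) | x. x \<in> D}"

definition op_sum :: "'a::plus rel \<Rightarrow> 'a rel \<Rightarrow> 'a rel"
  where "op_sum A B = {(x, y + z) | x y z. (x, y) \<in> A \<and> (x, z) \<in> B}"

definition op_neg :: "'a::uminus rel \<Rightarrow> 'a rel"
  where "op_neg T = {(x, - y) | x y. (x, y) \<in> T}"

definition linear_operator :: "'a::complex_vector set \<Rightarrow> 'a rel \<Rightarrow> bool"
  where "linear_operator X T \<longleftrightarrow> T \<subseteq> X \<times> X \<and> single_valued T \<and> csubspace T"

definition densely_defined :: "'a::complex_vector set \<Rightarrow> ('a \<Rightarrow> 'a \<Rightarrow> complex) \<Rightarrow> 'a rel \<Rightarrow> bool"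
  where "densely_defined X ip T \<longleftrightarrow>
    (\<forall>x\<in>X. \<forall>e>0. \<exists>y\<in>Domain T. ip_norm ip (y - x) < e)"

definition compact_operator :: "'a::complex_vector set \<Rightarrow> ('a \<Rightarrow> 'a \<Rightarrow> complex) \<Rightarrow> 'a rel \<Rightarrow> bool"
  where "compact_operator X ip K \<longleftrightarrow>
    linear_operator X K \<and> Domain K = X \<and>
    (\<forall>x y. (\<forall>n. (x n, y n) \<in> K) \<and> (\<exists>C. \<forall>n. ip_norm ip (x n) \<le> C) \<longrightarrow>
      (\<exists>r l. strict_mono (r :: nat \<Rightarrow> nat) \<and> l \<in> X \<and>
        (\<lambda>n. ip_norm ip (y (r n) - l)) \<longlonglongrightarrow> 0))"

definition has_compact_inverse :: "'a::complex_vector set \<Rightarrow> ('a \<Rightarrow> 'a \<Rightarrow> complex) \<Rightarrow> 'a rel \<Rightarrow> bool"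
  where "has_compact_inverse X ip T \<longleftrightarrow> linear_operator X T \<and> compact_operator X ip (T\<inverse>)"

definition dissipative :: "('a \<Rightarrow> 'a \<Rightarrow> complex) \<Rightarrow> 'a rel \<Rightarrow> bool"
  where "dissipative ip T \<longleftrightarrow> (\<forall>(x, y)\<in>T. Re (ip y x) \<le> 0)"

definition maximal_dissipative :: "'a::complex_vector set \<Rightarrow> ('a \<Rightarrow> 'a \<Rightarrow> complex) \<Rightarrow> 'a rel \<Rightarrow> bool"
  where "maximal_dissipative X ip T \<longleftrightarrow>
    linear_operator X T \<and> dissipative ip T \<and>
    (\<forall>S. linear_operator X S \<and> dissipative ip S \<and> T \<subseteq> S \<longrightarrow> S = T)"

definition op_adjoint :: "'a set \<Rightarrow> ('a \<Rightarrow> 'a \<Rightarrow> complex) \<Rightarrow> 'a rel \<Rightarrow> 'a rel"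
  where "op_adjoint X ip T = {(y, z). y \<in> X \<and> z \<in> X \<and> (\<forall>(x, u)\<in>T. ip u y = ip x z)}"

definition skewadjoint :: "'a::complex_vector set \<Rightarrow> ('a \<Rightarrow> 'a \<Rightarrow> complex) \<Rightarrow> 'a rel \<Rightarrow> bool"
  where "skewadjoint X ip T \<longleftrightarrow>
    linear_operator X T \<and> densely_defined X ip T \<and> op_adjoint X ip T = op_neg T"

text \<open>The values of \<open>S t\<close> for \<open>t < 0\<close> or outside \<open>X\<close> are irrelevant.\<close>

definition contraction_C0_semigroup ::
    "'a::complex_vector set \<Rightarrow> ('a \<Rightarrow> 'a \<Rightarrow> complex) \<Rightarrow> (real \<Rightarrow> 'a \<Rightarrow> 'a) \<Rightarrow> bool"
  where "contraction_C0_semigroup X ip S \<longleftrightarrow>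
    (\<forall>t\<ge>0. S t ` X \<subseteq> X) \<and>
    (\<forall>t\<ge>0. \<forall>x\<in>X. \<forall>y\<in>X. S t (x + y) = S t x + S t y) \<and>
    (\<forall>t\<ge>0. \<forall>c. \<forall>x\<in>X. S t (c *\<^sub>C x) = c *\<^sub>C S t x) \<and>
    (\<forall>x\<in>X. S 0 x = x) \<and>
    (\<forall>s\<ge>0. \<forall>t\<ge>0. \<forall>x\<in>X. S (s + t) x = S s (S t x)) \<and>
    (\<forall>x\<in>X. ((\<lambda>t. ip_norm ip (S t x - x)) \<longlongrightarrow> 0) (at_right 0)) \<and>
    (\<forall>t\<ge>0. \<forall>x\<in>X. ip_norm ip (S t x) \<le> ip_norm ip x)"

definition semigroup_generator ::
    "'a::complex_vector set \<Rightarrow> ('a \<Rightarrow> 'a \<Rightarrow> complex) \<Rightarrow> (real \<Rightarrow> 'a \<Rightarrow> 'a) \<Rightarrow> 'a rel"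
  where "semigroup_generator X ip S = {(x, y). x \<in> X \<and> y \<in> X \<and>
    ((\<lambda>t. ip_norm ip (complex_of_real (1 / t) *\<^sub>C (S t x - x) - y)) \<longlongrightarrow> 0) (at_right 0)}"


section \<open>The space \<open>L\<^sub>2(0,1)\<close>\<close>

abbreviation unit_interval_measure :: "real measure"
  where "unit_interval_measure \<equiv> lebesgue_on {0..1}"

definition square_integrable :: "(real \<Rightarrow> complex) \<Rightarrow> bool"
  where "square_integrable f \<longleftrightarrow>
    f \<in> borel_measurable unit_interval_measure \<and>
    integrable unit_interval_measure (\<lambda>x. (cmod (f x))\<^sup>2)"

definition L2_rel :: "(real \<Rightarrow> complex) \<Rightarrow> (real \<Rightarrow> complex) \<Rightarrow> bool"
  where "L2_rel f g \<longleftrightarrow> square_integrable f \<and> square_integrable g \<and>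
    (AE x in unit_interval_measure. f x = g x)"

lemma square_integrable_0: "square_integrable (\<lambda>_. 0)"
  by (simp add: square_integrable_def)

lemma square_integrable_scale:
  assumes "square_integrable f"
  shows "square_integrable (\<lambda>x. c * f x)"
  using assms by (auto simp: square_integrable_def norm_mult power_mult_distrib)

lemma square_integrable_add:
  assumes "square_integrable f" "square_integrable g"
  shows "square_integrable (\<lambda>x. f x + g x)"
proof -
  have [measurable]: "f \<in> borel_measurable unit_interval_measure"
      "g \<in> borel_measurable unit_interval_measure"
    using assms by (auto simp: square_integrable_def)
  have bd: "(cmod (f x + g x))\<^sup>2 \<le> 2 * (cmod (f x))\<^sup>2 + 2 * (cmod (g x))\<^sup>2" for x
  proof -
    have "(cmod (f x + g x))\<^sup>2 \<le> (cmod (f x) + cmod (g x))\<^sup>2"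
      by (intro power_mono norm_triangle_ineq) simp
    also have "\<dots> \<le> 2 * (cmod (f x))\<^sup>2 + 2 * (cmod (g x))\<^sup>2"
      using zero_le_power2[of "cmod (f x) - cmod (g x)"]
      by (simp add: power2_eq_square algebra_simps)
    finally show ?thesis .
  qed
  have "integrable unit_interval_measure (\<lambda>x. 2 * (cmod (f x))\<^sup>2 + 2 * (cmod (g x))\<^sup>2)"
    using assms by (auto simp: square_integrable_def)
  then have "integrable unit_interval_measure (\<lambda>x. (cmod (f x + g x))\<^sup>2)"
    by (rule Bochner_Integration.integrable_bound) (use bd in \<open>auto intro!: AE_I2\<close>)
  then show ?thesis by (auto simp: square_integrable_def)
qed

lemma L2_rel_measurable:
  assumes "L2_rel f g"
  shows "f \<in> borel_measurable unit_interval_measure" "g \<in> borel_measurable unit_interval_measure"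
  using assms by (auto simp: L2_rel_def square_integrable_def)

lemma part_equivp_L2_rel: "part_equivp L2_rel"
proof (rule part_equivpI)
  show "\<exists>f. L2_rel f f"
    by (rule exI[of _ "\<lambda>_. 0"]) (simp add: L2_rel_def square_integrable_0)
  show "symp L2_rel" by (rule sympI) (auto simp: L2_rel_def)
  show "transp L2_rel" by (rule transpI) (auto simp: L2_rel_def)
qed

quotient_type L2 = "real \<Rightarrow> complex" / partial: L2_rel
  by (rule part_equivp_L2_rel)

instantiation L2 :: complex_vector
begin

lift_definition zero_L2 :: L2 is "\<lambda>_. 0"
  by (simp add: L2_rel_def square_integrable_0)

lift_definition plus_L2 :: "L2 \<Rightarrow> L2 \<Rightarrow> L2" is "\<lambda>f g x. f x + g x"
  by (auto simp: L2_rel_def square_integrable_add)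

lift_definition scaleC_L2 :: "complex \<Rightarrow> L2 \<Rightarrow> L2" is "\<lambda>c f x. c * f x"
  by (auto simp: L2_rel_def square_integrable_scale)

lift_definition uminus_L2 :: "L2 \<Rightarrow> L2" is "\<lambda>f x. - f x"
  by (auto simp: L2_rel_def square_integrable_def)

definition minus_L2 :: "L2 \<Rightarrow> L2 \<Rightarrow> L2"
  where "minus_L2 u v = u + - v"

instance
proof
  fix u v w :: L2 and c d :: complex
  show "u + v + w = u + (v + w)"
    by transfer (auto simp: L2_rel_def add.assoc square_integrable_add)
  show "u + v = v + u"
    by transfer (auto simp: L2_rel_def add.commute square_integrable_add)
  show "0 + u = u"
    by transfer (auto simp: L2_rel_def)
  show "- u + u = 0"
    by transfer (auto simp: L2_rel_def square_integrable_0)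
  show "u - v = u + - v"
    by (rule minus_L2_def)
  show "c *\<^sub>C (u + v) = c *\<^sub>C u + c *\<^sub>C v"
    by transfer (auto simp: L2_rel_def distrib_left square_integrable_add square_integrable_scale)
  show "(c + d) *\<^sub>C u = c *\<^sub>C u + d *\<^sub>C u"
    by transfer (auto simp: L2_rel_def distrib_right
        intro: square_integrable_add[OF square_integrable_scale square_integrable_scale])
  show "c *\<^sub>C (d *\<^sub>C u) = (c * d) *\<^sub>C u"
    by transfer (auto simp: L2_rel_def mult.assoc
        intro: square_integrable_scale[OF square_integrable_scale])
  show "1 *\<^sub>C u = u"
    by transfer (auto simp: L2_rel_def)
qed

end

lift_definition L2_ip :: "L2 \<Rightarrow> L2 \<Rightarrow> complex"
  is "\<lambda>f g. LINT x|unit_interval_measure. f x * cnj (g x)"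
proof -
  fix f f' g g' assume r: "L2_rel f f'" "L2_rel g g'"
  note [measurable] = L2_rel_measurable[OF r(1)] L2_rel_measurable[OF r(2)]
  have [measurable]: "cnj \<in> borel_measurable borel"
    by (intro borel_measurable_continuous_onI continuous_intros)
  have "AE x in unit_interval_measure. f x * cnj (g x) = f' x * cnj (g' x)"
    using r by (auto simp: L2_rel_def)
  then show "(LINT x|unit_interval_measure. f x * cnj (g x)) =
      (LINT x|unit_interval_measure. f' x * cnj (g' x))"
    by (intro integral_cong_AE) measurable
qed


section \<open>Sobolev spaces\<close>

definition test_function :: "(real \<Rightarrow> real) \<Rightarrow> bool"
  where "test_function \<phi> \<longleftrightarrow>
    \<phi> C1_differentiable_on UNIV \<and> closure {x. \<phi> x \<noteq> 0} \<subseteq> {0<..<1}"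

lemma test_function_measurable:
  assumes "test_function \<phi>"
  shows "\<phi> \<in> borel_measurable unit_interval_measure"
    "deriv \<phi> \<in> borel_measurable unit_interval_measure"
proof -
  obtain D where D: "\<And>x. (\<phi> has_vector_derivative D x) (at x)" "continuous_on UNIV D"
    using assms by (auto simp: test_function_def C1_differentiable_on_def)
  have der: "(\<phi> has_real_derivative D x) (at x)" for x
    using D(1)[of x] by (simp add: has_real_derivative_iff_has_vector_derivative)
  have eq: "deriv \<phi> = D"
    using der by (auto intro!: DERIV_imp_deriv)
  have c: "continuous_on {0..1} \<phi>"
    using der by (intro continuous_at_imp_continuous_on ballI DERIV_isCont)
  show "\<phi> \<in> borel_measurable unit_interval_measure"
    by (rule continuous_imp_measurable_on_sets_lebesgue[OF c]) simp
  show "deriv \<phi> \<in> borel_measurable unit_interval_measure"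
    unfolding eq
    by (rule continuous_imp_measurable_on_sets_lebesgue)
      (use D(2) continuous_on_subset in auto)
qed

text \<open>
  Weak derivatives are taken against \<open>C\<^sup>1\<close> test functions with compact support in \<open>(0,1)\<close>,
  as in Brezis, Functional Analysis, Sobolev Spaces and PDEs, Section 8.2.
\<close>

lift_definition has_weak_deriv :: "L2 \<Rightarrow> L2 \<Rightarrow> bool"
  is "\<lambda>u g. \<forall>\<phi>. test_function \<phi> \<longrightarrow>
    (LINT x|unit_interval_measure. complex_of_real (deriv \<phi> x) * u x) =
    - (LINT x|unit_interval_measure. complex_of_real (\<phi> x) * g x)"
proof -
  fix u u' g g' assume r: "L2_rel u u'" "L2_rel g g'"
  note m = L2_rel_measurable[OF r(1)] L2_rel_measurable[OF r(2)]
  have "(LINT x|unit_interval_measure. complex_of_real (deriv \<phi> x) * u x) =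
        (LINT x|unit_interval_measure. complex_of_real (deriv \<phi> x) * u' x)" 
       "(LINT x|unit_interval_measure. complex_of_real (\<phi> x) * g x) =
        (LINT x|unit_interval_measure. complex_of_real (\<phi> x) * g' x)"
    if "test_function \<phi>" for \<phi>
    using r m test_function_measurable[OF that]
    by (auto simp: L2_rel_def intro!: integral_cong_AE)
  then show "(\<forall>\<phi>. test_function \<phi> \<longrightarrow>
      (LINT x|unit_interval_measure. complex_of_real (deriv \<phi> x) * u x) =
      - (LINT x|unit_interval_measure. complex_of_real (\<phi> x) * g x)) \<longleftrightarrow>
    (\<forall>\<phi>. test_function \<phi> \<longrightarrow>
      (LINT x|unit_interval_measure. complex_of_real (deriv \<phi> x) * u' x) =
      - (LINT x|unit_interval_measure. complex_of_real (\<phi> x) * g' x))"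
    by simp
qed

definition weak_deriv :: "L2 \<Rightarrow> L2"
  where "weak_deriv u = (THE g. has_weak_deriv u g)"

fun sobolev_H :: "nat \<Rightarrow> L2 set"
  where
    "sobolev_H 0 = UNIV"
  | "sobolev_H (Suc k) = {u. \<exists>g\<in>sobolev_H k. has_weak_deriv u g}"

text \<open>
  The value at \<open>x \<in> [0,1]\<close> of the unique representative of \<open>u \<in> H\<^sup>1(0,1)\<close> that is
  continuous on \<open>[0,1]\<close>.
\<close>

definition point_value :: "L2 \<Rightarrow> real \<Rightarrow> complex"
  where "point_value u x = (THE c. \<exists>f. continuous_on {0..1} f \<and> u = abs_L2 f \<and> c = f x)"

definition sobolev_H0 :: "nat \<Rightarrow> L2 set"
  where "sobolev_H0 k = {w \<in> sobolev_H k. point_value w 0 = 0}"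


section \<open>The closed-loop system operator\<close>

definition state_space :: "(L2 \<times> L2) set"
  where "state_space = sobolev_H0 2 \<times> UNIV"

definition state_ip :: "real \<Rightarrow> real \<Rightarrow> L2 \<times> L2 \<Rightarrow> L2 \<times> L2 \<Rightarrow> complex"
  where "state_ip \<gamma> \<eta> = (\<lambda>(w, v) (w', v').
    L2_ip ((weak_deriv ^^ 2) w) ((weak_deriv ^^ 2) w')
    + complex_of_real (\<gamma> - \<eta>\<^sup>2) * L2_ip (weak_deriv w) (weak_deriv w')
    + L2_ip v v')"

definition dom_A :: "real \<Rightarrow> real \<Rightarrow> real \<Rightarrow> (L2 \<times> L2) set"
  where "dom_A \<gamma> \<eta> \<kappa> = {(w, v). (w, v) \<in> state_space \<and>
    w \<in> sobolev_H 4 \<inter> sobolev_H0 2 \<and> v \<in> sobolev_H0 2 \<and>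
    point_value ((weak_deriv ^^ 2) w) 0 = 0 \<and>
    point_value ((weak_deriv ^^ 2) w) 1
      + complex_of_real \<kappa> * point_value (weak_deriv v) 1 = 0 \<and>
    point_value ((weak_deriv ^^ 3) w) 1
      - complex_of_real (\<gamma> - \<eta>\<^sup>2) * point_value (weak_deriv w) 1 = 0}"

definition op_A :: "real \<Rightarrow> real \<Rightarrow> real \<Rightarrow> (L2 \<times> L2) rel"
  where "op_A \<gamma> \<eta> \<kappa> = op_graph (dom_A \<gamma> \<eta> \<kappa>) (\<lambda>(w, v).
    (v, - (weak_deriv ^^ 4) w + complex_of_real (\<gamma> - \<eta>\<^sup>2) *\<^sub>C (weak_deriv ^^ 2) w))"

definition op_B :: "real \<Rightarrow> real \<Rightarrow> (L2 \<times> L2) rel"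
  where "op_B \<beta> \<eta> = op_graph (sobolev_H0 2 \<times> sobolev_H0 1) (\<lambda>(w, v).
    (0, - complex_of_real (2 * \<beta> * \<eta>) *\<^sub>C weak_deriv v))"

definition op_T :: "real \<Rightarrow> real \<Rightarrow> real \<Rightarrow> real \<Rightarrow> (L2 \<times> L2) rel"
  where "op_T \<beta> \<gamma> \<eta> \<kappa> = op_sum (op_A \<gamma> \<eta> \<kappa>) (op_B \<beta> \<eta>)"

lemma Domain_op_T: "Domain (op_T \<beta> \<gamma> \<eta> \<kappa>) = dom_A \<gamma> \<eta> \<kappa>"
proof -
  have "sobolev_H0 2 \<subseteq> sobolev_H0 1"
    by (auto simp: sobolev_H0_def numeral_2_eq_2)
  then have "dom_A \<gamma> \<eta> \<kappa> \<subseteq> sobolev_H0 2 \<times> sobolev_H0 1"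
    by (auto simp: dom_A_def)
  then show ?thesis
    by (fastforce simp: op_T_def op_sum_def op_A_def op_B_def op_graph_def Domain_iff)
qed

end

theory Submission
  imports Defs "HOL-Complex_Analysis.Great_Picard"
begin

text \<open>
  Everything about \<open>T\<close> follows from three facts: it is dissipative (integration by parts), it is onto
  (a two-point boundary value problem for \<open>w'\<close>), and its inverse is compact (an energy estimate bounds
  \<open>w'''\<close>, and the Volterra operator is compact by Arzela--Ascoli). A dissipative operator onto a Hilbert
  space is densely defined and has no proper dissipative extension; if moreover \<open>Re \<langle>T x, x\<rangle> = 0\<close> it is
  skewadjoint. The resolvents \<open>J\<^sub>h = (1 - h T)\<inverse>\<close> are contractions and
  \<open>\<parallel>J\<^sub>h J\<^sub>k x - J\<^sub>h\<^sub>+\<^sub>k x\<parallel> \<le> h k \<parallel>T\<^sup>2 x\<parallel>\<close>. Hence the implicit Euler approximations, \<open>2\<^sup>n\<close>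
  iterations of \<open>J\<^sub>h\<close> with \<open>h = t / 2\<^sup>n\<close>, converge to a contraction semigroup whose generator is a
  dissipative extension of \<open>T\<close>, and so equals \<open>T\<close>. On the Sobolev side, \<open>H\<^sup>1(0,1)\<close> is identified
  with the functions \<open>c + \<integral>\<^sub>0\<^sup>x g\<close>, \<open>g\<close> in \<open>L\<^sub>2(0,1)\<close>, by the lemma of du Bois-Reymond.
\<close>

text \<open>The norm depends on \<gamma> and \<eta>, so the abstract theory is relative to a carrier
  set; only \<open>L2\<close> gets a type-class norm. The equation \<open>T x = u\<close> is easier
  than the resolvent equation: its first row prescribes the velocity, so the term with \<kappa>
  becomes a known boundary datum and what remains is solved by exponentials. The resolvents then
  come abstractly from the bounded inverse.

  Step doubling makes consecutive approximations comparable factor by factor: each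
  \<open>J (2 * s)\<close> is replaced by \<open>J s\<close> twice, with an error quadratic in
  \<open>s\<close>, and there are only about \<open>1 / s\<close> factors. That error bound holds on
  D(T^2), whence the density results for this set.

  On the concrete side an element of a Sobolev space is a nested \<open>prim\<close> whose constants
  are boundary values at 0. Weak derivatives, traces and boundary conditions become algebra in these
  coordinates, and every integration by parts for \<open>T\<close> is an instance of
  \<open>L2_ip_parts\<close>, which rests on \<open>volterra\<close> plus its adjoint having rank
  one.\<close>

interpretation cvec: vector_space "scaleC :: complex \<Rightarrow> 'a::complex_vector \<Rightarrow> 'a"
  by (rule vector_space_scaleC)

section \<open>Hilbert spaces given by a carrier set\<close>

text \<open>Completeness is phrased through \<open>ip_norm\<close> because the carrier has no
  topology of its own. The type \<open>L2 \<times> L2\<close> does carry one later, but its product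
  norm does not see the derivatives of the first component.\<close>

locale hilbert_carrier =
  fixes X :: "'a::complex_vector set" and ip :: "'a \<Rightarrow> 'a \<Rightarrow> complex"
  assumes X_csubspace: "csubspace X"
    and ip_add_left: "\<lbrakk>x \<in> X; y \<in> X; z \<in> X\<rbrakk> \<Longrightarrow> ip (x + y) z = ip x z + ip y z"
    and ip_scale_left: "\<lbrakk>x \<in> X; y \<in> X\<rbrakk> \<Longrightarrow> ip (c *\<^sub>C x) y = c * ip x y"
    and ip_commute: "\<lbrakk>x \<in> X; y \<in> X\<rbrakk> \<Longrightarrow> ip y x = cnj (ip x y)"
    and ip_definite: "\<lbrakk>x \<in> X; x \<noteq> 0\<rbrakk> \<Longrightarrow> 0 < Re (ip x x)"
    and complete: "\<lbrakk>\<And>n. f n \<in> X; \<And>e. 0 < e \<Longrightarrow> \<exists>M. \<forall>m\<ge>M. \<forall>n\<ge>M. ip_norm ip (f m - f n) < e\<rbrakk>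
      \<Longrightarrow> \<exists>l\<in>X. (\<lambda>n. ip_norm ip (f n - l)) \<longlonglongrightarrow> 0"
begin

abbreviation N :: "'a \<Rightarrow> real" where "N \<equiv> ip_norm ip"

lemma zero_mem [simp, intro]: "0 \<in> X"
  and add_mem [simp, intro]: "\<lbrakk>x \<in> X; y \<in> X\<rbrakk> \<Longrightarrow> x + y \<in> X"
  and scale_mem [simp, intro]: "x \<in> X \<Longrightarrow> c *\<^sub>C x \<in> X"
  using X_csubspace by (auto simp: csubspace_iff)

lemma uminus_mem [simp, intro]: "x \<in> X \<Longrightarrow> - x \<in> X"
  using scale_mem[of x "-1"] by simp

lemma diff_mem [simp, intro]: "\<lbrakk>x \<in> X; y \<in> X\<rbrakk> \<Longrightarrow> x - y \<in> X"
  using add_mem[of x "- y"] by simp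

lemma ip_add_right: "\<lbrakk>x \<in> X; y \<in> X; z \<in> X\<rbrakk> \<Longrightarrow> ip z (x + y) = ip z x + ip z y"
  by (metis add_mem complex_cnj_add ip_add_left ip_commute)

lemma ip_scale_right: "\<lbrakk>x \<in> X; y \<in> X\<rbrakk> \<Longrightarrow> ip y (c *\<^sub>C x) = cnj c * ip y x"
  by (metis scale_mem complex_cnj_mult ip_scale_left ip_commute)

lemma ip_uminus_left: "\<lbrakk>x \<in> X; y \<in> X\<rbrakk> \<Longrightarrow> ip (- x) y = - ip x y"
  using ip_scale_left[of x y "-1"] by simp

lemma ip_uminus_right: "\<lbrakk>x \<in> X; y \<in> X\<rbrakk> \<Longrightarrow> ip y (- x) = - ip y x"
  using ip_scale_right[of x y "-1"] by simp

lemma ip_diff_left: "\<lbrakk>x \<in> X; y \<in> X; z \<in> X\<rbrakk> \<Longrightarrow> ip (x - y) z = ip x z - ip y z"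
  using ip_add_left[of x "- y" z] ip_uminus_left[of y z] by simp

lemma ip_diff_right: "\<lbrakk>x \<in> X; y \<in> X; z \<in> X\<rbrakk> \<Longrightarrow> ip z (x - y) = ip z x - ip z y"
  using ip_add_right[of x "- y" z] ip_uminus_right[of y z] by simp

lemma ip_zero_left [simp]: "y \<in> X \<Longrightarrow> ip 0 y = 0"
  using ip_scale_left[of 0 y 0] by simp

lemma ip_zero_right [simp]: "y \<in> X \<Longrightarrow> ip y 0 = 0"
  using ip_scale_right[of 0 y 0] by simp

lemmas ip_simps = ip_add_left ip_add_right ip_scale_left ip_scale_right
  ip_uminus_left ip_uminus_right ip_diff_left ip_diff_right

lemma Re_ip_self_nonneg: "x \<in> X \<Longrightarrow> 0 \<le> Re (ip x x)"
  by (cases "x = 0") (auto dest: ip_definite)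

lemma N_sq: "x \<in> X \<Longrightarrow> (N x)\<^sup>2 = Re (ip x x)"
  by (simp add: ip_norm_def Re_ip_self_nonneg)

lemma N_nonneg [simp]: "x \<in> X \<Longrightarrow> 0 \<le> N x"
  by (simp add: ip_norm_def Re_ip_self_nonneg)

lemma N_zero [simp]: "N 0 = 0"
  by (simp add: ip_norm_def)

lemma N_eq_0_iff: "x \<in> X \<Longrightarrow> N x = 0 \<longleftrightarrow> x = 0"
  by (metis N_sq N_zero ip_definite less_irrefl zero_power2)

lemma Re_ip_commute: "\<lbrakk>x \<in> X; y \<in> X\<rbrakk> \<Longrightarrow> Re (ip y x) = Re (ip x y)"
  by (metis complex_cnj(1) complex.sel(1) ip_commute complex_surj)

lemma N_scale: "x \<in> X \<Longrightarrow> N (c *\<^sub>C x) = cmod c * N x"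
proof -
  assume x: "x \<in> X"
  have "ip (c *\<^sub>C x) (c *\<^sub>C x) = of_real ((cmod c)\<^sup>2) * ip x x"
    using x by (simp add: ip_simps complex_norm_square del: of_real_power)
  then have "(N (c *\<^sub>C x))\<^sup>2 = (cmod c * N x)\<^sup>2"
    using x by (simp add: N_sq power_mult_distrib)
  then show ?thesis using x by (simp add: power2_eq_iff_nonneg)
qed

lemma N_uminus: "x \<in> X \<Longrightarrow> N (- x) = N x"
  using N_scale[of x "-1"] by simp

lemma N_minus_commute: "\<lbrakk>x \<in> X; y \<in> X\<rbrakk> \<Longrightarrow> N (x - y) = N (y - x)"
  using N_uminus[of "x - y"] by simp

lemma N_add_sq: "\<lbrakk>x \<in> X; y \<in> X\<rbrakk> \<Longrightarrow> (N (x + y))\<^sup>2 = (N x)\<^sup>2 + 2 * Re (ip x y) + (N y)\<^sup>2"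
  using Re_ip_commute[of x y] by (simp add: N_sq ip_simps)

lemma N_diff_sq: "\<lbrakk>x \<in> X; y \<in> X\<rbrakk> \<Longrightarrow> (N (x - y))\<^sup>2 = (N x)\<^sup>2 - 2 * Re (ip x y) + (N y)\<^sup>2"
  using Re_ip_commute[of x y] by (simp add: N_sq ip_simps)

text \<open>Cauchy-Schwarz for the real part suffices for the triangle inequality, the resolvent
  bound and the dissipativity of the generator. It comes from expanding the squared norm of
  \<open>N y\<close> times \<open>x\<close> minus \<open>N x\<close> times \<open>y\<close> and
  dividing by \<open>2 * N x * N y\<close>.\<close>

lemma Re_ip_le: assumes "x \<in> X" "y \<in> X" shows "Re (ip x y) \<le> N x * N y"
proof (cases "x = 0 \<or> y = 0")
  case True then show ?thesis using assms by auto
next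
  case False
  then have pos: "0 < N x" "0 < N y"
    using assms N_eq_0_iff N_nonneg by (metis less_le)+
  have "0 \<le> (N (of_real (N y) *\<^sub>C x - of_real (N x) *\<^sub>C y))\<^sup>2" by simp
  also have "\<dots> = 2 * (N x * N y) * (N x * N y - Re (ip x y))"
    using assms by (subst N_diff_sq) (auto simp: N_scale ip_simps power2_eq_square algebra_simps)
  finally show ?thesis using mult_pos_pos[OF pos] by (simp add: zero_le_mult_iff)
qed

lemma N_triangle: assumes "x \<in> X" "y \<in> X" shows "N (x + y) \<le> N x + N y"
proof (rule power2_le_imp_le)
  show "(N (x + y))\<^sup>2 \<le> (N x + N y)\<^sup>2"
    using assms Re_ip_le[OF assms] by (simp add: N_add_sq power2_sum)
qed (use assms in simp)

lemma N_triangle_diff: "\<lbrakk>x \<in> X; y \<in> X; z \<in> X\<rbrakk> \<Longrightarrow> N (x - z) \<le> N (x - y) + N (y - z)"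
  using N_triangle[of "x - y" "y - z"] by simp

lemma N_diff_le: "\<lbrakk>x \<in> X; y \<in> X\<rbrakk> \<Longrightarrow> N (x - y) \<le> N x + N y"
  using N_triangle[of x "- y"] by (simp add: N_uminus)

section \<open>Linear contractions and their powers; limits and fixed points\<close>

definition contraction :: "('a \<Rightarrow> 'a) \<Rightarrow> bool"
  where "contraction P \<longleftrightarrow> (\<forall>x\<in>X. P x \<in> X \<and> N (P x) \<le> N x) \<and>
    (\<forall>x\<in>X. \<forall>y\<in>X. P (x + y) = P x + P y) \<and> (\<forall>c. \<forall>x\<in>X. P (c *\<^sub>C x) = c *\<^sub>C P x)"

lemma contractionD:
  assumes "contraction P"
  shows "x \<in> X \<Longrightarrow> P x \<in> X" "x \<in> X \<Longrightarrow> N (P x) \<le> N x"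
    "\<lbrakk>x \<in> X; y \<in> X\<rbrakk> \<Longrightarrow> P (x + y) = P x + P y" "x \<in> X \<Longrightarrow> P (c *\<^sub>C x) = c *\<^sub>C P x"
  using assms by (auto simp: contraction_def)

lemma contraction_diff: "\<lbrakk>contraction P; x \<in> X; y \<in> X\<rbrakk> \<Longrightarrow> P (x - y) = P x - P y"
  using contractionD(3)[of P "x" "- y"] contractionD(4)[of P y "-1"] by simp

lemma contraction_id: "contraction (\<lambda>x. x)"
  by (simp add: contraction_def)

lemma contraction_comp: "\<lbrakk>contraction P; contraction Q\<rbrakk> \<Longrightarrow> contraction (\<lambda>x. P (Q x))"
  by (auto simp: contraction_def intro: order_trans)

lemma contraction_funpow: "contraction P \<Longrightarrow> contraction (P ^^ n)"
proof (induction n)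
  case (Suc n)
  then show ?case using contraction_comp[of P "P ^^ n"] by (simp add: o_def)
qed (simp add: contraction_id id_def)

lemma contraction_dist_le: "\<lbrakk>contraction P; x \<in> X; y \<in> X\<rbrakk> \<Longrightarrow> N (P x - P y) \<le> N (x - y)"
  by (metis contraction_diff contractionD(2) diff_mem)

lemma funpow_commute_on:
  assumes "contraction P" "contraction Q" "\<And>x. x \<in> X \<Longrightarrow> P (Q x) = Q (P x)" "x \<in> X"
  shows "P ((Q ^^ n) x) = (Q ^^ n) (P x)"
proof (induction n)
  case (Suc n)
  then show ?case using assms contractionD(1)[OF contraction_funpow[OF assms(2)] assms(4)] by simp
qed simp

lemma funpow_comp_on:
  assumes "contraction P" "contraction Q" "\<And>x. x \<in> X \<Longrightarrow> P (Q x) = Q (P x)" "x \<in> X"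
  shows "((\<lambda>x. P (Q x)) ^^ n) x = (P ^^ n) ((Q ^^ n) x)"
proof (induction n)
  case (Suc n)
  have "Q ((P ^^ n) ((Q ^^ n) x)) = (P ^^ n) (Q ((Q ^^ n) x))"
    using assms contractionD(1)[OF contraction_funpow[OF assms(2)] assms(4)]
    by (intro funpow_commute_on) auto
  then show ?case using Suc by simp
qed simp

text \<open>Telescoping, one swap of \<open>Q\<close> for \<open>P\<close> at a time. Commutation
  moves all powers of \<open>Q\<close> outside, so every summand is a contraction applied to the
  single difference \<open>P x - Q x\<close>, and a one-step error is needed only at the starting
  point \<open>x\<close>.\<close>

lemma funpow_diff_le:
  assumes "contraction P" "contraction Q" "\<And>x. x \<in> X \<Longrightarrow> P (Q x) = Q (P x)" "x \<in> X"
  shows "N ((P ^^ n) x - (Q ^^ n) x) \<le> real n * N (P x - Q x)"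
proof (induction n)
  case (Suc n)
  note [simp] = contractionD(1)[OF assms(1)] contractionD(1)[OF assms(2)]
    contractionD(1)[OF contraction_funpow[OF assms(1)]] contractionD(1)[OF contraction_funpow[OF assms(2)]]
  have Q: "(Q ^^ Suc n) x = (Q ^^ n) (Q x)"
    by (simp only: funpow_Suc_right o_apply)
  have "N ((P ^^ Suc n) x - (Q ^^ Suc n) x) \<le> N ((P ^^ Suc n) x - P ((Q ^^ n) x)) + N (P ((Q ^^ n) x) - (Q ^^ Suc n) x)"
    using assms(4) by (intro N_triangle_diff) auto
  also have "N ((P ^^ Suc n) x - P ((Q ^^ n) x)) \<le> N ((P ^^ n) x - (Q ^^ n) x)"
    using assms by (simp add: contraction_dist_le)
  also have "N (P ((Q ^^ n) x) - (Q ^^ Suc n) x) \<le> N (P x - Q x)"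
    unfolding Q using assms by (simp add: funpow_commute_on contraction_dist_le contraction_funpow)
  finally show ?case using Suc by (simp add: algebra_simps)
qed simp

lemma contraction_eq_on_dense:
  assumes PQ: "contraction P" "contraction Q"
    and dense: "\<And>x e. \<lbrakk>x \<in> X; 0 < e\<rbrakk> \<Longrightarrow> \<exists>y\<in>D. N (y - x) < e"
    and D: "D \<subseteq> X" "\<And>x. x \<in> D \<Longrightarrow> P x = Q x" and x: "x \<in> X"
  shows "P x = Q x"
proof -
  note [simp] = contractionD(1)[OF PQ(1)] contractionD(1)[OF PQ(2)]
  have "N (P x - Q x) \<le> 0 + e" if e: "0 < e" for e
  proof -
    obtain y where y: "y \<in> D" "N (y - x) < e / 2" using dense[of x "e/2"] x e by auto
    then have yX: "y \<in> X" using D by auto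
    have "N (P x - Q x) \<le> N (P x - P y) + N (P y - Q x)"
      using x yX by (intro N_triangle_diff) auto
    also have "\<dots> = N (P x - P y) + N (Q y - Q x)" using D y by simp
    also have "\<dots> \<le> N (x - y) + N (y - x)"
      using x yX PQ by (intro add_mono contraction_dist_le) auto
    also have "\<dots> < e" using x yX y N_minus_commute[of x y] by simp
    finally show ?thesis by simp
  qed
  then have "N (P x - Q x) \<le> 0" by (rule field_le_epsilon)
  moreover have "0 \<le> N (P x - Q x)" using x by simp
  ultimately show ?thesis using x N_eq_0_iff[of "P x - Q x"] by simp
qed

lemma lim_unique:
  assumes "\<And>n. f n \<in> X" "a \<in> X" "b \<in> X" "(\<lambda>n. N (f n - a)) \<longlonglongrightarrow> 0" "(\<lambda>n. N (f n - b)) \<longlonglongrightarrow> 0"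
  shows "a = b"
proof -
  have "(\<lambda>n. N (f n - a) + N (f n - b)) \<longlonglongrightarrow> 0 + 0" by (intro tendsto_intros assms)
  moreover have "N (a - b) \<le> N (f n - a) + N (f n - b)" for n
    using N_triangle_diff[of a "f n" b] assms N_minus_commute[of a "f n"] by simp
  ultimately have "N (a - b) \<le> 0 + 0" using LIMSEQ_le_const by blast
  then have "N (a - b) = 0" using N_nonneg[of "a - b"] assms by (simp del: N_nonneg)
  then show ?thesis using assms N_eq_0_iff[of "a - b"] by simp
qed

lemma banach_fixed_point:
  assumes q: "q < 1" and f: "\<And>x. x \<in> X \<Longrightarrow> f x \<in> X"
    "\<And>x y. \<lbrakk>x \<in> X; y \<in> X\<rbrakk> \<Longrightarrow> N (f x - f y) \<le> q * N (x - y)"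
  obtains x where "x \<in> X" "f x = x"
proof -
  \<comment> \<open>Outside the carrier \<open>ip_norm\<close> need not be nonnegative or symmetric,
    while a metric space asks this of the distance at all points of the type; hence the default
    value 0.\<close>
  interpret M: Metric_space X "\<lambda>x y. if x \<in> X \<and> y \<in> X then N (x - y) else 0"
  proof
    show "(if x \<in> X \<and> y \<in> X then N (x - y) else 0) = (if y \<in> X \<and> x \<in> X then N (y - x) else 0)" for x y
      using N_minus_commute[of x y] by auto
  qed (auto simp: N_eq_0_iff N_triangle_diff)
  have "M.mcomplete"
    unfolding M.mcomplete_def
  proof (intro allI impI)
    fix s assume "M.MCauchy s"
    then have s: "s n \<in> X" "\<And>e. 0 < e \<Longrightarrow> \<exists>M. \<forall>m\<ge>M. \<forall>n\<ge>M. N (s m - s n) < e" for n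
      unfolding M.MCauchy_def by (auto simp: image_subset_iff)
    obtain l where "l \<in> X" "(\<lambda>n. N (s n - l)) \<longlonglongrightarrow> 0"
      using complete[OF s] by auto
    then show "\<exists>x. limitin M.mtopology s x sequentially"
      using s by (auto simp: M.limitin_metric_dist_null)
  qed
  then show ?thesis
    by (rule M.Banach_fixedpoint_thm[where f = f and k = q]) (use q f that in auto)
qed

end

section \<open>Surjective dissipative operators\<close>

text \<open>The bounded inverse makes \<open>T\<close> injective, gives the Lipschitz constant in
  the fixed-point problem for the resolvents, and turns closeness of images into closeness of
  arguments in \<open>core_dense\<close>.\<close>

locale dissipative_onto = hilbert_carrier +
  fixes T :: "'a rel"
  assumes lin: "linear_operator X T" and diss: "dissipative ip T" and onto: "Range T = X"
    and bounded_inverse: "\<exists>C. \<forall>(x, y)\<in>T. ip_norm ip x \<le> C * ip_norm ip y"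
begin

lemma T_mem: "(x, u) \<in> T \<Longrightarrow> x \<in> X" "(x, u) \<in> T \<Longrightarrow> u \<in> X"
  using lin by (auto simp: linear_operator_def)

lemma T_unique: "\<lbrakk>(x, u) \<in> T; (x, v) \<in> T\<rbrakk> \<Longrightarrow> u = v"
  using lin by (auto simp: linear_operator_def single_valued_def)

lemma T_add: "\<lbrakk>(x, u) \<in> T; (y, v) \<in> T\<rbrakk> \<Longrightarrow> (x + y, u + v) \<in> T"
  using lin unfolding linear_operator_def csubspace_iff by (metis add_Pair)

lemma T_scale: "(x, u) \<in> T \<Longrightarrow> (c *\<^sub>C x, c *\<^sub>C u) \<in> T"
  using lin unfolding linear_operator_def csubspace_iff by (metis fst_conv scaleC_prod_def snd_conv)

lemma T_diff: "\<lbrakk>(x, u) \<in> T; (y, v) \<in> T\<rbrakk> \<Longrightarrow> (x - y, u - v) \<in> T"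
  using T_add[of x u "- y" "- v"] T_scale[of y v "-1"] by simp

lemma T_diss: "(x, u) \<in> T \<Longrightarrow> Re (ip u x) \<le> 0"
  using diss by (auto simp: dissipative_def)

lemma T_onto: "u \<in> X \<Longrightarrow> \<exists>x. (x, u) \<in> T"
  using onto by auto

lemma T_bound: obtains C where "0 \<le> C" "\<And>x y. (x, y) \<in> T \<Longrightarrow> N x \<le> C * N y"
proof -
  obtain C where C: "\<And>x y. (x, y) \<in> T \<Longrightarrow> N x \<le> C * N y"
    using bounded_inverse by auto
  have "N x \<le> \<bar>C\<bar> * N y" if "(x, y) \<in> T" for x y
    using C[OF that] T_mem[OF that] by (smt (verit) N_nonneg mult_right_mono)
  then show ?thesis by (intro that[of "\<bar>C\<bar>"]) auto
qed

lemma T_kernel: "(x, 0) \<in> T \<Longrightarrow> x = 0"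
  by (metis N_eq_0_iff N_nonneg N_zero T_bound T_mem(1) mult_zero_right order_antisym)

text \<open>Putting \<open>c = t * cnj a\<close> makes the left side linear in \<open>t > 0\<close>
  and the right side quadratic, so a small \<open>t\<close> is contradictory unless
  \<open>a = 0\<close>. Orthogonality is extracted in this way both from minimality of a distance
  and from dissipativity.\<close>

lemma linear_bound_imp_zero:
  assumes "\<And>c. Re (c * a) \<le> (cmod c)\<^sup>2 * r"
  shows "a = 0"
proof (rule ccontr)
  assume a: "a \<noteq> 0"
  \<comment> \<open>A bound of at least 1 keeps \<open>t\<close> positive even if \<open>r\<close>
    is zero or negative; then \<open>t * r' = 1 / 2\<close>.\<close>
  define r' where "r' = max r 1"
  have r': "r' \<ge> 1" "r' \<ge> r" by (auto simp: r'_def)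
  define t where "t = 1 / (2 * r')"
  have t: "t > 0" using r' by (simp add: t_def)
  have "Re (of_real t * cnj a * a) \<le> (cmod (of_real t * cnj a))\<^sup>2 * r" by (rule assms)
  also have "Re (of_real t * cnj a * a) = t * (cmod a)\<^sup>2"
    by (simp add: mult.assoc mult.commute[of "cnj a"] complex_norm_square[symmetric] del: of_real_power)
  also have "(cmod (of_real t * cnj a))\<^sup>2 * r \<le> (cmod (of_real t * cnj a))\<^sup>2 * r'"
    using r' by (intro mult_left_mono) auto
  also have "\<dots> = t * (cmod a)\<^sup>2 * (t * r')"
    using t by (simp add: norm_mult power_mult_distrib power2_eq_square)
  also have "t * r' = 1/2" using r' by (simp add: t_def)
  finally show False using t a by (simp add: mult_le_0_iff)
qed

text \<open>If \<open>S\<close> takes the value \<open>y\<close> at \<open>x\<close>, and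
  \<open>T\<close> takes it at \<open>x'\<close>, then \<open>z = x - x'\<close> is in the kernel of
  \<open>S\<close>. Adding multiples of \<open>z\<close> to a point \<open>u\<close> with
  \<open>T u = z\<close> leaves the image \<open>z\<close> unchanged, so
  \<open>Re (ip z (u + c *\<^sub>C z))\<close> is nonpositive for every \<open>c\<close>, which
  forces \<open>z = 0\<close>.\<close>

lemma dissipative_extension:
  assumes S: "linear_operator X S" "dissipative ip S" "T \<subseteq> S"
  shows "S = T"
proof -
  have SX: "S \<subseteq> X \<times> X" and Sadd: "\<And>x u y v. \<lbrakk>(x, u) \<in> S; (y, v) \<in> S\<rbrakk> \<Longrightarrow> (x + y, u + v) \<in> S"
    and Sscale: "\<And>x u c. (x, u) \<in> S \<Longrightarrow> (c *\<^sub>C x, c *\<^sub>C u) \<in> S"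
    using S(1) unfolding linear_operator_def csubspace_iff
    by (blast, metis add_Pair, metis fst_conv scaleC_prod_def snd_conv)
  have "(x, y) \<in> T" if xy: "(x, y) \<in> S" for x y
  proof -
    have X: "x \<in> X" "y \<in> X" using xy SX by auto
    obtain x' where x': "(x', y) \<in> T" using T_onto X by auto
    define z where "z = x - x'"
    have zX: "z \<in> X" using X T_mem[OF x'] by (simp add: z_def)
    have "(z, 0) \<in> S"
      using Sadd[OF xy Sscale[of x' y "-1"]] x' S(3) by (auto simp: z_def)
    obtain u where u: "(u, z) \<in> T" using T_onto[OF zX] by auto
    have uX: "u \<in> X" using T_mem[OF u] by simp
    have "Re (cnj c * ip z z) \<le> - Re (ip z u)" for c
    proof -
      have "(u + c *\<^sub>C z, z) \<in> S"
        using Sadd[OF subsetD[OF S(3) u] Sscale[OF \<open>(z, 0) \<in> S\<close>, of c]] by simp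
      then have "Re (ip z (u + c *\<^sub>C z)) \<le> 0" using S(2) by (auto simp: dissipative_def)
      then show ?thesis using zX uX by (simp add: ip_simps)
    qed note B = this
    have "ip z z = 0"
    proof (rule ccontr)
      assume nz: "ip z z \<noteq> 0"
      then have z: "0 < Re (ip z z)" using ip_definite[OF zX] zX by fastforce
      \<comment> \<open>The scalar makes the left side of \<open>B\<close> equal to
        \<open>1 - Re (ip z u)\<close>, which exceeds the bound by 1.\<close>
      show False using B[of "of_real ((1 - Re (ip z u)) / Re (ip z z))"] z by simp
    qed
    then have "z = 0" using ip_definite[OF zX] by fastforce
    then show ?thesis using x' by (simp add: z_def)
  qed
  then show ?thesis using S(3) by auto
qed

lemma maximal: "maximal_dissipative X ip T"
  using lin diss dissipative_extension by (auto simp: maximal_dissipative_def)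

text \<open>If \<open>p\<close> is the point closest to \<open>x\<close> in the closure of the domain, then \<open>x - p = T w\<close> is orthogonal to
  the domain, and dissipativity at \<open>w + c u\<close> for all scalars \<open>c\<close> makes \<open>w\<close> orthogonal to the range.\<close>

lemma dense_domain:
  assumes x: "x \<in> X" and e: "0 < e"
  shows "\<exists>y\<in>Domain T. N (y - x) < e"
proof -
  define D where "D = Domain T"
  have DX: "D \<subseteq> X" using T_mem by (auto simp: D_def)
  have Dadd: "\<And>a b. \<lbrakk>a \<in> D; b \<in> D\<rbrakk> \<Longrightarrow> a + b \<in> D" and Dscale: "\<And>a c. a \<in> D \<Longrightarrow> c *\<^sub>C a \<in> D"
    using T_add T_scale by (auto simp: D_def Domain_iff) blast+
  obtain z0 where "(z0, 0) \<in> T" using T_onto[of 0] by auto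
  then have D0: "D \<noteq> {}" by (auto simp: D_def)
  define d where "d = (INF y\<in>D. N (x - y))"
  have bdd: "bdd_below ((\<lambda>y. N (x - y)) ` D)"
    using x DX by (intro bdd_belowI[of _ 0]) auto
  have d_le: "d \<le> N (x - y)" if "y \<in> D" for y
    unfolding d_def using bdd that by (rule cINF_lower)
  have d0: "0 \<le> d" unfolding d_def using D0 x DX by (intro cINF_greatest) auto
  have "\<exists>y\<in>D. N (x - y) < d + 1 / real (Suc n)" for n
    using cINF_less_iff[OF D0 bdd, of "d + 1 / real (Suc n)"] by (simp add: d_def)
  then obtain y where y: "\<And>n. y n \<in> D" "\<And>n. N (x - y n) < d + 1 / real (Suc n)" by metis
  have yX [simp]: "y n \<in> X" for n using y DX by auto
  \<comment> \<open>The midpoint of \<open>y m\<close> and \<open>y n\<close> lies in the domain,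
    hence no closer to \<open>x\<close> than \<open>d\<close>; the parallelogram law turns this into
    a bound on \<open>N (y m - y n)\<close>. The factor \<open>4 * d + 2\<close> is twice the
    \<open>2 * d + 1\<close> in \<open>(d + r)^2 \<le> d^2 + (2 * d + 1) * r\<close> for
    \<open>r\<close> in [0, 1].\<close>
  have parallel: "(N (y m - y n))\<^sup>2 \<le> (4 * d + 2) * (1 / real (Suc m) + 1 / real (Suc n))" for m n
  proof -
    define p q where "p = 1 / real (Suc m)" and "q = 1 / real (Suc n)"
    define a b where "a = x - y m" and "b = x - y n"
    have X: "a \<in> X" "b \<in> X" using x by (auto simp: a_def b_def)
    have "(1/2) *\<^sub>C (y m + y n) \<in> D" using y Dadd Dscale by auto
    then have "d \<le> N (x - (1/2) *\<^sub>C (y m + y n))" by (rule d_le)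
    also have "x - (1/2) *\<^sub>C (y m + y n) = (1/2) *\<^sub>C (a + b)"
      using cvec.scale_left_distrib[of "1/2" "1/2" x]
      by (simp add: a_def b_def cvec.scale_right_distrib cvec.scale_right_diff_distrib)
    also have "N \<dots> = N (a + b) / 2" using X by (subst N_scale) auto
    finally have "4 * d\<^sup>2 \<le> (N (a + b))\<^sup>2"
      using power_mono[of "2 * d" "N (a + b)" 2] d0 by (simp add: power_mult_distrib)
    moreover have "(N (a + b))\<^sup>2 + (N (a - b))\<^sup>2 = 2 * (N a)\<^sup>2 + 2 * (N b)\<^sup>2"
      using X by (simp add: N_add_sq N_diff_sq)
    moreover have "N (a - b) = N (y m - y n)"
      using N_minus_commute[of "y n" "y m"] by (simp add: a_def b_def)
    moreover have "(N a)\<^sup>2 \<le> d\<^sup>2 + (2 * d + 1) * p" "(N b)\<^sup>2 \<le> d\<^sup>2 + (2 * d + 1) * q"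
    proof -
      have "(d + r)\<^sup>2 \<le> d\<^sup>2 + (2 * d + 1) * r" if "0 \<le> r" "r \<le> 1" for r
        using mult_right_mono[OF that(2) that(1)] by (simp add: power2_eq_square algebra_simps)
      note * = this
      show "(N a)\<^sup>2 \<le> d\<^sup>2 + (2 * d + 1) * p"
        using order_trans[OF power_mono[OF less_imp_le[OF y(2)[of m]]] *[of "1 / real (Suc m)"]] X x
        by (simp add: a_def p_def)
      show "(N b)\<^sup>2 \<le> d\<^sup>2 + (2 * d + 1) * q"
        using order_trans[OF power_mono[OF less_imp_le[OF y(2)[of n]]] *[of "1 / real (Suc n)"]] X x
        by (simp add: b_def q_def)
    qed
    ultimately show ?thesis unfolding p_def[symmetric] q_def[symmetric] by (simp add: algebra_simps)
  qed
  have "\<exists>M. \<forall>m\<ge>M. \<forall>n\<ge>M. N (y m - y n) < \<epsilon>" if \<epsilon>: "0 < \<epsilon>" for \<epsilon>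
  proof -
    have "(\<lambda>n. (8 * d + 4) * (1 / real (Suc n))) \<longlonglongrightarrow> (8 * d + 4) * 0"
      by (intro tendsto_intros LIMSEQ_Suc[OF lim_1_over_n])
    then have "\<forall>\<^sub>F n in sequentially. (8 * d + 4) * (1 / real (Suc n)) < \<epsilon>\<^sup>2"
      by (rule order_tendstoD) (use \<epsilon> in simp)
    then obtain M where M: "\<And>n. n \<ge> M \<Longrightarrow> (8 * d + 4) * (1 / real (Suc n)) < \<epsilon>\<^sup>2"
      by (auto simp: eventually_sequentially)
    have "N (y m - y n) < \<epsilon>" if "m \<ge> M" "n \<ge> M" for m n
    proof (rule power2_less_imp_less)
      show "(N (y m - y n))\<^sup>2 < \<epsilon>\<^sup>2"
      proof (rule le_less_trans)
        show "(N (y m - y n))\<^sup>2 \<le> ((8 * d + 4) * (1 / real (Suc m)) + (8 * d + 4) * (1 / real (Suc n))) / 2"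
        proof -
          have "z \<le> (4 * d + 2) * (p + q) \<Longrightarrow> z \<le> ((8 * d + 4) * p + (8 * d + 4) * q) / 2" for z p q :: real
            by (simp add: algebra_simps)
          then show ?thesis using parallel[of m n] by blast
        qed
        have "(a + b) / 2 < c" if "a < c" "b < c" for a b c :: real using that by simp
        then show "((8 * d + 4) * (1 / real (Suc m)) + (8 * d + 4) * (1 / real (Suc n))) / 2 < \<epsilon>\<^sup>2"
          using M[OF that(1)] M[OF that(2)] by blast
      qed
    qed (use \<epsilon> in simp)
    then show ?thesis by blast
  qed
  from complete[OF yX this] obtain p where p: "p \<in> X" "(\<lambda>n. N (y n - p)) \<longlonglongrightarrow> 0" by auto
  have orth: "ip (x - p) u = 0" if u: "u \<in> D" for u
  proof -
    have uX: "u \<in> X" using u DX by auto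
    have "Re (cnj c * ip (x - p) u) \<le> (cmod c)\<^sup>2 * (N u)\<^sup>2" for c
    proof -
      \<comment> \<open>The factor 2 makes the cross term and the quadratic term of the expansion
        carry the same factor 4.\<close>
      define cu where "cu = (2 * c) *\<^sub>C u"
      have le: "d \<le> N (x - p - cu)"
      proof (rule LIMSEQ_le_const)
        show "(\<lambda>n. N (x - p - cu) + N (y n - p)) \<longlonglongrightarrow> N (x - p - cu)"
          using tendsto_add[OF tendsto_const p(2)] by simp
        have "d \<le> N (x - p - cu) + N (y n - p)" for n
        proof -
          have "d \<le> N (x - (y n + cu))" using u y Dadd Dscale by (intro d_le) (auto simp: cu_def)
          also have "\<dots> \<le> N (x - (p + cu)) + N ((p + cu) - (y n + cu))"
            using x p uX by (intro N_triangle_diff) (auto simp: cu_def)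
          finally show ?thesis using p N_minus_commute[of p "y n"] by (simp add: algebra_simps)
        qed
        then show "\<exists>M. \<forall>n\<ge>M. d \<le> N (x - p - cu) + N (y n - p)" by blast
      qed
      have ge: "N (x - p) \<le> d"
      proof (rule LIMSEQ_le)
        show "(\<lambda>n. d + (1 / real (Suc n) + N (y n - p))) \<longlonglongrightarrow> d"
          using tendsto_add[OF tendsto_const tendsto_add[OF LIMSEQ_Suc[OF lim_1_over_n] p(2)], of d]
          by simp
        show "(\<lambda>n. N (x - p)) \<longlonglongrightarrow> N (x - p)" by simp
        have "N (x - p) \<le> d + (1 / real (Suc n) + N (y n - p))" for n
          using N_triangle_diff[of x "y n" p] y(2)[of n] x p by simp
        then show "\<exists>M. \<forall>n\<ge>M. N (x - p) \<le> d + (1 / real (Suc n) + N (y n - p))" by blast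
      qed
      have "(N (x - p))\<^sup>2 \<le> (N (x - p - cu))\<^sup>2"
        using le ge x p by (intro power_mono) auto
      also have "\<dots> = (N (x - p))\<^sup>2 - 2 * Re (cnj (2 * c) * ip (x - p) u) + (2 * cmod c)\<^sup>2 * (N u)\<^sup>2"
        using x p uX by (subst N_diff_sq) (auto simp: cu_def ip_simps N_scale norm_mult power_mult_distrib)
      finally show ?thesis by (simp add: power_mult_distrib)
    qed
    then show ?thesis
      by (intro linear_bound_imp_zero[of "ip (x - p) u" "(N u)\<^sup>2"]) (metis complex_cnj_cnj complex_mod_cnj)
  qed
  define z where "z = x - p"
  have zX: "z \<in> X" using x p by (simp add: z_def)
  obtain w where w: "(w, z) \<in> T" using T_onto zX by auto
  have wX: "w \<in> X" using T_mem[OF w] by simp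
  have "ip v w = 0" if uv: "(u, v) \<in> T" for u v
  proof (rule linear_bound_imp_zero)
    fix c
    have X: "u \<in> X" "v \<in> X" using T_mem[OF uv] by auto
    have "(w + c *\<^sub>C u, z + c *\<^sub>C v) \<in> T" by (intro T_add T_scale w uv)
    then have "Re (ip (z + c *\<^sub>C v) (w + c *\<^sub>C u)) \<le> 0" by (rule T_diss)
    moreover have "ip z w = 0" "ip z u = 0" using orth w uv by (auto simp: D_def z_def)
    ultimately have "Re (c * ip v w) \<le> - Re (c * cnj c * ip v u)"
      using X zX wX by (simp add: ip_simps algebra_simps)
    also have "\<dots> = (cmod c)\<^sup>2 * - Re (ip v u)"
      by (simp add: complex_norm_square[symmetric] del: of_real_power)
    finally show "Re (c * ip v w) \<le> (cmod c)\<^sup>2 * - Re (ip v u)" .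
  qed
  moreover obtain w' where "(w', w) \<in> T" using T_onto wX by auto
  ultimately have "ip w w = 0" by blast
  then have "w = 0" using ip_definite[OF wX] by fastforce
  then have "z = 0" using w T_unique T_scale[of w z 0] by simp
  then have "(\<lambda>n. N (y n - x)) \<longlonglongrightarrow> 0" using p by (simp add: z_def)
  then have "\<forall>\<^sub>F n in sequentially. N (y n - x) < e" by (rule order_tendstoD) (rule e)
  then obtain n where "N (y n - x) < e" by (auto simp: eventually_sequentially)
  then show ?thesis using y by (auto simp: D_def)
qed

text \<open>For \<open>y\<close> in the domain of the adjoint with image \<open>z\<close>,
  surjectivity supplies \<open>y'\<close> with \<open>T y' = - z\<close> and \<open>x\<close> with
  \<open>T x = y - y'\<close>. Both \<open>ip (T x) y\<close> and \<open>ip (T x) y'\<close> equal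
  \<open>ip x z\<close>, so \<open>y - y'\<close> is orthogonal to itself and \<open>y\<close> lies
  in the domain of \<open>T\<close>.\<close>

lemma skewadjointI:
  assumes skew: "\<And>x u y v. \<lbrakk>(x, u) \<in> T; (y, v) \<in> T\<rbrakk> \<Longrightarrow> ip u y = - ip x v"
  shows "skewadjoint X ip T"
  unfolding skewadjoint_def
proof (intro conjI lin)
  show "densely_defined X ip T"
    unfolding densely_defined_def using dense_domain by auto
  show "op_adjoint X ip T = op_neg T"
  proof (intro set_eqI iffI; clarify)
    fix y z assume "(y, z) \<in> op_adjoint X ip T"
    then have X: "y \<in> X" "z \<in> X" and adj: "\<And>x u. (x, u) \<in> T \<Longrightarrow> ip u y = ip x z"
      by (auto simp: op_adjoint_def)
    obtain y' where y': "(y', - z) \<in> T" using T_onto[of "- z"] X by auto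
    then have y'X: "y' \<in> X" using T_mem by auto
    obtain x where x: "(x, y - y') \<in> T" using T_onto[of "y - y'"] X y'X by auto
    have "ip (y - y') (y - y') = 0"
      using adj[OF x] skew[OF x y'] X y'X T_mem[OF x] by (simp add: ip_simps)
    then have "y - y' = 0" using ip_definite[of "y - y'"] X y'X by fastforce
    then show "(y, z) \<in> op_neg T" using y' by (force simp: op_neg_def)
  next
    fix y z assume "(y, z) \<in> op_neg T"
    then obtain v where v: "(y, v) \<in> T" "z = - v" by (auto simp: op_neg_def)
    then show "(y, z) \<in> op_adjoint X ip T"
      using T_mem[OF v(1)] T_mem skew[OF _ v(1)] by (fastforce simp: op_adjoint_def ip_simps)
  qed
qed

text \<open>Polarization: evaluating the vanishing real part at \<open>x + y\<close> gives the real
  part of the skew identity, and replacing \<open>y\<close> by \<open>\<i> *\<^sub>C y\<close> gives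
  its imaginary part.\<close>

lemma skewadjoint_if_conservative:
  assumes zero: "\<And>x u. (x, u) \<in> T \<Longrightarrow> Re (ip u x) = 0"
  shows "skewadjoint X ip T"
proof (rule skewadjointI)
  have re: "Re (ip u y) = - Re (ip x v)" if xu: "(x, u) \<in> T" and yv: "(y, v) \<in> T" for x u y v
  proof -
    note X = T_mem[OF xu] T_mem[OF yv]
    have "Re (ip (u + v) (x + y)) = 0" by (rule zero[OF T_add[OF xu yv]])
    then show ?thesis
      using zero[OF xu] zero[OF yv] Re_ip_commute[of v x] X by (simp add: ip_simps)
  qed
  fix x u y v assume xu: "(x, u) \<in> T" and yv: "(y, v) \<in> T"
  have "Re (ip u (\<i> *\<^sub>C y)) = - Re (ip x (\<i> *\<^sub>C v))" by (rule re[OF xu T_scale[OF yv]])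
  then have "Im (ip u y) = - Im (ip x v)" using T_mem[OF xu] T_mem[OF yv] by (simp add: ip_simps)
  then show "ip u y = - ip x v" using re[OF xu yv] by (simp add: complex_eq_iff)
qed

text \<open>With \<open>K = T\<inverse>\<close>, the equation \<open>K z - h z = y\<close> says that \<open>z\<close> is fixed by
  \<open>z \<mapsto> z - \<rho> (h z - K z + y)\<close>, a strict contraction for small \<open>\<rho>\<close> because \<open>-K\<close> is accretive.\<close>

lemma resolvent_exists:
  assumes h: "0 < h" and y: "y \<in> X"
  shows "\<exists>x u. (x, u) \<in> T \<and> x - of_real h *\<^sub>C u = y"
proof -
  obtain C where C: "0 \<le> C" "\<And>x y. (x, y) \<in> T \<Longrightarrow> N x \<le> C * N y" by (rule T_bound) blast
  define K where "K = (\<lambda>z. SOME x. (x, z) \<in> T)"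
  have K: "(K z, z) \<in> T" if "z \<in> X" for z
    unfolding K_def using T_onto[OF that] by (rule someI_ex)
  have KX [simp]: "K z \<in> X" if "z \<in> X" for z using T_mem[OF K[OF that]] by simp
  have Kdiff: "(K a - K b, a - b) \<in> T" if "a \<in> X" "b \<in> X" for a b
    using that by (intro T_diff K)
  \<comment> \<open>This value minimises \<open>1 - 2 * \<rho> * h + \<rho>^2 * (h + C)^2\<close>,
    the factor by which the map changes squared distances at most; the minimum is the square of
    \<open>q\<close> below.\<close>
  define \<rho> where "\<rho> = h / (h + C)\<^sup>2"
  have \<rho>: "0 < \<rho>" using h C by (simp add: \<rho>_def)
  define f where "f = (\<lambda>z. z - of_real \<rho> *\<^sub>C (of_real h *\<^sub>C z - K z + y))"
  have fX: "f z \<in> X" if "z \<in> X" for z using that y by (auto simp: f_def)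
  define q where "q = sqrt (1 - h\<^sup>2 / (h + C)\<^sup>2)"
  have hle: "h\<^sup>2 \<le> (h + C)\<^sup>2" using h C by (intro power_mono) auto
  have hC: "0 < (h + C)\<^sup>2" using h C by simp
  have q0: "0 \<le> 1 - h\<^sup>2 / (h + C)\<^sup>2" using hle hC by (simp add: divide_simps)
  have contr: "N (f a - f b) \<le> q * N (a - b)" if ab: "a \<in> X" "b \<in> X" for a b
  proof (rule power2_le_imp_le)
    define e k where "e = a - b" and "k = K a - K b"
    have ke: "(k, e) \<in> T" using Kdiff[OF ab] by (simp add: e_def k_def)
    have X: "e \<in> X" "k \<in> X" using ab by (auto simp: e_def k_def)
    define g where "g = of_real h *\<^sub>C e - k"
    have gX: "g \<in> X" using X by (simp add: g_def)
    have "f a - f b = e - of_real \<rho> *\<^sub>C g"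
      by (simp add: f_def e_def k_def g_def cvec.scale_right_diff_distrib cvec.scale_right_distrib)
    then have "(N (f a - f b))\<^sup>2 = (N e)\<^sup>2 - 2 * \<rho> * Re (ip e g) + \<rho>\<^sup>2 * (N g)\<^sup>2"
      using X gX \<rho> by (simp add: N_diff_sq ip_simps N_scale power_mult_distrib)
    moreover have "h * (N e)\<^sup>2 \<le> Re (ip e g)"
      using X T_diss[OF ke] by (simp add: g_def ip_simps N_sq)
    moreover have "(N g)\<^sup>2 \<le> ((h + C) * N e)\<^sup>2"
    proof (rule power_mono)
      have "N g \<le> h * N e + N k" unfolding g_def using X h N_diff_le[of "of_real h *\<^sub>C e" k]
        by (simp add: N_scale)
      then show "N g \<le> (h + C) * N e" using C(2)[OF ke] by (simp add: algebra_simps)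
    qed (use gX in simp)
    ultimately have "(N (f a - f b))\<^sup>2 \<le> (N e)\<^sup>2 - 2 * \<rho> * (h * (N e)\<^sup>2) + \<rho>\<^sup>2 * ((h + C) * N e)\<^sup>2"
      using \<rho> by (smt (verit) mult_left_mono zero_le_power2)
    also have "\<dots> = (1 - h\<^sup>2 / (h + C)\<^sup>2) * (N e)\<^sup>2"
    proof -
      have "\<rho>\<^sup>2 * (h + C)\<^sup>2 = h\<^sup>2 / (h + C)\<^sup>2" "\<rho> * h = h\<^sup>2 / (h + C)\<^sup>2"
        using hC by (simp_all add: \<rho>_def power2_eq_square)
      moreover have "(N e)\<^sup>2 - 2 * \<rho> * (h * (N e)\<^sup>2) + \<rho>\<^sup>2 * ((h + C) * N e)\<^sup>2 =
          (1 - 2 * (\<rho> * h) + \<rho>\<^sup>2 * (h + C)\<^sup>2) * (N e)\<^sup>2"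
        by (simp only: power_mult_distrib) (simp only: left_diff_distrib distrib_right mult.assoc mult_1)
      ultimately show ?thesis by simp
    qed
    also have "\<dots> = (q * N (a - b))\<^sup>2" using q0 by (simp add: q_def e_def power_mult_distrib)
    finally show "(N (f a - f b))\<^sup>2 \<le> (q * N (a - b))\<^sup>2" .
    show "0 \<le> q * N (a - b)" using q0 ab by (simp add: q_def)
  qed
  have "q < 1" using h hC by (simp add: q_def)
  then obtain z where z: "z \<in> X" "f z = z"
    using banach_fixed_point[of q f] fX contr by metis
  then have "of_real \<rho> *\<^sub>C (of_real h *\<^sub>C z - K z + y) = 0"
    by (simp add: f_def)
  then have "of_real h *\<^sub>C z - K z + y = 0" using \<rho> by simp
  then have "K z - of_real h *\<^sub>C z = y" by (simp add: algebra_simps eq_diff_eq)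
  then show ?thesis using K[OF z(1)] by blast
qed

section \<open>The resolvents and their algebra\<close>

lemma resolvent_bound:
  assumes h: "0 \<le> h" and xu: "(x, u) \<in> T"
  shows "N x \<le> N (x - of_real h *\<^sub>C u)"
proof -
  note X = T_mem[OF xu]
  have "N x * N x \<le> Re (ip (x - of_real h *\<^sub>C u) x)"
    using X h T_diss[OF xu] N_sq[OF X(1)]
    by (simp add: ip_simps power2_eq_square mult_nonneg_nonpos)
  also have "\<dots> \<le> N (x - of_real h *\<^sub>C u) * N x" using X by (intro Re_ip_le) auto
  finally show ?thesis
    using N_nonneg[OF X(1)] X by (metis N_nonneg diff_mem mult_le_cancel_right not_less order_antisym scale_mem)
qed

text \<open>With the identity as value at step 0, the estimates for \<open>J h\<close> hold for all
  \<open>h \<ge> 0\<close>, so time 0 is not a separate case in the approximation scheme.\<close>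

definition J :: "real \<Rightarrow> 'a \<Rightarrow> 'a"
  where "J h y = (if h = 0 then y else SOME x. \<exists>u. (x, u) \<in> T \<and> x - of_real h *\<^sub>C u = y)"

lemma J_0 [simp]: "J 0 y = y"
  by (simp add: J_def)

lemma J_solves:
  assumes "0 < h" "y \<in> X"
  obtains u where "(J h y, u) \<in> T" "J h y - of_real h *\<^sub>C u = y"
  using someI_ex[OF resolvent_exists[OF assms]] assms(1) that by (auto simp: J_def)

lemma J_inverse:
  assumes h: "0 \<le> h" and xu: "(x, u) \<in> T"
  shows "J h (x - of_real h *\<^sub>C u) = x"
proof (cases "h = 0")
  case False
  then have "0 < h" using h by simp
  moreover have "x - of_real h *\<^sub>C u \<in> X" using T_mem[OF xu] by auto
  ultimately obtain v where v: "(J h (x - of_real h *\<^sub>C u), v) \<in> T"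
      "J h (x - of_real h *\<^sub>C u) - of_real h *\<^sub>C v = x - of_real h *\<^sub>C u"
    by (rule J_solves)
  let ?x = "J h (x - of_real h *\<^sub>C u)"
  have "(?x - x) - of_real h *\<^sub>C (v - u) = 0"
    using v(2) by (simp add: cvec.scale_right_diff_distrib algebra_simps)
  then have "N (?x - x) \<le> 0"
    using resolvent_bound[OF h T_diff[OF v(1) xu]] by simp
  then show ?thesis
    using T_mem[OF v(1)] T_mem[OF xu] N_eq_0_iff[of "?x - x"] N_nonneg[of "?x - x"] by (simp del: N_nonneg)
qed simp

lemma J_contraction: "0 \<le> h \<Longrightarrow> contraction (J h)"
proof (cases "h = 0")
  case True
  then have "J h = (\<lambda>x. x)" by (simp add: fun_eq_iff)
  then show ?thesis by (simp add: contraction_id)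
next
  case False
  assume "0 \<le> h"
  then have h: "0 < h" using False by simp
  have eqI: "J h y = x" if "(x, u) \<in> T" "x - of_real h *\<^sub>C u = y" for x u y
    using J_inverse[of h x u] h that by simp
  show ?thesis
    unfolding contraction_def
  proof (intro conjI ballI allI)
    fix x y c assume x: "x \<in> X" and y: "y \<in> X"
    obtain u where u: "(J h x, u) \<in> T" "J h x - of_real h *\<^sub>C u = x" using J_solves[OF h x] by blast
    obtain v where v: "(J h y, v) \<in> T" "J h y - of_real h *\<^sub>C v = y" using J_solves[OF h y] by blast
    show "J h (x + y) = J h x + J h y"
      by (rule eqI[OF T_add[OF u(1) v(1)]])
        (use u(2) v(2) in \<open>simp add: cvec.scale_right_distrib algebra_simps\<close>)
  next
    fix x c assume x: "x \<in> X"
    obtain u where u: "(J h x, u) \<in> T" "J h x - of_real h *\<^sub>C u = x" using J_solves[OF h x] by blast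
    show "J h x \<in> X" using T_mem[OF u(1)] by simp
    show "N (J h x) \<le> N x" using resolvent_bound[OF _ u(1), of h] h u(2) by simp
    have "c *\<^sub>C J h x - of_real h *\<^sub>C (c *\<^sub>C u) = c *\<^sub>C x"
      using arg_cong[OF u(2), of "scaleC c"] by (simp add: cvec.scale_right_diff_distrib mult.commute)
    then show "J h (c *\<^sub>C x) = c *\<^sub>C J h x"
      by (rule eqI[OF T_scale[OF u(1)]])
  qed
qed

lemma J_mem [simp]: "\<lbrakk>0 \<le> h; x \<in> X\<rbrakk> \<Longrightarrow> J h x \<in> X"
  using contractionD(1)[OF J_contraction] .

lemma J_increment:
  assumes h: "0 \<le> h" and xu: "(x, u) \<in> T"
  shows "J h x - x = of_real h *\<^sub>C J h u"
proof -
  note X = T_mem[OF xu] and c = J_contraction[OF h]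
  have "x = J h x - of_real h *\<^sub>C J h u"
    using J_inverse[OF h xu] X by (simp add: contraction_diff[OF c] contractionD(4)[OF c])
  then show ?thesis by (simp add: algebra_simps eq_diff_eq)
qed

text \<open>\<open>J h u\<close> is itself in the domain, so \<open>x + h * J h u\<close>, which is
  \<open>J h x\<close> by \<open>J_increment\<close>, is mapped by \<open>T\<close> to
  \<open>u + h * T (J h u)\<close>. This is \<open>J h u\<close> again, by its defining
  equation.\<close>

lemma J_commute_T:
  assumes h: "0 \<le> h" and xu: "(x, u) \<in> T"
  shows "(J h x, J h u) \<in> T"
proof (cases "h = 0")
  case False
  then have h': "0 < h" using h by simp
  note X = T_mem[OF xu] and c = J_contraction[OF h]
  obtain w where w: "(J h u, w) \<in> T" "J h u - of_real h *\<^sub>C w = u" using J_solves[OF h' X(2)] by blast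
  have "J h x = x + of_real h *\<^sub>C J h u" using J_increment[OF h xu] by (simp add: diff_eq_eq add.commute)
  moreover have "J h u = u + of_real h *\<^sub>C w" using w(2) by (simp add: algebra_simps diff_eq_eq)
  ultimately show ?thesis using T_add[OF xu T_scale[OF w(1)]] by simp
qed (use xu in simp)

lemma J_commute:
  assumes h: "0 \<le> h" and k: "0 \<le> k" and x: "x \<in> X"
  shows "J h (J k x) = J k (J h x)"
proof (cases "h = 0")
  case False
  then have h': "0 < h" using h by simp
  obtain u where u: "(J h x, u) \<in> T" "J h x - of_real h *\<^sub>C u = x" using J_solves[OF h' x] by blast
  note X = T_mem[OF u(1)] and c = J_contraction[OF k]
  have "J k x = J k (J h x) - of_real h *\<^sub>C J k u"
    using arg_cong[OF u(2), of "J k"] X by (simp add: contraction_diff[OF c] contractionD(4)[OF c])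
  then show ?thesis using J_inverse[OF h J_commute_T[OF k u(1)]] by simp
qed simp

lemma J_diff_id_le:
  assumes h: "0 \<le> h" and xu: "(x, u) \<in> T"
  shows "N (J h x - x) \<le> h * N u"
proof -
  note X = T_mem[OF xu] and c = J_contraction[OF h]
  show ?thesis unfolding J_increment[OF h xu] using X h contractionD(2)[OF c X(2)] by (simp add: N_scale mult_left_mono)
qed

lemma J_expansion_le:
  assumes h: "0 \<le> h" and xu: "(x, u) \<in> T" and uv: "(u, v) \<in> T"
  shows "N (J h x - x - of_real h *\<^sub>C u) \<le> h\<^sup>2 * N v"
proof -
  note X = T_mem[OF xu] and c = J_contraction[OF h]
  have "J h x - x - of_real h *\<^sub>C u = of_real h *\<^sub>C (J h u - u)"
    by (simp add: J_increment[OF h xu] cvec.scale_right_diff_distrib)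
  then show ?thesis
    using X h mult_left_mono[OF J_diff_id_le[OF h uv] h] by (simp add: N_scale power2_eq_square mult.assoc)
qed

text \<open>On \<open>D(T\<^sup>2)\<close>: \<open>J\<^sub>h J\<^sub>k - J\<^sub>h\<^sub>+\<^sub>k = - h k J\<^sub>h J\<^sub>k J\<^sub>h\<^sub>+\<^sub>k T\<^sup>2\<close>, since
  \<open>(1 - h T) (1 - k T) - (1 - (h + k) T) = h k T\<^sup>2\<close>.\<close>

lemma J_add_le:
  assumes h: "0 \<le> h" and k: "0 \<le> k" and xu: "(x, u) \<in> T" and uv: "(u, v) \<in> T"
  shows "N (J h (J k x) - J (h + k) x) \<le> h * k * N v"
proof -
  define P where "P = (\<lambda>x. J h (J k x))"
  define Q where "Q = J (h + k)"
  have hk: "0 \<le> h + k" using h k by simp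
  have cP: "contraction P" unfolding P_def using h k by (rule contraction_comp[OF J_contraction J_contraction])
  have cQ: "contraction Q" unfolding Q_def by (rule J_contraction[OF hk])
  have comm: "P (Q z) = Q (P z)" if "z \<in> X" for z
    using that h k by (simp add: P_def Q_def J_commute[of "h + k"])
  have X: "x \<in> X" "u \<in> X" "v \<in> X" using T_mem[OF xu] T_mem[OF uv] by auto
  define y where "y = x - of_real (h + k) *\<^sub>C u"
  have yX: "y \<in> X" using X by (simp add: y_def)
  have Qy: "Q y = x" unfolding Q_def y_def by (rule J_inverse[OF hk xu])
  define y' where "y' = x - of_real k *\<^sub>C u"
  have Py: "P (y + of_real (h * k) *\<^sub>C v) = x"
  proof -
    have "(y', u - of_real k *\<^sub>C v) \<in> T"
      unfolding y'_def by (intro T_diff T_scale xu uv)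
    then have "J h (y' - of_real h *\<^sub>C (u - of_real k *\<^sub>C v)) = y'"
      by (rule J_inverse[OF h])
    moreover have "y' - of_real h *\<^sub>C (u - of_real k *\<^sub>C v) = y + of_real (h * k) *\<^sub>C v"
      by (simp add: y_def y'_def cvec.scale_right_diff_distrib cvec.scale_left_distrib algebra_simps)
    ultimately have "J h (y + of_real (h * k) *\<^sub>C v) = y'" by simp
    moreover have "J h (J k z) = J k (J h z)" if "z \<in> X" for z using J_commute[OF h k that] .
    ultimately show ?thesis
      unfolding P_def using yX X J_inverse[OF k xu] by (simp add: y'_def)
  qed
  \<comment> \<open>With one \<open>x\<close> written as \<open>P (y + h * k * v)\<close> and the
    other as \<open>Q y\<close>, the terms in \<open>y\<close> cancel by commutation, and
    \<open>Q P\<close> is left acting on \<open>h * k * v\<close>.\<close>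
  have "Q x - P x = Q (P (y + of_real (h * k) *\<^sub>C v)) - P (Q y)" by (simp only: Py Qy)
  also have "\<dots> = of_real (h * k) *\<^sub>C Q (P v)"
    using X yX comm[OF yX]
    by (simp add: contractionD(1,3,4)[OF cP] contractionD(3,4)[OF cQ] del: of_real_mult)
  finally have "N (Q x - P x) = h * k * N (Q (P v))"
    using X h k contractionD(1)[OF cP] contractionD(1)[OF cQ] by (simp add: N_scale norm_mult)
  also have "N (Q (P v)) \<le> N v"
    using contractionD(2)[OF cQ contractionD(1)[OF cP X(3)]] contractionD(2)[OF cP X(3)] by simp
  finally show ?thesis
    using N_minus_commute[of "Q x" "P x"] X h k contractionD(1)[OF cP] contractionD(1)[OF cQ]
    by (simp add: P_def Q_def mult_left_mono)
qed

text \<open>Density in the graph norm: \<open>u\<close> is approximated by a \<open>v\<close> in the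
  domain, and \<open>y\<close> is the preimage of \<open>v\<close>. The bounded inverse carries the
  approximation back to \<open>x\<close>. The tolerance \<open>e / (C + 1)\<close> serves both
  estimates, also when \<open>C = 0\<close>.\<close>

lemma core_dense:
  assumes xu: "(x, u) \<in> T" and e: "0 < e"
  shows "\<exists>y v w. (y, v) \<in> T \<and> (v, w) \<in> T \<and> N (v - u) < e \<and> N (y - x) < e"
proof -
  note X = T_mem[OF xu]
  obtain C where C: "0 \<le> C" "\<And>x y. (x, y) \<in> T \<Longrightarrow> N x \<le> C * N y" by (rule T_bound) blast
  have "0 < e / (C + 1)" using e C by simp
  then obtain v where v: "v \<in> Domain T" "N (v - u) < e / (C + 1)" using dense_domain X by blast
  then obtain w where w: "(v, w) \<in> T" by auto
  have vX: "v \<in> X" using T_mem[OF w] by simp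
  obtain y where y: "(y, v) \<in> T" using T_onto[OF vX] by auto
  have "N (y - x) \<le> C * N (v - u)" by (rule C(2)[OF T_diff[OF y xu]])
  moreover have "(C + 1) * N (v - u) < e" using v C by (simp add: field_simps)
  moreover have "0 \<le> N (v - u)" "0 \<le> C * N (v - u)" using vX X C by simp_all
  ultimately show ?thesis using y w by (intro exI[of _ y] exI[of _ v] exI[of _ w]) (simp add: algebra_simps)
qed

subsection \<open>The generated semigroup\<close>

definition D2 :: "'a set"
  where "D2 = {x. \<exists>u v. (x, u) \<in> T \<and> (u, v) \<in> T}"

lemma D2_subset: "D2 \<subseteq> X"
  using T_mem by (auto simp: D2_def)

lemma D2_dense: assumes "x \<in> X" "0 < e" shows "\<exists>y\<in>D2. N (y - x) < e"
proof -
  obtain z where z: "z \<in> Domain T" "N (z - x) < e / 2" using dense_domain[of x "e/2"] assms by auto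
  then obtain u where u: "(z, u) \<in> T" by auto
  obtain y v w where y: "(y, v) \<in> T" "(v, w) \<in> T" "N (y - z) < e / 2"
    using core_dense[OF u, of "e/2"] assms by auto
  have "N (y - x) \<le> N (y - z) + N (z - x)"
    using T_mem[OF y(1)] T_mem[OF u] assms by (intro N_triangle_diff) auto
  then show ?thesis using y z by (intro bexI[of _ y]) (auto simp: D2_def)
qed

definition euler :: "real \<Rightarrow> nat \<Rightarrow> 'a \<Rightarrow> 'a"
  where "euler t k = J (t / 2 ^ k) ^^ (2 ^ k)"

lemma euler_contraction: "0 \<le> t \<Longrightarrow> contraction (euler t k)"
  unfolding euler_def by (intro contraction_funpow J_contraction) simp

lemma euler_mem [simp]: "\<lbrakk>0 \<le> t; x \<in> X\<rbrakk> \<Longrightarrow> euler t k x \<in> X"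
  using contractionD(1)[OF euler_contraction] .

text \<open>There are \<open>2 ^ k\<close> replacements of one factor by two, each with error at
  most \<open>(t / 2 ^ Suc k)^2 * N v\<close>.\<close>

lemma euler_step:
  assumes t: "0 \<le> t" and xu: "(x, u) \<in> T" and uv: "(u, v) \<in> T"
  shows "N (euler t (Suc k) x - euler t k x) \<le> t\<^sup>2 * N v / (4 * 2 ^ k)"
proof -
  define s where "s = t / 2 ^ Suc k"
  have s: "0 \<le> s" "t / 2 ^ k = s + s" using t by (simp_all add: s_def)
  have x: "x \<in> X" using T_mem[OF xu] by simp
  have "J s ^^ (2 * m) = (\<lambda>x. J s (J s x)) ^^ m" for m
    by (induction m) (simp_all add: o_def fun_eq_iff)
  from this[of "2 ^ k"] have e: "euler t (Suc k) = (\<lambda>x. J s (J s x)) ^^ (2 ^ k)"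
    by (simp add: euler_def s_def)
  have "N (euler t (Suc k) x - euler t k x) \<le> real (2 ^ k) * N (J s (J s x) - J (s + s) x)"
    unfolding e unfolding euler_def s(2)
    by (rule funpow_diff_le[OF contraction_comp[OF J_contraction J_contraction] J_contraction])
      (use s x in \<open>auto simp: J_commute[of s "2 * s"]\<close>)
  also have "\<dots> \<le> real (2 ^ k) * (s * s * N v)"
    by (intro mult_left_mono J_add_le[OF s(1) s(1) xu uv]) simp
  also have "\<dots> = t\<^sup>2 * N v / (4 * 2 ^ k)"
    by (simp add: s_def power2_eq_square)
  finally show ?thesis .
qed

lemma euler_cauchy_D2:
  assumes t: "0 \<le> t" and xu: "(x, u) \<in> T" and uv: "(u, v) \<in> T"
  shows "N (euler t (k + m) x - euler t k x) \<le> t\<^sup>2 * N v / (2 * 2 ^ k)"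
proof -
  have X: "x \<in> X" "v \<in> X" using T_mem[OF xu] T_mem[OF uv] by auto
  \<comment> \<open>The factor \<open>1 - 1 / 2 ^ m\<close> is the partial sum of the geometric
    series of step errors; it closes the induction and is then estimated by 1.\<close>
  have "N (euler t (k + m) x - euler t k x) \<le> t\<^sup>2 * N v / (2 * 2 ^ k) * (1 - 1 / 2 ^ m)"
  proof (induction m)
    case (Suc m)
    have "N (euler t (k + Suc m) x - euler t k x) \<le>
        N (euler t (Suc (k + m)) x - euler t (k + m) x) + N (euler t (k + m) x - euler t k x)"
      using X t by (simp add: N_triangle_diff)
    also have "\<dots> \<le> t\<^sup>2 * N v / (4 * 2 ^ (k + m)) + t\<^sup>2 * N v / (2 * 2 ^ k) * (1 - 1 / 2 ^ m)"
      by (intro add_mono euler_step[OF t xu uv] Suc)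
    also have "\<dots> = t\<^sup>2 * N v / (2 * 2 ^ k) * (1 - 1 / 2 ^ Suc m)"
      by (simp add: power_add field_simps)
    finally show ?case .
  qed simp
  also have "\<dots> \<le> t\<^sup>2 * N v / (2 * 2 ^ k) * 1"
    using X by (intro mult_left_mono) auto
  finally show ?thesis by simp
qed

lemma euler_converges:
  assumes t: "0 \<le> t" and x: "x \<in> X"
  shows "\<exists>l\<in>X. (\<lambda>k. N (euler t k x - l)) \<longlonglongrightarrow> 0"
proof (rule complete)
  fix e :: real assume e: "0 < e"
  obtain y where "y \<in> D2" "N (y - x) < e / 8" using D2_dense[OF x, of "e/8"] e by auto
  then obtain u v where y: "(y, u) \<in> T" "(u, v) \<in> T" "N (y - x) < e / 8" by (auto simp: D2_def)
  have X: "y \<in> X" "v \<in> X" using T_mem[OF y(1)] T_mem[OF y(2)] by auto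
  have "(\<lambda>k. t\<^sup>2 * N v / 2 * (1 / 2) ^ k) \<longlonglongrightarrow> t\<^sup>2 * N v / 2 * 0"
    by (intro tendsto_intros LIMSEQ_power_zero) simp
  then have "\<forall>\<^sub>F k in sequentially. t\<^sup>2 * N v / 2 * (1 / 2) ^ k < e / 4"
    by (rule order_tendstoD) (use e in simp)
  then obtain M where M: "t\<^sup>2 * N v / (2 * 2 ^ M) < e / 4"
    by (auto simp: eventually_sequentially power_divide)
  define r where "r = t\<^sup>2 * N v / (2 * 2 ^ M)"
  have close: "N (euler t n x - euler t M x) < e / 2" if n: "n \<ge> M" for n
  proof -
    have "N (euler t n x - euler t M x) \<le> N (euler t n x - euler t n y) +
        (N (euler t n y - euler t M y) + N (euler t M y - euler t M x))"
      using N_triangle_diff[of "euler t n x" "euler t n y" "euler t M x"]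
        N_triangle_diff[of "euler t n y" "euler t M y" "euler t M x"] x X t by simp
    also have "\<dots> \<le> N (x - y) + (r + N (y - x))"
      unfolding r_def using euler_cauchy_D2[OF t y(1,2), of M "n - M"] n x X t
      by (intro add_mono contraction_dist_le euler_contraction) auto
    also have "\<dots> < e / 2" using M[folded r_def] y(3) N_minus_commute[OF x X(1)] by simp
    finally show ?thesis .
  qed
  have "N (euler t m x - euler t n x) < e" if "m \<ge> M" "n \<ge> M" for m n
    using N_triangle_diff[of "euler t m x" "euler t M x" "euler t n x"] close[OF that(1)] close[OF that(2)]
      N_minus_commute[of "euler t n x" "euler t M x"] x t by simp
  then show "\<exists>M. \<forall>m\<ge>M. \<forall>n\<ge>M. N (euler t m x - euler t n x) < e" by blast
qed (use t x in simp)

definition semigroup :: "real \<Rightarrow> 'a \<Rightarrow> 'a"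
  where "semigroup t x = (SOME l. l \<in> X \<and> (\<lambda>k. N (euler t k x - l)) \<longlonglongrightarrow> 0)"

lemma semigroup:
  assumes "0 \<le> t" "x \<in> X"
  shows semigroup_mem: "semigroup t x \<in> X"
    and semigroup_lim: "(\<lambda>k. N (euler t k x - semigroup t x)) \<longlonglongrightarrow> 0"
proof -
  have "\<exists>l. l \<in> X \<and> (\<lambda>k. N (euler t k x - l)) \<longlonglongrightarrow> 0" using euler_converges[OF assms] by auto
  from someI_ex[OF this] show "semigroup t x \<in> X" "(\<lambda>k. N (euler t k x - semigroup t x)) \<longlonglongrightarrow> 0"
    by (auto simp: semigroup_def)
qed

lemma semigroup_eqI:
  assumes "0 \<le> t" "x \<in> X" "l \<in> X" "(\<lambda>k. N (euler t k x - l)) \<longlonglongrightarrow> 0"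
  shows "semigroup t x = l"
  using semigroup[OF assms(1,2)] assms by (intro lim_unique[of "\<lambda>k. euler t k x"]) auto

lemma semigroup_dist_le:
  assumes t: "0 \<le> t" and X: "x \<in> X" "z \<in> X" and le: "\<And>k. N (euler t k x - z) \<le> r"
  shows "N (semigroup t x - z) \<le> r"
proof -
  note S = semigroup[OF t X(1)]
  have "(\<lambda>k. N (euler t k x - semigroup t x) + r) \<longlonglongrightarrow> 0 + r" by (intro tendsto_intros S)
  moreover have "N (semigroup t x - z) \<le> N (euler t k x - semigroup t x) + r" for k
    using N_triangle_diff[of "semigroup t x" "euler t k x" z] le[of k] S X t
      N_minus_commute[of "semigroup t x" "euler t k x"] by simp
  ultimately have "N (semigroup t x - z) \<le> 0 + r" using LIMSEQ_le_const by blast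
  then show ?thesis by simp
qed

lemma semigroup_contraction:
  assumes t: "0 \<le> t"
  shows "contraction (semigroup t)"
  unfolding contraction_def
proof (intro conjI ballI allI)
  note E = euler_contraction[OF t]
  fix x assume x: "x \<in> X"
  note S = semigroup[OF t x]
  show "semigroup t x \<in> X" by (rule S)
  show "N (semigroup t x) \<le> N x"
    using semigroup_dist_le[OF t x, of 0 "N x"] contractionD(2)[OF E x] by simp
  show "semigroup t (c *\<^sub>C x) = c *\<^sub>C semigroup t x" for c
  proof (rule semigroup_eqI)
    have "N (euler t k (c *\<^sub>C x) - c *\<^sub>C semigroup t x) = cmod c * N (euler t k x - semigroup t x)" for k
      using S x t by (simp add: contractionD(4)[OF E] N_scale[symmetric] cvec.scale_right_diff_distrib)
    then show "(\<lambda>k. N (euler t k (c *\<^sub>C x) - c *\<^sub>C semigroup t x)) \<longlonglongrightarrow> 0"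
      using tendsto_mult_right_zero[OF S(2), of "cmod c"] by simp
  qed (use t x S in auto)
  fix y assume y: "y \<in> X"
  note S' = semigroup[OF t y]
  show "semigroup t (x + y) = semigroup t x + semigroup t y"
  proof (rule semigroup_eqI)
    have le: "N (euler t k (x + y) - (semigroup t x + semigroup t y)) \<le>
        N (euler t k x - semigroup t x) + N (euler t k y - semigroup t y)" for k
      using N_triangle[of "euler t k x - semigroup t x" "euler t k y - semigroup t y"] S S' x y t
      by (simp add: contractionD(3)[OF E] algebra_simps)
    show "(\<lambda>k. N (euler t k (x + y) - (semigroup t x + semigroup t y))) \<longlonglongrightarrow> 0"
      by (rule tendsto_sandwich[OF _ _ tendsto_const tendsto_add_zero[OF S(2) S'(2)]])
        (use le S S' x y t in \<open>auto intro!: always_eventually\<close>)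
  qed (use t x y S S' in auto)
qed

lemma semigroup_0: "x \<in> X \<Longrightarrow> semigroup 0 x = x"
proof (rule semigroup_eqI)
  have "J 0 ^^ n = id" for n by (induction n) (simp_all add: fun_eq_iff)
  then show "(\<lambda>k. N (euler 0 k x - x)) \<longlonglongrightarrow> 0" by (simp add: euler_def)
qed auto

text \<open>On D(T^2) the powers of \<open>J a (J b x)\<close> and \<open>J (a + b) x\<close> differ
  by at most \<open>2 ^ k\<close> times \<open>s / 2 ^ k * t / 2 ^ k * N v\<close>, which tends to
  0. The law extends from \<open>D2\<close> because both sides are contractions.\<close>

lemma semigroup_add:
  assumes s: "0 \<le> s" and t: "0 \<le> t" and x: "x \<in> X"
  shows "semigroup (s + t) x = semigroup s (semigroup t x)"
proof (rule contraction_eq_on_dense[OF _ _ D2_dense D2_subset _ x])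
  show "contraction (semigroup (s + t))" "contraction (\<lambda>x. semigroup s (semigroup t x))"
    using s t contraction_comp[OF semigroup_contraction semigroup_contraction, of s t]
    by (auto intro!: semigroup_contraction)
  fix x assume "x \<in> D2"
  then obtain u v where uv: "(x, u) \<in> T" "(u, v) \<in> T" by (auto simp: D2_def)
  have X: "x \<in> X" "v \<in> X" using T_mem[OF uv(1)] T_mem[OF uv(2)] by auto
  have st: "0 \<le> s + t" using s t by simp
  note S = semigroup[OF t X(1)]
  note S' = semigroup[OF s S(1)]
  show "semigroup (s + t) x = semigroup s (semigroup t x)"
  proof (rule semigroup_eqI[OF st X(1) S'(1)])
    have 1: "N (euler (s + t) k x - euler s k (euler t k x)) \<le> s * t * N v * (1 / 2) ^ k" for k
    proof -
      define a b where "a = s / 2 ^ k" and "b = t / 2 ^ k"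
      have ab: "0 \<le> a" "0 \<le> b" "(s + t) / 2 ^ k = a + b"
        using s t by (simp_all add: a_def b_def add_divide_distrib)
      have e: "euler s k (euler t k x) = ((\<lambda>x. J a (J b x)) ^^ (2 ^ k)) x"
        unfolding euler_def a_def[symmetric] b_def[symmetric]
        using ab X by (intro funpow_comp_on[symmetric] J_contraction J_commute) auto
      have "N (euler s k (euler t k x) - euler (s + t) k x) \<le>
          real (2 ^ k) * N (J a (J b x) - J (a + b) x)"
        unfolding e unfolding euler_def ab(3)
        by (rule funpow_diff_le[OF contraction_comp[OF J_contraction J_contraction] J_contraction])
          (use ab X in \<open>auto simp: J_commute[of a "a + b"] J_commute[of b "a + b"]\<close>)
      also have "\<dots> \<le> real (2 ^ k) * (a * b * N v)"
        by (intro mult_left_mono J_add_le[OF ab(1,2) uv]) simp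
      also have "\<dots> = s * t * N v * (1 / 2) ^ k"
        by (simp add: a_def b_def power_divide)
      finally show ?thesis
        using N_minus_commute[of "euler s k (euler t k x)" "euler (s + t) k x"] X s t by simp
    qed
    have 2: "N (euler s k (euler t k x) - euler s k (semigroup t x)) \<le> N (euler t k x - semigroup t x)" for k
      using s t X S by (intro contraction_dist_le euler_contraction) auto
    have le: "N (euler (s + t) k x - semigroup s (semigroup t x)) \<le>
        s * t * N v * (1 / 2) ^ k + N (euler t k x - semigroup t x)
          + N (euler s k (semigroup t x) - semigroup s (semigroup t x))" for k
      using N_triangle_diff[of "euler (s + t) k x" "euler s k (euler t k x)" "semigroup s (semigroup t x)"]
        N_triangle_diff[of "euler s k (euler t k x)" "euler s k (semigroup t x)" "semigroup s (semigroup t x)"]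
        1[of k] 2[of k] X S S' s t by simp
    have "(\<lambda>k. s * t * N v * (1 / 2) ^ k + N (euler t k x - semigroup t x)
          + N (euler s k (semigroup t x) - semigroup s (semigroup t x))) \<longlonglongrightarrow> s * t * N v * 0 + 0 + 0"
      by (intro tendsto_intros LIMSEQ_power_zero S S') simp
    then have lim: "(\<lambda>k. s * t * N v * (1 / 2) ^ k + N (euler t k x - semigroup t x)
          + N (euler s k (semigroup t x) - semigroup s (semigroup t x))) \<longlonglongrightarrow> 0" by simp
    show "(\<lambda>k. N (euler (s + t) k x - semigroup s (semigroup t x))) \<longlonglongrightarrow> 0"
      by (rule tendsto_sandwich[OF _ _ tendsto_const lim])
        (use le X S' st in \<open>auto intro!: always_eventually\<close>)
  qed
qed

text \<open>The identity serves as the second contraction in \<open>funpow_diff_le\<close>: each of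
  the \<open>2 ^ k\<close> factors moves \<open>x\<close> by at most
  \<open>t / 2 ^ k * N u\<close>.\<close>

lemma semigroup_diff_id_le:
  assumes t: "0 \<le> t" and xu: "(x, u) \<in> T"
  shows "N (semigroup t x - x) \<le> t * N u"
proof (rule semigroup_dist_le[OF t])
  note X = T_mem[OF xu]
  show "x \<in> X" "x \<in> X" by (fact X)+
  fix k
  have id: "(\<lambda>x. x) ^^ n = (\<lambda>x::'a. x)" for n by (induction n) (simp_all add: fun_eq_iff)
  have "N ((J (t / 2 ^ k) ^^ (2 ^ k)) x - ((\<lambda>x. x) ^^ (2 ^ k)) x) \<le> real (2 ^ k) * N (J (t / 2 ^ k) x - x)"
    using t X by (intro funpow_diff_le J_contraction contraction_id) auto
  also have "\<dots> \<le> real (2 ^ k) * (t / 2 ^ k * N u)"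
    by (intro mult_left_mono J_diff_id_le xu) (use t in auto)
  finally show "N (euler t k x - x) \<le> t * N u" by (simp add: euler_def id)
qed

text \<open>The single step \<open>J t\<close> is the approximation with \<open>k = 0\<close> and
  serves as the intermediate point: the limit lies within \<open>t^2 * N v / 2\<close> of it, and it
  lies within \<open>t^2 * N v\<close> of the first order expansion.\<close>

lemma semigroup_expansion_le:
  assumes t: "0 \<le> t" and xu: "(x, u) \<in> T" and uv: "(u, v) \<in> T"
  shows "N (semigroup t x - x - of_real t *\<^sub>C u) \<le> 2 * t\<^sup>2 * N v"
proof -
  have X: "x \<in> X" "u \<in> X" "v \<in> X" using T_mem[OF xu] T_mem[OF uv] by auto
  note S = semigroup[OF t X(1)]
  have "N (semigroup t x - J t x) \<le> t\<^sup>2 * N v"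
  proof (rule semigroup_dist_le[OF t X(1)])
    show "J t x \<in> X" using t X by simp
    show "N (euler t k x - J t x) \<le> t\<^sup>2 * N v" for k
    proof -
      have "N (euler t k x - J t x) \<le> t\<^sup>2 * N v / 2"
        using euler_cauchy_D2[OF t xu uv, of 0 k] by (simp add: euler_def)
      also have "\<dots> \<le> t\<^sup>2 * N v" using X by simp
      finally show ?thesis .
    qed
  qed
  moreover have "N (J t x - (x + of_real t *\<^sub>C u)) \<le> t\<^sup>2 * N v"
    using J_expansion_le[OF t xu uv] by (simp add: diff_diff_add)
  moreover have "N (semigroup t x - (x + of_real t *\<^sub>C u)) \<le>
      N (semigroup t x - J t x) + N (J t x - (x + of_real t *\<^sub>C u))"
    using X S t by (intro N_triangle_diff) auto
  ultimately show ?thesis by (simp add: diff_diff_add)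
qed

lemma semigroup_continuous:
  assumes x: "x \<in> X"
  shows "((\<lambda>t. N (semigroup t x - x)) \<longlongrightarrow> 0) (at_right 0)"
proof (rule tendstoI)
  fix e :: real assume e: "0 < e"
  obtain y where y: "y \<in> Domain T" "N (y - x) < e / 4" using dense_domain[OF x, of "e/4"] e by auto
  then obtain u where u: "(y, u) \<in> T" by auto
  note X = T_mem[OF u]
  have "((\<lambda>t. t * N u) \<longlongrightarrow> 0 * N u) (at_right 0)" by (intro tendsto_intros)
  then have "\<forall>\<^sub>F t in at_right 0. t * N u < e / 2" by (rule order_tendstoD) (use e in simp)
  moreover have "\<forall>\<^sub>F t in at_right (0::real). 0 < t" by (rule eventually_at_right_less)
  ultimately show "\<forall>\<^sub>F t in at_right 0. dist (N (semigroup t x - x)) 0 < e"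
  proof eventually_elim
    case (elim t)
    then have t: "0 \<le> t" by simp
    note S = semigroup_mem[OF t x] semigroup_mem[OF t X(1)]
    have "N (semigroup t x - x) \<le> N (semigroup t x - semigroup t y) + (N (semigroup t y - y) + N (y - x))"
      using N_triangle_diff[of "semigroup t x" "semigroup t y" x] N_triangle_diff[of "semigroup t y" y x] S X x
      by simp
    also have "\<dots> \<le> N (x - y) + (t * N u + N (y - x))"
      by (intro add_mono contraction_dist_le semigroup_contraction semigroup_diff_id_le t x X u order_refl)
    also have "\<dots> < e" using y(2) elim N_minus_commute[OF x X(1)] by simp
    finally show ?case using S x by simp
  qed
qed

lemma semigroup_is_contraction_C0: "contraction_C0_semigroup X ip semigroup"
  unfolding contraction_C0_semigroup_def
  using semigroup_contraction semigroup_0 semigroup_add semigroup_continuous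
  by (simp add: contraction_def image_subset_iff)

section \<open>Identification of the generator\<close>

abbreviation quotient :: "real \<Rightarrow> 'a \<Rightarrow> 'a"
  where "quotient t x \<equiv> of_real (1 / t) *\<^sub>C (semigroup t x - x)"

abbreviation gen :: "'a rel" where "gen \<equiv> semigroup_generator X ip semigroup"

text \<open>The second order expansion is available only on D(T^2). For \<open>z\<close> in the
  domain the quotients satisfy \<open>N (quotient t z) \<le> N (T z)\<close> uniformly in
  \<open>t > 0\<close>, so approximation in the graph norm extends the limit to all of
  \<open>T\<close>.\<close>

lemma T_subset_generator: "T \<subseteq> gen"
proof clarify
  fix x u assume xu: "(x, u) \<in> T"
  note X = T_mem[OF xu]
  have "((\<lambda>t. N (quotient t x - u)) \<longlongrightarrow> 0) (at_right 0)"
  proof (rule tendstoI)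
    fix e :: real assume e: "0 < e"
    obtain y v w where y: "(y, v) \<in> T" "(v, w) \<in> T" "N (v - u) < e / 4"
      using core_dense[OF xu, of "e/4"] e by auto
    have Y: "y \<in> X" "v \<in> X" "w \<in> X" using T_mem[OF y(1)] T_mem[OF y(2)] by auto
    have "((\<lambda>t. t * (2 * N w)) \<longlongrightarrow> 0 * (2 * N w)) (at_right 0)" by (intro tendsto_intros)
    then have "\<forall>\<^sub>F t in at_right 0. t * (2 * N w) < e / 2" by (rule order_tendstoD) (use e in simp)
    moreover have "\<forall>\<^sub>F t in at_right (0::real). 0 < t" by (rule eventually_at_right_less)
    ultimately show "\<forall>\<^sub>F t in at_right 0. dist (N (quotient t x - u)) 0 < e"
    proof eventually_elim
      case (elim t)
      then have t: "0 \<le> t" "t \<noteq> 0" by simp_all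
      note S = semigroup_mem[OF t(1) X(1)] semigroup_mem[OF t(1) Y(1)]
      have "N (quotient t x - quotient t y) \<le> N (u - v)"
      proof -
        have "quotient t x - quotient t y = of_real (1 / t) *\<^sub>C (semigroup t (x - y) - (x - y))"
          using X Y by (simp add: contraction_diff[OF semigroup_contraction[OF t(1)]]
              cvec.scale_right_diff_distrib algebra_simps)
        then have "N (quotient t x - quotient t y) = 1 / t * N (semigroup t (x - y) - (x - y))"
          using X Y t semigroup_mem by (simp add: N_scale norm_divide)
        also have "\<dots> \<le> 1 / t * (t * N (u - v))"
          using t by (intro mult_left_mono semigroup_diff_id_le T_diff xu y) auto
        finally show ?thesis using t by simp
      qed
      moreover have "N (quotient t y - v) \<le> t * (2 * N w)"
      proof -
        have "quotient t y - v = of_real (1 / t) *\<^sub>C (semigroup t y - y - of_real t *\<^sub>C v)"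
          using t by (simp add: cvec.scale_right_diff_distrib)
        then have "N (quotient t y - v) = 1 / t * N (semigroup t y - y - of_real t *\<^sub>C v)"
          using Y S t by (simp add: N_scale norm_divide)
        also have "\<dots> \<le> 1 / t * (2 * t\<^sup>2 * N w)"
          using t by (intro mult_left_mono semigroup_expansion_le y) auto
        finally show ?thesis using t by (simp add: power2_eq_square)
      qed
      moreover have "N (quotient t x - u) \<le> N (quotient t x - quotient t y) + (N (quotient t y - v) + N (v - u))"
        using N_triangle_diff[of "quotient t x" "quotient t y" u] N_triangle_diff[of "quotient t y" v u] X Y S
        by simp
      ultimately have "N (quotient t x - u) < e"
        using y(3) elim N_minus_commute[OF X(2) Y(2)] by simp
      then show ?case using X S by simp
    qed
  qed
  then show "(x, u) \<in> gen" using X by (simp add: semigroup_generator_def)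
qed

lemma generator_add:
  assumes "(x, u) \<in> gen" "(y, v) \<in> gen"
  shows "(x + y, u + v) \<in> gen"
proof -
  have X: "x \<in> X" "u \<in> X" "y \<in> X" "v \<in> X"
    and lim: "((\<lambda>t. N (quotient t x - u)) \<longlongrightarrow> 0) (at_right 0)" "((\<lambda>t. N (quotient t y - v)) \<longlongrightarrow> 0) (at_right 0)"
    using assms by (auto simp: semigroup_generator_def)
  have "\<forall>\<^sub>F t in at_right 0. N (quotient t (x + y) - (u + v)) \<le> N (quotient t x - u) + N (quotient t y - v)
      \<and> 0 \<le> N (quotient t (x + y) - (u + v))"
    using eventually_at_right_less[of "0::real"]
  proof eventually_elim
    case (elim t)
    then have t: "0 \<le> t" by simp
    have eq: "quotient t (x + y) - (u + v) = (quotient t x - u) + (quotient t y - v)"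
      using X contractionD(3)[OF semigroup_contraction[OF t]]
      by (simp add: cvec.scale_right_diff_distrib cvec.scale_right_distrib algebra_simps)
    show ?case unfolding eq using X semigroup_mem[OF t] by (intro conjI N_triangle N_nonneg) auto
  qed
  then have "((\<lambda>t. N (quotient t (x + y) - (u + v))) \<longlongrightarrow> 0) (at_right 0)"
    by (intro tendsto_sandwich[OF _ _ tendsto_const tendsto_add_zero[OF lim]]) (auto elim: eventually_mono)
  then show ?thesis using X by (simp add: semigroup_generator_def)
qed

lemma generator_scale:
  assumes "(x, u) \<in> gen"
  shows "(c *\<^sub>C x, c *\<^sub>C u) \<in> gen"
proof -
  have X: "x \<in> X" "u \<in> X" and lim: "((\<lambda>t. N (quotient t x - u)) \<longlongrightarrow> 0) (at_right 0)"
    using assms by (auto simp: semigroup_generator_def)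
  have "\<forall>\<^sub>F t in at_right 0. cmod c * N (quotient t x - u) = N (quotient t (c *\<^sub>C x) - c *\<^sub>C u)"
    using eventually_at_right_less[of "0::real"]
  proof eventually_elim
    case (elim t)
    then have t: "0 \<le> t" by simp
    have "quotient t (c *\<^sub>C x) - c *\<^sub>C u = c *\<^sub>C (quotient t x - u)"
      using X contractionD(4)[OF semigroup_contraction[OF t]]
      by (simp add: cvec.scale_right_diff_distrib mult.commute)
    then show ?case using X semigroup_mem[OF t] by (simp add: N_scale)
  qed
  then have "((\<lambda>t. N (quotient t (c *\<^sub>C x) - c *\<^sub>C u)) \<longlongrightarrow> 0) (at_right 0)"
    by (rule Lim_transform_eventually[OF tendsto_mult_right_zero[OF lim]])
  then show ?thesis using X by (simp add: semigroup_generator_def)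
qed

text \<open>Contractivity gives \<open>Re (ip (semigroup t x) x) \<le> N x * N x\<close>, so every
  difference quotient has nonpositive real part against \<open>x\<close>, and the sign survives the
  limit.\<close>

lemma generator_Re_le:
  assumes "(x, u) \<in> gen"
  shows "Re (ip u x) \<le> 0"
proof -
  have X: "x \<in> X" "u \<in> X" and lim: "((\<lambda>t. N (quotient t x - u)) \<longlongrightarrow> 0) (at_right 0)"
    using assms by (auto simp: semigroup_generator_def)
  have "\<forall>\<^sub>F t in at_right 0. Re (ip u x) \<le> N (quotient t x - u) * N x"
    using eventually_at_right_less[of "0::real"]
  proof eventually_elim
    case (elim t)
    then have t: "0 \<le> t" by simp
    note S = semigroup_mem[OF t X(1)]
    have "Re (ip (semigroup t x) x) \<le> N x * N x"
      using Re_ip_le[OF S X(1)] contractionD(2)[OF semigroup_contraction[OF t] X(1)] X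
      by (meson N_nonneg mult_right_mono order_trans)
    then have "Re (ip (semigroup t x - x) x) \<le> 0"
      using X S N_sq[OF X(1)] by (simp add: ip_simps power2_eq_square)
    then have "Re (ip (quotient t x) x) \<le> 0"
      using X S elim by (simp add: ip_scale_left mult_le_0_iff divide_le_0_iff)
    moreover have "Re (ip (u - quotient t x) x) \<le> N (u - quotient t x) * N x"
      using X S by (intro Re_ip_le) auto
    ultimately show ?case
      using X S N_minus_commute[of u "quotient t x"] by (simp add: ip_diff_left)
  qed
  moreover have "((\<lambda>t. N (quotient t x - u) * N x) \<longlongrightarrow> 0) (at_right 0)"
    by (rule tendsto_mult_left_zero[OF lim])
  ultimately show ?thesis
    using tendsto_lowerbound trivial_limit_at_right_real by blast
qed

lemma generator_unique:
  assumes "(x, u) \<in> gen" "(x, v) \<in> gen"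
  shows "u = v"
proof -
  have X: "x \<in> X" "u \<in> X" "v \<in> X"
    and lim: "((\<lambda>t. N (quotient t x - u)) \<longlongrightarrow> 0) (at_right 0)" "((\<lambda>t. N (quotient t x - v)) \<longlongrightarrow> 0) (at_right 0)"
    using assms by (auto simp: semigroup_generator_def)
  have "\<forall>\<^sub>F t in at_right 0. N (u - v) \<le> N (quotient t x - u) + N (quotient t x - v)"
    using eventually_at_right_less[of "0::real"]
  proof eventually_elim
    case (elim t)
    then have S: "semigroup t x \<in> X" using X semigroup_mem by simp
    then show ?case
      using N_triangle_diff[of u "quotient t x" v] N_minus_commute[of u "quotient t x"] X by simp
  qed
  then have "N (u - v) \<le> 0"
    using tendsto_lowerbound[OF tendsto_add_zero[OF lim]] trivial_limit_at_right_real by blast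
  then have "N (u - v) = 0" using N_nonneg[of "u - v"] X by (simp del: N_nonneg)
  then show ?thesis using N_eq_0_iff[of "u - v"] X by simp
qed

theorem generator_eq: "gen = T"
proof (rule dissipative_extension[OF _ _ T_subset_generator])
  have "(0, 0) \<in> gen" using T_onto[of 0] T_kernel T_subset_generator by fastforce
  then have "csubspace gen"
    using generator_add generator_scale by (auto simp: csubspace_iff scaleC_prod_def zero_prod_def)
  moreover have "gen \<subseteq> X \<times> X" by (auto simp: semigroup_generator_def)
  ultimately show "linear_operator X gen"
    using generator_unique by (auto simp: linear_operator_def single_valued_def)
  show "dissipative ip gen" using generator_Re_le by (auto simp: dissipative_def)
qed

end

section \<open>\<open>L\<^sub>2(0,1)\<close> as a Hilbert space\<close>

lemma L2_rel_refl_iff: "L2_rel f f \<longleftrightarrow> square_integrable f"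
  by (simp add: L2_rel_def)

lemma L2_cases: obtains f where "u = abs_L2 f" "square_integrable f"
  using Quotient3_abs_rep[OF Quotient3_L2, of u] Quotient3_rep_reflp[OF Quotient3_L2, of u]
  by (metis L2_rel_refl_iff)

lemma abs_L2_eq_iff:
  assumes "square_integrable f" "square_integrable g"
  shows "abs_L2 f = abs_L2 g \<longleftrightarrow> (AE x in unit_interval_measure. f x = g x)"
  using Quotient3_rel[OF Quotient3_L2, of f g] assms by (auto simp: L2_rel_def)

lemma abs_L2_ops:
  assumes "square_integrable f" "square_integrable g"
  shows "abs_L2 f + abs_L2 g = abs_L2 (\<lambda>x. f x + g x)"
    and "c *\<^sub>C abs_L2 f = abs_L2 (\<lambda>x. c * f x)"
    and "- abs_L2 f = abs_L2 (\<lambda>x. - f x)"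
    and "abs_L2 f - abs_L2 g = abs_L2 (\<lambda>x. f x - g x)"
    and "L2_ip (abs_L2 f) (abs_L2 g) = (LINT x|unit_interval_measure. f x * cnj (g x))"
  using assms square_integrable_scale[of g "-1"]
  by (auto simp: plus_L2.abs_eq scaleC_L2.abs_eq uminus_L2.abs_eq L2_ip.abs_eq minus_L2_def L2_rel_refl_iff)

lemma square_integrable_measurable [measurable_dest]:
  "square_integrable f \<Longrightarrow> f \<in> borel_measurable unit_interval_measure"
  by (simp add: square_integrable_def)

lemma square_integrable_uminus: "square_integrable f \<Longrightarrow> square_integrable (\<lambda>x. - f x)"
  using square_integrable_scale[of f "-1"] by simp

lemma square_integrable_diff:
  "\<lbrakk>square_integrable f; square_integrable g\<rbrakk> \<Longrightarrow> square_integrable (\<lambda>x. f x - g x)"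
  using square_integrable_add[OF _ square_integrable_uminus] by force

lemma cnj_measurable [measurable]: "cnj \<in> borel_measurable borel"
  by (intro borel_measurable_continuous_onI continuous_intros)

lemma square_integrable_mult:
  assumes "square_integrable f" "square_integrable g"
  shows "integrable unit_interval_measure (\<lambda>x. f x * g x)"
proof (rule Bochner_Integration.integrable_bound)
  note [measurable] = assms[THEN square_integrable_measurable]
  show "integrable unit_interval_measure (\<lambda>x. (cmod (f x))\<^sup>2 + (cmod (g x))\<^sup>2)"
    using assms by (auto simp: square_integrable_def)
  show "(\<lambda>x. f x * g x) \<in> borel_measurable unit_interval_measure" by measurable
  have "a * b \<le> a\<^sup>2 + b\<^sup>2" if "0 \<le> a" "0 \<le> b" for a b :: real
    using sum_squares_bound[of a b] mult_nonneg_nonneg[OF that] by simp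
  then show "AE x in unit_interval_measure. norm (f x * g x) \<le> norm ((cmod (f x))\<^sup>2 + (cmod (g x))\<^sup>2)"
    by (simp add: norm_mult)
qed

lemma square_integrable_cnj: "square_integrable f \<Longrightarrow> square_integrable (\<lambda>x. cnj (f x))"
  unfolding square_integrable_def by (auto intro: measurable_compose[OF _ cnj_measurable])

lemma square_integrable_bounded:
  assumes "f \<in> borel_measurable unit_interval_measure" "\<And>x. x \<in> {0..1} \<Longrightarrow> cmod (f x) \<le> B"
  shows "square_integrable f"
proof -
  have "finite_measure unit_interval_measure"
    by (rule finite_measure_lebesgue_on) simp
  then have "integrable unit_interval_measure (\<lambda>x. (cmod (f x))\<^sup>2)"
    using assms by (intro finite_measure.integrable_const_bound[where B = "B\<^sup>2"])
      (auto simp: power_mono space_restrict_space intro!: AE_I2)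
  then show ?thesis using assms by (simp add: square_integrable_def)
qed

lemma square_integrable_continuous:
  assumes "continuous_on {0..1} f"
  shows "square_integrable f"
proof -
  have "bounded (f ` {0..1})"
    using assms by (intro compact_imp_bounded compact_continuous_image) auto
  then obtain B where "\<And>x. x \<in> {0..1} \<Longrightarrow> cmod (f x) \<le> B"
    unfolding bounded_iff by blast
  then show ?thesis
    using assms by (intro square_integrable_bounded continuous_imp_measurable_on_sets_lebesgue) auto
qed

lemma square_integrable_integrable:
  "square_integrable f \<Longrightarrow> integrable unit_interval_measure f"
  using square_integrable_mult[OF _ square_integrable_continuous[of "\<lambda>_. 1"]] by simp

lemma L2_ip_add_left: "L2_ip (u + v) w = L2_ip u w + L2_ip v w"
proof -
  obtain f g h where "u = abs_L2 f" "square_integrable f" "v = abs_L2 g" "square_integrable g"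
    "w = abs_L2 h" "square_integrable h" by (metis L2_cases)
  then show ?thesis
    by (simp add: abs_L2_ops square_integrable_add distrib_right square_integrable_mult square_integrable_cnj)
qed

lemma L2_ip_scale_left: "L2_ip (c *\<^sub>C u) w = c * L2_ip u w"
proof -
  obtain f h where "u = abs_L2 f" "square_integrable f" "w = abs_L2 h" "square_integrable h"
    by (metis L2_cases)
  then show ?thesis by (simp add: abs_L2_ops square_integrable_scale mult.assoc)
qed

lemma L2_ip_commute: "L2_ip v u = cnj (L2_ip u v)"
proof -
  obtain f h where "u = abs_L2 f" "square_integrable f" "v = abs_L2 h" "square_integrable h"
    by (metis L2_cases)
  then show ?thesis
    by (simp add: abs_L2_ops mult.commute flip: Bochner_Integration.integral_cnj)
qed

lemma L2_ip_add_right: "L2_ip w (u + v) = L2_ip w u + L2_ip w v"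
  by (metis L2_ip_add_left L2_ip_commute complex_cnj_add)

lemma L2_ip_scale_right: "L2_ip w (c *\<^sub>C u) = cnj c * L2_ip w u"
  by (metis L2_ip_commute L2_ip_scale_left complex_cnj_mult)

lemma L2_ip_uminus_left: "L2_ip (- u) v = - L2_ip u v"
  using L2_ip_scale_left[of "-1" u v] by simp

lemma L2_ip_diff_left: "L2_ip (u - w) v = L2_ip u v - L2_ip w v"
  using L2_ip_add_left[of u "- w" v] by (simp add: L2_ip_uminus_left)

lemma L2_ip_self:
  assumes "square_integrable f"
  shows "L2_ip (abs_L2 f) (abs_L2 f) = complex_of_real (LINT x|unit_interval_measure. (cmod (f x))\<^sup>2)"
  using assms
  by (simp add: abs_L2_ops complex_norm_square[symmetric] flip: integral_complex_of_real of_real_power)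

text \<open>The real part of the complex inner product induces the same norm. As type-class
  structure it gives \<open>L2\<close> its topology, the notion \<open>Cauchy\<close> and the
  Cauchy-Schwarz inequality for the real part; complex scalars stay with
  \<open>scaleC\<close>.\<close>

instantiation L2 :: real_inner
begin

definition scaleR_L2 :: "real \<Rightarrow> L2 \<Rightarrow> L2" where "scaleR_L2 r u = of_real r *\<^sub>C u"
definition inner_L2 :: "L2 \<Rightarrow> L2 \<Rightarrow> real" where "inner_L2 u v = Re (L2_ip u v)"
definition norm_L2 :: "L2 \<Rightarrow> real" where "norm_L2 u = sqrt (inner u u)"
definition sgn_L2 :: "L2 \<Rightarrow> L2" where "sgn_L2 u = complex_of_real (inverse (norm u)) *\<^sub>C u"
definition dist_L2 :: "L2 \<Rightarrow> L2 \<Rightarrow> real" where "dist_L2 u v = norm (u - v)"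
definition uniformity_L2 :: "(L2 \<times> L2) filter"
  where "uniformity_L2 = (INF e\<in>{0 <..}. principal {(u, v). dist u v < e})"
definition open_L2 :: "L2 set \<Rightarrow> bool"
  where "open_L2 U \<longleftrightarrow> (\<forall>x\<in>U. eventually (\<lambda>(x', y). x' = x \<longrightarrow> y \<in> U) uniformity)"

instance
proof
  fix u v w :: L2 and r s :: real and U :: "L2 set"
  show "r *\<^sub>R (u + v) = r *\<^sub>R u + r *\<^sub>R v" "(r + s) *\<^sub>R u = r *\<^sub>R u + s *\<^sub>R u"
    "r *\<^sub>R s *\<^sub>R u = (r * s) *\<^sub>R u" "1 *\<^sub>R u = u"
    by (simp_all add: scaleR_L2_def scaleC_add_right scaleC_add_left scaleC_scaleC scaleC_one)
  show "inner u v = inner v u" using L2_ip_commute[of u v] by (simp add: inner_L2_def)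
  show "inner (u + v) w = inner u w + inner v w" "inner (r *\<^sub>R u) v = r * inner u v"
    by (simp_all add: inner_L2_def scaleR_L2_def L2_ip_add_left L2_ip_scale_left)
  obtain f where f: "u = abs_L2 f" "square_integrable f" by (rule L2_cases)
  then have i: "inner u u = (LINT x|unit_interval_measure. (cmod (f x))\<^sup>2)"
    by (simp add: inner_L2_def L2_ip_self)
  show "0 \<le> inner u u" unfolding i by simp
  have "inner u u = 0 \<longleftrightarrow> (AE x in unit_interval_measure. (cmod (f x))\<^sup>2 = 0)"
    unfolding i using f by (intro integral_nonneg_eq_0_iff_AE) (auto simp: square_integrable_def)
  also have "\<dots> \<longleftrightarrow> u = 0"
    unfolding f zero_L2_def using f by (subst abs_L2_eq_iff) (auto simp: square_integrable_0)
  finally show "inner u u = 0 \<longleftrightarrow> u = 0" .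
  show "norm u = sqrt (inner u u)" by (rule norm_L2_def)
  show "sgn u = inverse (norm u) *\<^sub>R u" unfolding scaleR_L2_def by (rule sgn_L2_def)
  show "dist u v = norm (u - v)" by (rule dist_L2_def)
  show "(uniformity :: (L2 \<times> L2) filter) = (INF e\<in>{0 <..}. principal {(u, v). dist u v < e})"
    by (rule uniformity_L2_def)
  show "open U \<longleftrightarrow> (\<forall>x\<in>U. \<forall>\<^sub>F (x', y) in uniformity. x' = x \<longrightarrow> y \<in> U)"
    by (rule open_L2_def)
qed

end

lemma norm_L2_sq: "square_integrable f \<Longrightarrow> (norm (abs_L2 f))\<^sup>2 = (LINT x|unit_interval_measure. (cmod (f x))\<^sup>2)"
  by (simp add: power2_norm_eq_inner inner_L2_def L2_ip_self)

lemma L2_ip_eq_norm_sq: "L2_ip u u = complex_of_real ((norm u)\<^sup>2)"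
  by (rule L2_cases[of u]) (simp add: norm_L2_sq L2_ip_self del: of_real_power)

lemma norm_scaleC: "norm (c *\<^sub>C u) = cmod c * norm (u :: L2)"
proof -
  have "L2_ip (c *\<^sub>C u) (c *\<^sub>C u) = c * cnj c * L2_ip u u"
    using L2_ip_commute[of u "c *\<^sub>C u"] L2_ip_commute[of u u] by (simp add: L2_ip_scale_left)
  then have "complex_of_real ((norm (c *\<^sub>C u))\<^sup>2) = complex_of_real ((cmod c * norm u)\<^sup>2)"
    by (simp only: L2_ip_eq_norm_sq complex_norm_square[symmetric]) (simp add: power_mult_distrib)
  then have "(norm (c *\<^sub>C u))\<^sup>2 = (cmod c * norm u)\<^sup>2" by (simp only: of_real_eq_iff)
  then show ?thesis by simp
qed

text \<open>Multiplying \<open>u\<close> by a unimodular scalar makes the inner product real and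
  nonnegative without changing the norm, which reduces the claim to the real inner product.\<close>

lemma L2_cauchy_schwarz: "cmod (L2_ip u v) \<le> norm u * norm v"
proof (cases "L2_ip u v = 0")
  case False
  define c where "c = cnj (L2_ip u v) / cmod (L2_ip u v)"
  have "cmod c = 1" using False by (simp add: c_def norm_divide)
  have "c * L2_ip u v = complex_of_real (cmod (L2_ip u v))"
    using False by (simp add: c_def complex_norm_square[symmetric] mult.commute[of "cnj _"] power2_eq_square)
  then have "cmod (L2_ip u v) = inner (c *\<^sub>C u) v"
    by (simp add: inner_L2_def L2_ip_scale_left)
  also have "\<dots> \<le> norm (c *\<^sub>C u) * norm v" by (rule norm_cauchy_schwarz)
  finally show ?thesis using \<open>cmod c = 1\<close> by (simp add: norm_scaleC)
qed simp

text \<open>Cauchy-Schwarz against the constant 1, whose norm is 1 because the interval has measure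
  1.\<close>

lemma integral_norm_le_L2:
  assumes "square_integrable f"
  shows "(LINT x|unit_interval_measure. cmod (f x)) \<le> norm (abs_L2 f)"
proof -
  have sq: "square_integrable (\<lambda>x. complex_of_real (cmod (f x)))" "square_integrable (\<lambda>x. 1)"
    using assms by (auto simp: square_integrable_def intro!: square_integrable_continuous[unfolded square_integrable_def])
  have one: "norm (abs_L2 (\<lambda>x. 1)) = 1"
    using norm_L2_sq[OF sq(2)] norm_ge_zero[of "abs_L2 (\<lambda>x. 1)"]
    by (auto simp: power2_eq_1_iff measure_restrict_space simp del: norm_ge_zero)
  have "(LINT x|unit_interval_measure. cmod (f x)) = cmod (L2_ip (abs_L2 (\<lambda>x. complex_of_real (cmod (f x)))) (abs_L2 (\<lambda>x. 1)))"
    using sq by (simp add: abs_L2_ops)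
  also have "\<dots> \<le> norm (abs_L2 (\<lambda>x. complex_of_real (cmod (f x)))) * 1"
    using L2_cauchy_schwarz one by metis
  also have "norm (abs_L2 (\<lambda>x. complex_of_real (cmod (f x)))) = norm (abs_L2 f)"
    by (rule power2_eq_imp_eq) (use norm_L2_sq[OF sq(1)] norm_L2_sq[OF assms] in simp_all)
  finally show ?thesis by simp
qed

lemma nn_integral_norm_sq:
  assumes "square_integrable f"
  shows "(\<integral>\<^sup>+x. ennreal ((cmod (f x))\<^sup>2) \<partial>unit_interval_measure) = ennreal ((norm (abs_L2 f))\<^sup>2)"
  unfolding norm_L2_sq[OF assms] using assms
  by (intro nn_integral_eq_integral) (auto simp: square_integrable_def)

lemma fast_cauchy_subseq:
  fixes X :: "nat \<Rightarrow> 'a::metric_space"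
  assumes "Cauchy X"
  obtains r where "strict_mono r" "\<And>k m. k \<le> m \<Longrightarrow> dist (X (r m)) (X (r k)) < (1/2) ^ k"
proof -
  have "\<exists>r. \<forall>k. (\<forall>m\<ge>r k. \<forall>n\<ge>r k. dist (X m) (X n) < (1/2) ^ k) \<and> r k < r (Suc k)"
  proof (rule dependent_nat_choice)
    have C: "\<exists>M. \<forall>m\<ge>M. \<forall>n\<ge>M. dist (X m) (X n) < (1/2) ^ k" for k
      using assms by (intro metric_CauchyD) auto
    then show "\<exists>M. \<forall>m\<ge>M. \<forall>n\<ge>M. dist (X m) (X n) < (1/2) ^ 0" .
    fix y k
    obtain M where "\<forall>m\<ge>M. \<forall>n\<ge>M. dist (X m) (X n) < (1/2) ^ Suc k" using C by blast
    then show "\<exists>M. (\<forall>m\<ge>M. \<forall>n\<ge>M. dist (X m) (X n) < (1/2) ^ Suc k) \<and> y < M"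
      by (intro exI[of _ "max M (Suc y)"]) auto
  qed
  then obtain r where r: "\<And>k m n. \<lbrakk>r k \<le> m; r k \<le> n\<rbrakk> \<Longrightarrow> dist (X m) (X n) < (1/2) ^ k" "\<And>k. r k < r (Suc k)"
    by blast
  then have "strict_mono r" by (simp add: strict_mono_Suc_iff)
  then show ?thesis using r(1) by (intro that) (auto simp: strict_mono_less_eq)
qed

text \<open>Riesz--Fischer: a fast Cauchy subsequence converges a.e. because its increments are
  summable in \<open>L\<^sub>1\<close>; Fatou's lemma identifies the a.e. limit as the limit in \<open>L\<^sub>2\<close>.\<close>

instance L2 :: complete_space
proof
  fix X :: "nat \<Rightarrow> L2" assume X: "Cauchy X"
  let ?M = unit_interval_measure
  obtain r where r: "strict_mono r" "\<And>k m. k \<le> m \<Longrightarrow> dist (X (r m)) (X (r k)) < (1/2) ^ k"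
    using fast_cauchy_subseq[OF X] by blast
  have "\<forall>k. \<exists>f. X (r k) = abs_L2 f \<and> square_integrable f" by (metis L2_cases)
  then obtain f where f: "\<And>k. X (r k) = abs_L2 (f k)" "\<And>k. square_integrable (f k)" by metis
  note [measurable] = f(2)[THEN square_integrable_measurable]
  have d: "square_integrable (\<lambda>x. f m x - f k x)" for m k by (rule square_integrable_diff[OF f(2) f(2)])
  have norm_d: "norm (abs_L2 (\<lambda>x. f m x - f k x)) < (1/2) ^ k" if "k \<le> m" for m k
    using r(2)[OF that] f by (simp add: dist_norm abs_L2_ops)
  have "(\<integral>\<^sup>+x. ennreal (cmod (f (Suc k) x - f k x)) \<partial>?M) \<le> ennreal ((1/2) ^ k)" for k
  proof -
    have "(\<integral>\<^sup>+x. ennreal (cmod (f (Suc k) x - f k x)) \<partial>?M) = ennreal (LINT x|?M. cmod (f (Suc k) x - f k x))"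
      using d by (intro nn_integral_eq_integral) (auto intro!: integrable_norm square_integrable_integrable)
    also have "\<dots> \<le> ennreal ((1/2) ^ k)"
      using integral_norm_le_L2[OF d, of "Suc k" k] norm_d[of k "Suc k"] by (intro ennreal_leI) simp
    finally show ?thesis .
  qed
  then have "(\<Sum>k. \<integral>\<^sup>+x. ennreal (cmod (f (Suc k) x - f k x)) \<partial>?M) \<le> (\<Sum>k. ennreal ((1/2) ^ k))"
    by (intro suminf_le) auto
  also have "\<dots> < \<infinity>"
    by (subst suminf_ennreal2) (auto intro!: summable_geometric)
  finally have "(\<integral>\<^sup>+x. (\<Sum>k. ennreal (cmod (f (Suc k) x - f k x))) \<partial>?M) \<noteq> \<infinity>"
    by (subst nn_integral_suminf) auto
  then have "AE x in ?M. (\<Sum>k. ennreal (cmod (f (Suc k) x - f k x))) \<noteq> \<infinity>"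
    by (intro nn_integral_PInf_AE) auto
  then have conv: "AE x in ?M. convergent (\<lambda>k. f k x)"
  proof eventually_elim
    case (elim x)
    then have "summable (\<lambda>k. cmod (f (Suc k) x - f k x))"
      by (intro summable_suminf_not_top) (auto simp: top_ennreal.rep_eq infinity_ennreal_def)
    then have "summable (\<lambda>k. f (Suc k) x - f k x)" by (rule summable_norm_cancel)
    then have "convergent (\<lambda>n. \<Sum>k<n. f (Suc k) x - f k x)" by (simp add: summable_iff_convergent)
    moreover have "(\<Sum>k<n. f (Suc k) x - f k x) = f n x - f 0 x" for n by (induction n) auto
    ultimately have "convergent (\<lambda>n. f n x - f 0 x)" by simp
    then have "convergent (\<lambda>n. (f n x - f 0 x) + f 0 x)" by (intro convergent_add convergent_const)
    then show ?case by simp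
  qed
  define g where "g = (\<lambda>x. lim (\<lambda>k. f k x))"
  have [measurable]: "g \<in> borel_measurable ?M" unfolding g_def by measurable
  have lim: "AE x in ?M. (\<lambda>k. f k x) \<longlonglongrightarrow> g x"
    using conv by eventually_elim (simp add: g_def convergent_LIMSEQ_iff)
  have bound: "(\<integral>\<^sup>+x. ennreal ((cmod (g x - f k x))\<^sup>2) \<partial>?M) \<le> ennreal (((1/2) ^ k)\<^sup>2)" for k
  proof -
    have "(\<integral>\<^sup>+x. ennreal ((cmod (g x - f k x))\<^sup>2) \<partial>?M) =
        (\<integral>\<^sup>+x. liminf (\<lambda>m. ennreal ((cmod (f m x - f k x))\<^sup>2)) \<partial>?M)"
    proof (rule nn_integral_cong_AE)
      show "AE x in ?M. ennreal ((cmod (g x - f k x))\<^sup>2) = liminf (\<lambda>m. ennreal ((cmod (f m x - f k x))\<^sup>2))"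
        using lim
      proof eventually_elim
        case (elim x)
        then have "(\<lambda>m. ennreal ((cmod (f m x - f k x))\<^sup>2)) \<longlonglongrightarrow> ennreal ((cmod (g x - f k x))\<^sup>2)"
          by (intro tendsto_intros) auto
        then show ?case by (intro lim_imp_Liminf[symmetric]) auto
      qed
    qed
    also have "\<dots> \<le> liminf (\<lambda>m. \<integral>\<^sup>+x. ennreal ((cmod (f m x - f k x))\<^sup>2) \<partial>?M)"
      by (intro nn_integral_liminf) auto
    also have "\<dots> \<le> ennreal (((1/2) ^ k)\<^sup>2)"
    proof (rule Liminf_le)
      show "\<forall>\<^sub>F m in sequentially. (\<integral>\<^sup>+x. ennreal ((cmod (f m x - f k x))\<^sup>2) \<partial>?M) \<le> ennreal (((1/2) ^ k)\<^sup>2)"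
        using eventually_ge_at_top[of k]
      proof eventually_elim
        case (elim m)
        show ?case unfolding nn_integral_norm_sq[OF d]
          using norm_d[OF elim] by (intro ennreal_leI power_mono) auto
      qed
    qed simp
    finally show ?thesis .
  qed
  have gd: "square_integrable (\<lambda>x. g x - f k x)" for k
    unfolding square_integrable_def
  proof
    show "integrable ?M (\<lambda>x. (cmod (g x - f k x))\<^sup>2)"
      using le_less_trans[OF bound[of k] ennreal_less_top] by (intro integrableI_bounded) auto
  qed measurable
  then have g: "square_integrable g"
    using square_integrable_add[OF gd[of 0] f(2)[of 0]] by simp
  have "norm (X (r k) - abs_L2 g) \<le> (1/2) ^ k" for k
  proof (rule power2_le_imp_le)
    have "ennreal ((norm (abs_L2 (\<lambda>x. g x - f k x)))\<^sup>2) \<le> ennreal (((1/2) ^ k)\<^sup>2)"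
      using bound[of k] by (simp add: nn_integral_norm_sq[OF gd])
    then have "(norm (abs_L2 (\<lambda>x. g x - f k x)))\<^sup>2 \<le> ((1/2) ^ k)\<^sup>2" by (subst (asm) ennreal_le_iff) auto
    then show "(norm (X (r k) - abs_L2 g))\<^sup>2 \<le> ((1/2) ^ k)\<^sup>2"
      using f g by (subst norm_minus_commute) (simp add: abs_L2_ops)
  qed simp
  then have "(\<lambda>k. X (r k) - abs_L2 g) \<longlonglongrightarrow> 0"
    by (intro Lim_null_comparison[OF _ LIMSEQ_power_zero[of "1/2 :: real"]]) (auto intro!: always_eventually)
  then have "(X \<circ> r) \<longlonglongrightarrow> abs_L2 g" by (simp add: LIM_zero_iff o_def)
  then have "X \<longlonglongrightarrow> abs_L2 g" using Cauchy_converges_subseq[OF X r(1)] by blast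
  then show "convergent X" by (auto simp: convergent_def)
qed

section \<open>Primitives of square integrable functions\<close>

abbreviation I :: "real measure" where "I \<equiv> unit_interval_measure"

lemma unit_interval_finite: "finite_measure I"
  by (rule finite_measure_lebesgue_on) simp

lemma unit_interval_id_measurable: "(\<lambda>x. x) \<in> borel_measurable I"
  by (intro continuous_imp_measurable_on_sets_lebesgue) auto

text \<open>The sigma-algebra of \<open>I\<close> consists of Lebesgue rather than Borel sets;
  half-lines and the two triangles of the unit square are declared measurable for it here.\<close>

lemma unit_interval_pred_le [measurable]:
  "Measurable.pred I (\<lambda>y. y \<le> a)" "Measurable.pred I (\<lambda>y. a \<le> y)"
  "Measurable.pred (I \<Otimes>\<^sub>M I) (\<lambda>p. snd p \<le> fst p)" "Measurable.pred (I \<Otimes>\<^sub>M I) (\<lambda>p. fst p \<le> snd p)"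
  unfolding pred_def
  by (rule borel_measurable_le borel_measurable_const unit_interval_id_measurable
      measurable_compose[OF measurable_fst unit_interval_id_measurable]
      measurable_compose[OF measurable_snd unit_interval_id_measurable])+

lemma square_integrable_on_subinterval:
  assumes "square_integrable f" "0 \<le> a" "b \<le> 1"
  shows "f integrable_on {a..b}"
proof -
  have "f integrable_on {0..1}"
    using has_integral_integral_lebesgue_on[OF square_integrable_integrable[OF assms(1)]]
    by (auto simp: integrable_on_def)
  then show ?thesis by (rule integrable_on_subinterval) (use assms in auto)
qed

lemma LINT_unit_interval: "square_integrable f \<Longrightarrow> (LINT x|I. f x) = integral {0..1} f"
  by (intro lebesgue_integral_eq_integral square_integrable_integrable) auto

lemma square_integrable_restrict:
  assumes "square_integrable f" and [measurable]: "Measurable.pred I P"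
  shows "square_integrable (\<lambda>y. if P y then f y else 0)" (is "square_integrable ?g")
  unfolding square_integrable_def
proof
  have [measurable]: "f \<in> borel_measurable I" by (rule square_integrable_measurable[OF assms(1)])
  show [measurable]: "?g \<in> borel_measurable I" by measurable
  show "integrable I (\<lambda>x. (cmod (?g x))\<^sup>2)"
  proof (rule Bochner_Integration.integrable_bound)
    show "integrable I (\<lambda>x. (cmod (f x))\<^sup>2)" using assms by (simp add: square_integrable_def)
    show "(\<lambda>x. (cmod (?g x))\<^sup>2) \<in> borel_measurable I" by measurable
  qed (auto intro!: AE_I2)
qed

lemma square_integrable_cutoff:
  "square_integrable f \<Longrightarrow> square_integrable (\<lambda>y. if y \<le> a then f y else 0)"
  by (rule square_integrable_restrict) measurable

lemma LINT_cutoff: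
  assumes "square_integrable f" "x \<in> {0..1}"
  shows "(LINT y|I. (if y \<le> x then f y else 0)) = integral {0..x} f"
proof -
  have "(LINT y|I. (if y \<le> x then f y else 0)) = integral {0..1} (\<lambda>y. if y \<in> {..x} then f y else 0)"
    using LINT_unit_interval[OF square_integrable_cutoff[OF assms(1)]] by simp
  also have "\<dots> = integral ({..x} \<inter> {0..1}) f" by (rule integral_restrict_Int)
  also have "{..x} \<inter> {0..1} = {0..x}" using assms(2) by auto
  finally show ?thesis .
qed

lemma continuous_primitive:
  "square_integrable f \<Longrightarrow> continuous_on {0..1} (\<lambda>x. integral {0..x} f)"
  by (intro indefinite_integral_continuous_1 square_integrable_on_subinterval) auto

lemma square_integrable_primitive: "square_integrable f \<Longrightarrow> square_integrable (\<lambda>x. integral {0..x} f)"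
  by (rule square_integrable_continuous[OF continuous_primitive])

text \<open>The product on the right is the integral of \<open>f x * g y\<close> over the unit
  square. Fubini's theorem on the triangles \<open>y \<le> x\<close> and \<open>x \<le> y\<close>
  yields the two terms on the left, so \<open>f\<close> and \<open>g\<close> need no regularity
  beyond square integrability.\<close>

lemma integral_by_parts_primitive:
  assumes f: "square_integrable f" and g: "square_integrable g"
  shows "(LINT x|I. f x * integral {0..x} g) + (LINT x|I. integral {0..x} f * g x) = (LINT x|I. f x) * (LINT x|I. g x)"
proof -
  interpret finite_measure I by (rule unit_interval_finite)
  interpret P: pair_sigma_finite I I ..
  have [measurable]: "f \<in> borel_measurable I" "g \<in> borel_measurable I"
    using f g by (auto intro: square_integrable_measurable)
  have fg: "integrable (I \<Otimes>\<^sub>M I) (\<lambda>(x, y). f x * g y)"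
  proof (rule P.Fubini_integrable)
    show "integrable I (\<lambda>x. LINT y|I. norm (case (x, y) of (x, y) \<Rightarrow> f x * g y))"
      using square_integrable_integrable[OF f] by (simp add: norm_mult)
  qed (auto intro!: AE_I2 square_integrable_integrable[OF g])
  have i1: "integrable (I \<Otimes>\<^sub>M I) (\<lambda>(x, y). if y \<le> x then f x * g y else 0)"
    by (rule Bochner_Integration.integrable_bound[OF fg]) (auto intro!: AE_I2)
  have i2: "integrable (I \<Otimes>\<^sub>M I) (\<lambda>(x, y). if x \<le> y then f x * g y else 0)"
    by (rule Bochner_Integration.integrable_bound[OF fg]) (auto intro!: AE_I2)
  have mem: "x \<in> space I \<Longrightarrow> x \<in> {0..1}" for x by (simp add: space_restrict_space)
  have 1: "(LINT x|I. f x * integral {0..x} g) = (LINT x|I. LINT y|I. (if y \<le> x then f x * g y else 0))"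
  proof (rule Bochner_Integration.integral_cong)
    fix x assume "x \<in> space I"
    then have "f x * integral {0..x} g = (LINT y|I. f x * (if y \<le> x then g y else 0))"
      using LINT_cutoff[OF g mem] by simp
    also have "\<dots> = (LINT y|I. (if y \<le> x then f x * g y else 0))"
      by (rule Bochner_Integration.integral_cong) simp_all
    finally show "f x * integral {0..x} g = (LINT y|I. (if y \<le> x then f x * g y else 0))" .
  qed simp
  have 2: "(LINT x|I. integral {0..x} f * g x) = (LINT y|I. LINT x|I. (if x \<le> y then f x * g y else 0))"
  proof (rule Bochner_Integration.integral_cong)
    fix y assume "y \<in> space I"
    then have "integral {0..y} f * g y = (LINT x|I. (if x \<le> y then f x else 0) * g y)"
      using LINT_cutoff[OF f mem] by simp
    also have "\<dots> = (LINT x|I. (if x \<le> y then f x * g y else 0))"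
      by (rule Bochner_Integration.integral_cong) simp_all
    finally show "integral {0..y} f * g y = (LINT x|I. (if x \<le> y then f x * g y else 0))" .
  qed simp
  also have "\<dots> = (LINT x|I. LINT y|I. (if x \<le> y then f x * g y else 0))"
    by (rule P.Fubini_integral[OF i2])
  finally have "(LINT x|I. f x * integral {0..x} g) + (LINT x|I. integral {0..x} f * g x) =
      (LINT x|I. LINT y|I. (if y \<le> x then f x * g y else 0)) + (LINT x|I. LINT y|I. (if x \<le> y then f x * g y else 0))"
    unfolding 1 by simp
  also have "\<dots> = (LINT x|I. (LINT y|I. (if y \<le> x then f x * g y else 0)) + (LINT y|I. (if x \<le> y then f x * g y else 0)))"
    using P.integrable_fst[OF i1] P.integrable_fst[OF i2] by (intro Bochner_Integration.integral_add[symmetric]) auto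
  also have "\<dots> = (LINT x|I. f x * (LINT y|I. g y))"
  proof (rule integral_cong_AE)
    show "AE x in I. (LINT y|I. (if y \<le> x then f x * g y else 0)) + (LINT y|I. (if x \<le> y then f x * g y else 0))
        = f x * (LINT y|I. g y)"
      using P.AE_integrable_fst[OF i1] P.AE_integrable_fst[OF i2]
    proof eventually_elim
      case (elim x)
      have "(LINT y|I. (if y \<le> x then f x * g y else 0)) + (LINT y|I. (if x \<le> y then f x * g y else 0)) =
          (LINT y|I. (if y \<le> x then f x * g y else 0) + (if x \<le> y then f x * g y else 0))"
        using elim by (intro Bochner_Integration.integral_add[symmetric]) auto
      also have "\<dots> = (LINT y|I. f x * g y)"
      proof (rule integral_cong_AE)
        \<comment> \<open>Both triangles contain the diagonal, which meets each section in a single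
          point.\<close>
        have "AE y in lebesgue. y \<noteq> x" by (intro AE_completion AE_lborel_singleton)
        then have "AE y in I. y \<noteq> x" by (auto simp: AE_restrict_space_iff elim!: eventually_mono)
        then show "AE y in I. (if y \<le> x then f x * g y else 0) + (if x \<le> y then f x * g y else 0) = f x * g y"
          by eventually_elim auto
      qed measurable
      finally show ?case by simp
    qed
  qed measurable
  finally show ?thesis by simp
qed

text \<open>After extension by 0, the integral vanishes over all half-lines \<open>{..a}\<close>.
  These generate the Borel sets and are stable under intersection, so it vanishes over Borel sets by
  the \<pi>-\<lambda> argument, and over Lebesgue sets since they differ from Borel sets by null
  sets.\<close>

lemma AE_zero_if_primitive_zero:
  assumes f: "square_integrable f" and zero: "\<And>x. x \<in> {0..1} \<Longrightarrow> integral {0..x} f = 0"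
  shows "AE x in I. f x = 0"
proof -
  interpret finite_measure I by (rule unit_interval_finite)
  define f0 where "f0 = (\<lambda>x. if x \<in> {0..1} then f x else 0)"
  have int: "integrable lebesgue f0"
    unfolding f0_def using square_integrable_integrable[OF f] by (subst Lebesgue_Measure.integrable_restrict_UNIV) auto
  have sint: "set_integrable lebesgue A f0" if "A \<in> sets lebesgue" for A
    using set_integrable_subset[of lebesgue UNIV f0 A] int that by (simp add: set_integrable_def)
  have all: "(LINT x:UNIV|lebesgue. f0 x) = 0"
  proof -
    have "(LINT x:UNIV|lebesgue. f0 x) = integral UNIV f0"
      by (rule set_lebesgue_integral_eq_integral(2)[OF sint]) simp
    also have "\<dots> = integral {0..1} f" unfolding f0_def by (rule integral_restrict_UNIV)
    finally show ?thesis using zero[of 1] by simp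
  qed
  have borel: "(LINT x:A|lebesgue. f0 x) = 0" if "A \<in> sets borel" for A
  proof -
    have gen: "sigma_sets UNIV (range (\<lambda>a::real. {..a})) \<subseteq> sets lebesgue"
    proof -
      have "sigma_sets UNIV (range (\<lambda>a::real. {..a})) = sets borel" unfolding borel_eq_atMost by simp
      also have "\<dots> \<subseteq> sets lebesgue" by (auto intro: sets_completionI_sets)
      finally show ?thesis .
    qed
    have "Int_stable (range (\<lambda>a::real. {..a}))"
      by (auto simp: Int_stable_def intro!: range_eqI[of _ _ "min _ _"])
    moreover have "range (\<lambda>a::real. {..a}) \<subseteq> Pow UNIV" by simp
    moreover have "A \<in> sigma_sets UNIV (range (\<lambda>a::real. {..a}))"
      using that unfolding borel_eq_atMost by simp
    ultimately show ?thesis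
    proof (induction rule: sigma_sets_induct_disjoint)
      case (basic A)
      then obtain a where A: "A = {..a}" by auto
      have "(LINT x:A|lebesgue. f0 x) = integral A f0"
        by (rule set_lebesgue_integral_eq_integral(2)[OF sint]) (simp add: A)
      also have "\<dots> = integral ({0..1} \<inter> A) f" unfolding f0_def by (rule integral_restrict_Int)
      also have "\<dots> = 0"
      proof (cases "a < 0")
        case True
        then have "{0..1} \<inter> A = {}" by (auto simp: A)
        then show ?thesis by simp
      next
        case False
        then have "{0..1} \<inter> A = {0..min a 1}" by (auto simp: A)
        then show ?thesis using zero[of "min a 1"] False by simp
      qed
      finally show ?case .
    next
      case empty
      then show ?case by (simp add: set_lebesgue_integral_def)
    next
      case (compl A)
      then have A: "A \<in> sets lebesgue" using gen by blast
      have "(LINT x:A \<union> (UNIV - A)|lebesgue. f0 x) = (LINT x:A|lebesgue. f0 x) + (LINT x:UNIV - A|lebesgue. f0 x)"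
        using A by (intro set_integral_Un sint) auto
      then show ?case using compl all by simp
    next
      case (union A)
      have A: "A i \<in> sets lebesgue" for i using gen union(2) by blast
      have "(LINT x:(\<Union>i. A i)|lebesgue. f0 x) = (\<Sum>i. (LINT x:A i|lebesgue. f0 x))"
        using A union(1) by (intro lebesgue_integral_countable_add sint) (auto simp: disjoint_family_on_def)
      then show ?case using union by simp
    qed
  qed
  have leb: "(LINT x:A|lebesgue. f0 x) = 0" if A: "A \<in> sets lebesgue" for A
  proof -
    obtain S N N' where S: "A = S \<union> N" "N \<subseteq> N'" "N' \<in> null_sets lborel" "S \<in> sets lborel"
      by (rule sets_completionE[OF A])
    have N: "N' \<in> null_sets lebesgue" using S(3) by (rule null_sets_completionI)
    have "(LINT x:A|lebesgue. f0 x) = (LINT x:S|lebesgue. f0 x)"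
      unfolding set_lebesgue_integral_def
    proof (rule integral_cong_AE)
      show "AE x in lebesgue. indicat_real A x *\<^sub>R f0 x = indicat_real S x *\<^sub>R f0 x"
        using AE_not_in[OF N] by eventually_elim (use S in \<open>auto simp: indicator_def\<close>)
      show "(\<lambda>x. indicat_real A x *\<^sub>R f0 x) \<in> borel_measurable lebesgue"
        using sint[OF A] by (auto simp: set_integrable_def)
      show "(\<lambda>x. indicat_real S x *\<^sub>R f0 x) \<in> borel_measurable lebesgue"
        using sint[of S] S(4) by (auto simp: set_integrable_def)
    qed
    then show ?thesis using borel S(4) by simp
  qed
  show ?thesis
  proof (rule density_zero[OF square_integrable_integrable[OF f]])
    fix A assume A: "A \<in> sets I"
    then have A': "A \<subseteq> {0..1}" "A \<in> sets lebesgue" by (auto simp: sets_restrict_space_iff)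
    have "(LINT x:A|I. f x) = (LINT x:A|lebesgue. f0 x)"
      unfolding set_lebesgue_integral_def using A'
      by (subst integral_restrict_space) (auto intro!: Bochner_Integration.integral_cong simp: f0_def indicator_def)
    then show "(LINT x:A|I. f x) = 0" using leb A' by simp
  qed
qed

text \<open>The set where the two functions agree is closed and has full measure in (0, 1), hence is
  all of [0, 1]. This makes \<open>point_value\<close> well defined.\<close>

lemma AE_eq_continuous_imp_eq:
  fixes f g :: "real \<Rightarrow> complex"
  assumes c: "continuous_on {0..1} f" "continuous_on {0..1} g" and ae: "AE x in I. f x = g x" and x: "x \<in> {0..1}"
  shows "f x = g x"
proof -
  define C where "C = {x \<in> {0..1}. f x - g x = 0}"
  have "closed C" unfolding C_def
    using c by (intro continuous_closed_preimage_constant continuous_intros) auto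
  moreover have "AE x \<in> {0<..<1} in lebesgue. x \<in> C"
    using ae by (auto simp: AE_restrict_space_iff C_def elim!: eventually_mono)
  ultimately have "{0<..<1} \<subseteq> C"
    by (auto intro: mem_closed_if_AE_lebesgue_open[of "{0<..<1}" C])
  then have "closure {0<..<1} \<subseteq> C" using \<open>closed C\<close> by (intro closure_minimal)
  then show ?thesis using x by (auto simp: C_def)
qed

section \<open>The Volterra operator and coordinates on H^1\<close>

lift_definition volterra :: "L2 \<Rightarrow> L2" is "\<lambda>f x. integral {0..x} f"
proof -
  fix f g assume r: "L2_rel f g"
  have "integral {0..x} f = integral {0..x} g" if "x \<in> {0..1}" for x
  proof -
    have "AE y in I. f y = g y" using r by (simp add: L2_rel_def)
    then have ae: "AE y in lebesgue. y \<in> {0..1} \<longrightarrow> f y = g y" by (simp add: AE_restrict_space_iff)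
    then obtain S where S: "S \<in> null_sets lebesgue" "{y. \<not> (y \<in> {0..1} \<longrightarrow> f y = g y)} \<subseteq> S"
      by (auto simp: eventually_ae_filter)
    show ?thesis
      by (rule integral_spike[of S]) (use S that in \<open>auto simp: negligible_iff_null_sets\<close>)
  qed
  then have "AE x in I. integral {0..x} f = integral {0..x} g"
    by (intro AE_I2) (simp add: space_restrict_space)
  then show "L2_rel (\<lambda>x. integral {0..x} f) (\<lambda>x. integral {0..x} g)"
    using r by (auto simp: L2_rel_def square_integrable_primitive)
qed

definition one_L2 :: L2 where "one_L2 = abs_L2 (\<lambda>_. 1)"

text \<open>The element of \<open>H\<^sup>1(0,1)\<close> with value \<open>c\<close> at \<open>0\<close> and derivative \<open>g\<close>.\<close>

definition prim :: "complex \<Rightarrow> L2 \<Rightarrow> L2" where "prim c g = c *\<^sub>C one_L2 + volterra g"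

lemma square_integrable_const: "square_integrable (\<lambda>_. c)"
  by (rule square_integrable_continuous) simp

lemma volterra_abs: "square_integrable f \<Longrightarrow> volterra (abs_L2 f) = abs_L2 (\<lambda>x. integral {0..x} f)"
  by (simp add: volterra.abs_eq L2_rel_refl_iff)

lemma prim_abs: "square_integrable f \<Longrightarrow> prim c (abs_L2 f) = abs_L2 (\<lambda>x. c + integral {0..x} f)"
  by (simp add: prim_def one_L2_def volterra_abs abs_L2_ops square_integrable_const
      square_integrable_primitive square_integrable_scale[OF square_integrable_const, of c 1, simplified])

lemma continuous_prim: "square_integrable f \<Longrightarrow> continuous_on {0..1} (\<lambda>x. c + integral {0..x} f)"
  by (intro continuous_intros continuous_primitive)

lemma L2_ip_abs_one: "square_integrable f \<Longrightarrow> L2_ip (abs_L2 f) one_L2 = integral {0..1} f"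
  by (simp add: one_L2_def abs_L2_ops square_integrable_const LINT_unit_interval)

lemma volterra_add: "volterra (u + v) = volterra u + volterra v"
proof -
  obtain f g where f: "u = abs_L2 f" "square_integrable f" "v = abs_L2 g" "square_integrable g"
    by (metis L2_cases)
  have "volterra (u + v) = abs_L2 (\<lambda>x. integral {0..x} (\<lambda>y. f y + g y))"
    using f by (simp add: abs_L2_ops volterra_abs square_integrable_add)
  also have "\<dots> = abs_L2 (\<lambda>x. integral {0..x} f + integral {0..x} g)"
    using f square_integrable_primitive[OF square_integrable_add[OF f(2,4)]]
    by (subst abs_L2_eq_iff)
      (auto simp: square_integrable_add square_integrable_primitive space_restrict_space
        square_integrable_on_subinterval Henstock_Kurzweil_Integration.integral_add intro!: AE_I2)
  finally show ?thesis using f by (simp add: volterra_abs abs_L2_ops square_integrable_primitive)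
qed

lemma volterra_scale: "volterra (c *\<^sub>C u) = c *\<^sub>C volterra u"
proof -
  obtain f where f: "u = abs_L2 f" "square_integrable f" by (rule L2_cases)
  then show ?thesis
    using abs_L2_ops(2)[OF f(2) f(2)] abs_L2_ops(2)[OF square_integrable_primitive[OF f(2)] f(2)]
    by (simp add: volterra_abs square_integrable_scale)
qed

lemma prim_add: "prim c u + prim d v = prim (c + d) (u + v)"
  by (simp add: prim_def volterra_add scaleC_add_left algebra_simps)

lemma prim_scale: "c *\<^sub>C prim d u = prim (c * d) (c *\<^sub>C u)"
  by (simp add: prim_def volterra_scale scaleC_add_right scaleC_scaleC)

lemma volterra_zero [simp]: "volterra 0 = 0"
  using volterra_scale[of 0 0] by simp

lemma volterra_diff: "volterra (u - v) = volterra u - volterra v"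
  using volterra_add[of "u - v" v] by (simp add: eq_diff_eq)

lemma prim_diff: "prim c q - prim d s = prim (c - d) (q - s)"
  using prim_add[of "c - d" "q - s" d s] by (simp add: diff_eq_eq)

lemma prim_0_0: "prim 0 0 = 0"
  by (simp add: prim_def)

lemma prim_0_add: "prim 0 (u + v) = prim 0 u + prim 0 v"
  by (simp add: prim_add)

lemma prim_0_scale: "prim 0 (c *\<^sub>C u) = c *\<^sub>C prim 0 u"
  by (simp add: prim_scale)

text \<open>In operator terms, \<open>volterra\<close> plus its adjoint is the rank-one operator
  built from \<open>one_L2\<close>. Conjugation passes through the primitive since it is bounded and
  linear over the reals.\<close>

lemma L2_ip_volterra: "L2_ip g (volterra h) + L2_ip (volterra g) h = L2_ip g one_L2 * cnj (L2_ip h one_L2)"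
proof -
  obtain e f where f: "g = abs_L2 e" "square_integrable e" "h = abs_L2 f" "square_integrable f"
    by (metis L2_cases)
  note cf = square_integrable_cnj[OF f(4)]
  have cnj: "cnj (integral {0..x} f) = integral {0..x} (\<lambda>y. cnj (f y))" if "0 \<le> x" "x \<le> 1" for x
    using integral_linear[OF square_integrable_on_subinterval[OF f(4), of 0 x] bounded_linear_cnj] that
    by (simp add: o_def)
  have "L2_ip g (volterra h) = (LINT x|I. e x * integral {0..x} (\<lambda>y. cnj (f y)))"
    using f by (simp add: volterra_abs abs_L2_ops square_integrable_primitive)
      (auto intro!: Bochner_Integration.integral_cong simp: cnj space_restrict_space)
  moreover have "L2_ip (volterra g) h = (LINT x|I. integral {0..x} e * cnj (f x))"
    using f by (simp add: volterra_abs abs_L2_ops square_integrable_primitive)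
  moreover have "L2_ip g one_L2 * cnj (L2_ip h one_L2) = (LINT x|I. e x) * (LINT x|I. cnj (f x))"
    using f by (simp add: one_L2_def abs_L2_ops square_integrable_const)
  ultimately show ?thesis using integral_by_parts_primitive[OF f(2) cf] by simp
qed

lemma norm_one_L2: "norm one_L2 = 1"
proof -
  have "(norm one_L2)\<^sup>2 = 1" unfolding one_L2_def
    by (subst norm_L2_sq) (simp_all add: square_integrable_const measure_restrict_space)
  then show ?thesis using norm_ge_zero[of one_L2] by (simp add: power2_eq_1_iff del: norm_ge_zero)
qed

text \<open>Cauchy-Schwarz against the indicator of [x, y], whose norm is
  \<open>sqrt (y - x)\<close>. Primitives of a bounded family are thus uniformly Hoelder continuous
  with exponent 1/2.\<close>

lemma norm_primitive_le:
  assumes f: "square_integrable f" and xy: "0 \<le> x" "x \<le> y" "y \<le> 1"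
  shows "cmod (integral {0..y} f - integral {0..x} f) \<le> sqrt (y - x) * norm (abs_L2 f)"
proof -
  define h where "h = (\<lambda>t. indicator {x..y} t :: complex)"
  have h: "square_integrable h"
  proof (rule square_integrable_bounded)
    show "h \<in> borel_measurable I" unfolding h_def using xy
      by (intro borel_measurable_indicator) (auto simp: sets_restrict_space_iff)
  qed (auto simp: h_def indicator_def)
  have "norm (abs_L2 h) = sqrt (y - x)"
  proof (rule power2_eq_imp_eq)
    have "(cmod (h t))\<^sup>2 = indicat_real {x..y} t" for t by (simp add: h_def indicator_def)
    then have "(norm (abs_L2 h))\<^sup>2 = (LINT t|I. indicat_real {x..y} t)" by (simp add: norm_L2_sq[OF h])
    also have "\<dots> = measure I ({x..y} \<inter> space I)" by (rule Bochner_Integration.integral_indicator)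
    also have "{x..y} \<inter> space I = {x..y}" using xy by (auto simp: space_restrict_space)
    also have "measure I {x..y} = y - x" using xy by (subst measure_restrict_space) auto
    finally show "(norm (abs_L2 h))\<^sup>2 = (sqrt (y - x))\<^sup>2" using xy by simp
  qed (use xy in auto)
  moreover have "L2_ip (abs_L2 f) (abs_L2 h) = integral {0..y} f - integral {0..x} f"
  proof -
    have fh: "square_integrable (\<lambda>t. if t \<in> {x..y} then f t else 0)"
      unfolding atLeastAtMost_iff by (rule square_integrable_restrict[OF f]) measurable
    have "L2_ip (abs_L2 f) (abs_L2 h) = (LINT t|I. (if t \<in> {x..y} then f t else 0))"
      using f h by (simp add: abs_L2_ops) (auto intro!: Bochner_Integration.integral_cong simp: h_def indicator_def)
    also have "\<dots> = integral {0..1} (\<lambda>t. if t \<in> {x..y} then f t else 0)" by (rule LINT_unit_interval[OF fh])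
    also have "\<dots> = integral ({x..y} \<inter> {0..1}) f" by (rule integral_restrict_Int)
    also have "{x..y} \<inter> {0..1} = {x..y}" using xy by auto
    also have "integral {x..y} f = integral {0..y} f - integral {0..x} f"
      using Henstock_Kurzweil_Integration.integral_combine[of 0 x y f] square_integrable_on_subinterval[OF f, of 0 y] xy by (simp add: eq_diff_eq add.commute)
    finally show ?thesis .
  qed
  ultimately show ?thesis
    using L2_cauchy_schwarz[of "abs_L2 f" "abs_L2 h"] by (simp add: mult.commute)
qed

lemma norm_L2_le_sup:
  assumes "square_integrable f" "\<And>x. x \<in> {0..1} \<Longrightarrow> cmod (f x) \<le> B" "0 \<le> B"
  shows "norm (abs_L2 f) \<le> B"
proof (rule power2_le_imp_le)
  interpret finite_measure I by (rule unit_interval_finite)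
  have "(norm (abs_L2 f))\<^sup>2 \<le> (LINT x|I. B\<^sup>2)"
    unfolding norm_L2_sq[OF assms(1)] using assms
    by (intro integral_mono) (auto simp: square_integrable_def space_restrict_space intro: power_mono)
  then show "(norm (abs_L2 f))\<^sup>2 \<le> B\<^sup>2" by (simp add: measure_restrict_space)
qed (rule assms)

lemma norm_volterra_le: "norm (volterra g) \<le> norm g"
proof -
  obtain f where f: "g = abs_L2 f" "square_integrable f" by (rule L2_cases)
  have "cmod (integral {0..x} f) \<le> norm g" if "x \<in> {0..1}" for x
  proof -
    have "cmod (integral {0..x} f) \<le> sqrt x * norm g"
      using norm_primitive_le[OF f(2), of 0 x] that f by simp
    also have "\<dots> \<le> 1 * norm g" using that by (intro mult_right_mono) auto
    finally show ?thesis by simp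
  qed
  then show ?thesis unfolding f(1) volterra_abs[OF f(2)]
    using f by (intro norm_L2_le_sup square_integrable_primitive) auto
qed

lemma volterra_compact:
  assumes "\<And>n. norm (g n) \<le> B"
  obtains r l where "strict_mono (r :: nat \<Rightarrow> nat)" "(\<lambda>n. volterra (g (r n))) \<longlonglongrightarrow> l"
proof -
  have "\<forall>n. \<exists>f. g n = abs_L2 f \<and> square_integrable f" by (metis L2_cases)
  then obtain f where f: "\<And>n. g n = abs_L2 (f n)" "\<And>n. square_integrable (f n)" by metis
  define F where "F = (\<lambda>n x. integral {0..x} (f n))"
  have B: "0 \<le> B" using assms[of 0] norm_ge_zero order_trans by blast
  have holder: "cmod (F n y - F n x) \<le> sqrt \<bar>y - x\<bar> * B" if "x \<in> {0..1}" "y \<in> {0..1}" for n x y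
  proof -
    have "cmod (F n y - F n x) \<le> sqrt \<bar>y - x\<bar> * norm (g n)"
      unfolding F_def using norm_primitive_le[OF f(2), of x y n] norm_primitive_le[OF f(2), of y x n] that f(1)
      by (cases "x \<le> y") (auto simp: norm_minus_commute abs_if)
    also have "\<dots> \<le> sqrt \<bar>y - x\<bar> * B" by (intro mult_left_mono assms) auto
    finally show ?thesis .
  qed
  have bound: "norm (F n x) \<le> B" if "x \<in> {0..1}" for n x
  proof -
    have "norm (F n x) \<le> sqrt x * B" using holder[of 0 x n] that by (simp add: F_def)
    also have "\<dots> \<le> 1 * B" using that B by (intro mult_right_mono) auto
    finally show ?thesis by simp
  qed
  \<comment> \<open>The radius \<open>(e / (B + 1))^2\<close> inverts the Hoelder bound;
    \<open>B + 1\<close> in place of \<open>B\<close> keeps the quotient meaningful when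
    \<open>B = 0\<close>.\<close>
  have equi: "\<exists>d>0. \<forall>n y. y \<in> {0..1} \<and> norm (x - y) < d \<longrightarrow> norm (F n x - F n y) < e"
    if x: "x \<in> {0..1}" and e: "0 < e" for x e
  proof (intro exI[of _ "(e / (B + 1))\<^sup>2"] conjI allI impI)
    show "0 < (e / (B + 1))\<^sup>2" using e B by simp
    fix n y assume y: "y \<in> {0..1} \<and> norm (x - y) < (e / (B + 1))\<^sup>2"
    have "norm (F n x - F n y) \<le> sqrt \<bar>x - y\<bar> * B" using holder x y by blast
    also have "\<dots> \<le> sqrt \<bar>x - y\<bar> * (B + 1)" by (intro mult_left_mono) auto
    also have "\<dots> < e / (B + 1) * (B + 1)"
    proof (rule mult_strict_right_mono)
      show "sqrt \<bar>x - y\<bar> < e / (B + 1)"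
        using y e B by (intro real_less_lsqrt) auto
    qed (use B in simp)
    finally show "norm (F n x - F n y) < e" using B by simp
  qed
  obtain h r where h: "continuous_on {0..1} h" "strict_mono (r :: nat \<Rightarrow> nat)"
      "\<And>e. 0 < e \<Longrightarrow> \<exists>N. \<forall>n x. n \<ge> N \<and> x \<in> {0..1} \<longrightarrow> norm (F (r n) x - h x) < e"
  proof (rule Arzela_Ascoli[OF compact_Icc bound equi])
    fix h k
    assume a: "continuous_on {0..1} h" "strict_mono (k :: nat \<Rightarrow> nat)"
      "\<And>e. 0 < e \<Longrightarrow> \<exists>N. \<forall>n x. n \<ge> N \<and> x \<in> {0..1} \<longrightarrow> norm (F (k n) x - h x) < e"
    show thesis by (rule that[of h k]) (fact a)+
  qed
  have "(\<lambda>n. volterra (g (r n))) \<longlonglongrightarrow> abs_L2 h"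
  proof (rule metric_LIMSEQ_I)
    fix e :: real assume e: "0 < e"
    then obtain M where M: "\<And>n x. n \<ge> M \<Longrightarrow> x \<in> {0..1} \<Longrightarrow> norm (F (r n) x - h x) < e / 2"
      using h(3)[of "e/2"] by auto
    note sh = square_integrable_continuous[OF h(1)]
    have "dist (volterra (g (r n))) (abs_L2 h) < e" if "n \<ge> M" for n
    proof -
      have sF: "square_integrable (F (r n))" unfolding F_def by (rule square_integrable_primitive[OF f(2)])
      have "volterra (g (r n)) = abs_L2 (F (r n))" by (simp add: f(1) F_def volterra_abs f(2))
      then have "dist (volterra (g (r n))) (abs_L2 h) = norm (abs_L2 (\<lambda>x. F (r n) x - h x))"
        using sF sh by (simp add: dist_norm abs_L2_ops)
      also have "\<dots> \<le> e / 2"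
        using M[OF that] e by (intro norm_L2_le_sup square_integrable_diff sF sh) (auto intro: less_imp_le)
      finally show ?thesis using e by simp
    qed
    then show "\<exists>M. \<forall>n\<ge>M. dist (volterra (g (r n))) (abs_L2 h) < e" by blast
  qed
  then show ?thesis using h(2) that by blast
qed

section \<open>Weak derivatives\<close>

lemma volterra_eq_0_iff: "volterra g = 0 \<longleftrightarrow> g = 0"
proof
  assume v: "volterra g = 0"
  obtain f where f: "g = abs_L2 f" "square_integrable f" by (rule L2_cases)
  have "abs_L2 (\<lambda>x. integral {0..x} f) = abs_L2 (\<lambda>_. 0)"
    using v f by (simp add: volterra_abs zero_L2_def)
  then have "AE x in I. integral {0..x} f = 0"
    using f by (subst (asm) abs_L2_eq_iff) (auto simp: square_integrable_primitive square_integrable_0)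
  then have "integral {0..x} f = 0" if "x \<in> {0..1}" for x
    using AE_eq_continuous_imp_eq[OF continuous_primitive[OF f(2)] continuous_on_const] that by blast
  then have "AE x in I. f x = 0" by (rule AE_zero_if_primitive_zero[OF f(2)])
  then show "g = 0" unfolding f zero_L2_def using f by (subst abs_L2_eq_iff) (auto simp: square_integrable_0)
qed simp

lemma point_value_eq:
  assumes f: "continuous_on {0..1} f" and x: "x \<in> {0..1}"
  shows "point_value (abs_L2 f) x = f x"
  unfolding point_value_def
proof (rule the_equality)
  show "\<exists>h. continuous_on {0..1} h \<and> abs_L2 f = abs_L2 h \<and> f x = h x" using f by blast
  fix c assume "\<exists>h. continuous_on {0..1} h \<and> abs_L2 f = abs_L2 h \<and> c = h x"
  then obtain h where h: "continuous_on {0..1} h" "abs_L2 f = abs_L2 h" "c = h x" by blast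
  then have "AE t in I. h t = f t"
    using f by (subst abs_L2_eq_iff[symmetric]) (auto simp: square_integrable_continuous)
  then show "c = f x" using AE_eq_continuous_imp_eq[OF h(1) f _ x] h by simp
qed

lemma point_value_prim_0: "point_value (prim c g) 0 = c"
proof -
  obtain f where f: "g = abs_L2 f" "square_integrable f" by (rule L2_cases)
  show ?thesis
    using point_value_eq[OF continuous_prim[OF f(2), of c], of 0] f by (simp add: prim_abs)
qed

lemma point_value_prim_1: "point_value (prim c g) 1 = c + L2_ip g one_L2"
proof -
  obtain f where f: "g = abs_L2 f" "square_integrable f" by (rule L2_cases)
  show ?thesis
    using point_value_eq[OF continuous_prim[OF f(2), of c], of 1] f by (simp add: prim_abs L2_ip_abs_one)
qed

text \<open>The constant is the value at 0, and \<open>volterra\<close> is injective. Uniqueness of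
  these coordinates lets weak derivatives be read off from a nested \<open>prim\<close>.\<close>

lemma prim_inject: "prim c g = prim d h \<longleftrightarrow> c = d \<and> g = h"
proof
  assume e: "prim c g = prim d h"
  then have "c = d" using point_value_prim_0 by metis
  moreover have "volterra (g - h) = 0" using e \<open>c = d\<close> by (simp add: prim_def volterra_diff)
  ultimately show "c = d \<and> g = h" by (simp add: volterra_eq_0_iff)
qed simp

lemma has_weak_deriv_abs:
  assumes "square_integrable u" "square_integrable g"
  shows "has_weak_deriv (abs_L2 u) (abs_L2 g) \<longleftrightarrow> (\<forall>\<phi>. test_function \<phi> \<longrightarrow>
    (LINT x|I. complex_of_real (deriv \<phi> x) * u x) = - (LINT x|I. complex_of_real (\<phi> x) * g x))"
  using assms by (simp add: has_weak_deriv.abs_eq L2_rel_refl_iff)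

lemma test_functionD:
  assumes "test_function \<phi>"
  shows "\<And>x. (\<phi> has_real_derivative deriv \<phi> x) (at x)" "continuous_on UNIV (deriv \<phi>)"
    "\<And>x. x \<notin> {0<..<1} \<Longrightarrow> \<phi> x = 0"
proof -
  obtain D where D: "\<And>x. (\<phi> has_vector_derivative D x) (at x)" "continuous_on UNIV D"
    using assms by (auto simp: test_function_def C1_differentiable_on_def)
  have der: "(\<phi> has_real_derivative D x) (at x)" for x
    using D(1)[of x] by (simp add: has_real_derivative_iff_has_vector_derivative)
  then have "deriv \<phi> = D" by (auto intro!: DERIV_imp_deriv)
  then show "\<And>x. (\<phi> has_real_derivative deriv \<phi> x) (at x)" "continuous_on UNIV (deriv \<phi>)"
    using der D by simp_all
  have "closure {x. \<phi> x \<noteq> 0} \<subseteq> {0<..<1}" using assms by (simp add: test_function_def)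
  then show "x \<notin> {0<..<1} \<Longrightarrow> \<phi> x = 0" for x using closure_subset[of "{x. \<phi> x \<noteq> 0}"] by blast
qed

lemma test_function_integral:
  assumes "test_function \<phi>" "0 \<le> x"
  shows "integral {0..x} (\<lambda>t. complex_of_real (deriv \<phi> t)) = complex_of_real (\<phi> x)"
proof -
  note t = test_functionD[OF assms(1)]
  have "((\<lambda>t. deriv \<phi> t) has_integral (\<phi> x - \<phi> 0)) {0..x}"
    using assms(2) t(1)
    by (intro fundamental_theorem_of_calculus)
      (auto simp: has_real_derivative_iff_has_vector_derivative[symmetric] intro: DERIV_subset)
  then have "((\<lambda>t. complex_of_real (deriv \<phi> t)) has_integral complex_of_real (\<phi> x - \<phi> 0)) {0..x}"
    using has_integral_linear[OF _ bounded_linear_of_real] by (force simp: o_def)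
  then show ?thesis using t(3)[of 0] by (simp add: integral_unique)
qed

text \<open>The derivative of a test function has integral zero; hence the constant \<open>c\<close>
  drops out and the integration by parts formula has no boundary term.\<close>

lemma has_weak_deriv_prim: "has_weak_deriv (prim c g) g"
proof -
  obtain f where f: "g = abs_L2 f" "square_integrable f" by (rule L2_cases)
  have "(LINT x|I. complex_of_real (deriv \<phi> x) * (c + integral {0..x} f)) = - (LINT x|I. complex_of_real (\<phi> x) * f x)"
    if \<phi>: "test_function \<phi>" for \<phi>
  proof -
    note t = test_functionD[OF \<phi>]
    have c: "continuous_on {0..1} (\<lambda>x. complex_of_real (deriv \<phi> x))"
      using t(2) by (intro continuous_intros) (auto intro: continuous_on_subset)
    have s: "square_integrable (\<lambda>x. complex_of_real (deriv \<phi> x))" by (rule square_integrable_continuous[OF c])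
    have z: "(LINT x|I. complex_of_real (deriv \<phi> x)) = 0"
      using LINT_unit_interval[OF s] test_function_integral[OF \<phi>, of 1] t(3)[of 1] by simp
    have "(LINT x|I. complex_of_real (deriv \<phi> x) * (c + integral {0..x} f)) =
        (LINT x|I. c * complex_of_real (deriv \<phi> x)) + (LINT x|I. complex_of_real (deriv \<phi> x) * integral {0..x} f)"
      by (subst Bochner_Integration.integral_add[symmetric])
        (auto intro!: square_integrable_integrable[OF s] integrable_mult_right square_integrable_mult[OF s]
          square_integrable_primitive f simp: algebra_simps)
    also have "\<dots> = (LINT x|I. complex_of_real (deriv \<phi> x) * integral {0..x} f)"
      by (simp only: integral_mult_right_zero z) simp
    also have "\<dots> = - (LINT x|I. integral {0..x} (\<lambda>t. complex_of_real (deriv \<phi> t)) * f x)"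
      using integral_by_parts_primitive[OF s f(2)] z by (simp add: eq_neg_iff_add_eq_0)
    also have "(LINT x|I. integral {0..x} (\<lambda>t. complex_of_real (deriv \<phi> t)) * f x) = (LINT x|I. complex_of_real (\<phi> x) * f x)"
      by (rule Bochner_Integration.integral_cong) (auto simp: test_function_integral[OF \<phi>] space_restrict_space)
    finally show ?thesis .
  qed
  then show ?thesis
    unfolding f(1) prim_abs[OF f(2)]
    using f continuous_prim[OF f(2)] by (subst has_weak_deriv_abs) (auto intro: square_integrable_continuous)
qed

subsection \<open>The lemma of du Bois-Reymond\<close>

text \<open>A primitive of the positive part: once continuously differentiable, which is the
  regularity demanded of test functions.\<close>

definition smooth_pos :: "real \<Rightarrow> real" where "smooth_pos s = (max 0 s)\<^sup>2 / 2"

lemma smooth_pos_deriv: "(smooth_pos has_real_derivative max 0 s) (at s)"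
proof -
  consider "s > 0" | "s < 0" | "s = 0" by linarith
  then show ?thesis
  proof cases
    case 1
    have "((\<lambda>s. s\<^sup>2 / 2) has_real_derivative s) (at s)" by (auto intro!: derivative_eq_intros)
    then show ?thesis
      using 1 by (subst DERIV_cong_ev[OF refl _ refl, of _ "\<lambda>s. s\<^sup>2 / 2"])
        (auto simp: smooth_pos_def max_def eventually_nhds intro!: exI[of _ "{0<..}"])
  next
    case 2
    have "((\<lambda>s. 0) has_real_derivative 0) (at s)" by (auto intro!: derivative_eq_intros)
    then show ?thesis
      using 2 by (subst DERIV_cong_ev[OF refl _ refl, of _ "\<lambda>s. 0"])
        (auto simp: smooth_pos_def max_def eventually_nhds intro!: exI[of _ "{..<0}"])
  next
    case 3
    have "((\<lambda>h. smooth_pos h / h) \<longlongrightarrow> 0) (at 0)"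
    proof (rule Lim_null_comparison)
      show "\<forall>\<^sub>F h in at 0. norm (smooth_pos h / h) \<le> \<bar>h\<bar>"
        by (rule always_eventually) (auto simp: smooth_pos_def max_def power2_eq_square abs_mult)
      show "((\<lambda>h. \<bar>h\<bar>) \<longlongrightarrow> 0) (at (0::real))" by (rule tendsto_rabs_zero) (rule tendsto_ident_at)
    qed
    then show ?thesis using 3 by (simp add: DERIV_def smooth_pos_def)
  qed
qed

text \<open>The derivative \<open>ramp n\<close> of \<open>smooth_ramp n\<close> is \<open>0\<close> on \<open>(-\<infinity>, 0]\<close>, \<open>1\<close> on \<open>[1/n, \<infinity>)\<close> and linear between.\<close>

definition ramp :: "real \<Rightarrow> real \<Rightarrow> real" where "ramp n s = n * (max 0 s - max 0 (s - 1 / n))"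
definition smooth_ramp :: "real \<Rightarrow> real \<Rightarrow> real" where "smooth_ramp n s = n * (smooth_pos s - smooth_pos (s - 1 / n))"

lemma smooth_ramp_deriv: "((\<lambda>t. smooth_ramp n (t - a)) has_real_derivative ramp n (t - a)) (at t)"
  unfolding smooth_ramp_def ramp_def
  by (auto intro!: derivative_eq_intros DERIV_chain2[OF smooth_pos_deriv])

lemma ramp_nonpos:
  assumes "0 < n" "s \<le> 0"
  shows "ramp n s = 0" "smooth_ramp n s = 0"
proof -
  have "0 < 1 / n" using assms by simp
  then have "max 0 s = 0" "max 0 (s - 1 / n) = 0" using assms by linarith+
  then show "ramp n s = 0" "smooth_ramp n s = 0" by (simp_all add: ramp_def smooth_ramp_def smooth_pos_def)
qed

lemma ramp_large: "\<lbrakk>0 < n; 1 / n \<le> s\<rbrakk> \<Longrightarrow> ramp n s = 1"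
    "\<lbrakk>0 < n; 1 / n \<le> s\<rbrakk> \<Longrightarrow> smooth_ramp n s = s - 1 / (2 * n)"
proof -
  assume n: "0 < n" "1 / n \<le> s"
  have "0 < 1 / n" using n by simp
  then have s: "0 \<le> s" using n by linarith
  show "ramp n s = 1" using n s by (simp add: ramp_def max_def)
  show "smooth_ramp n s = s - 1 / (2 * n)"
    using n s by (simp add: smooth_ramp_def smooth_pos_def max_def power2_eq_square field_simps)
qed

lemma ramp_bounds:
  assumes "0 < n"
  shows "0 \<le> ramp n s \<and> ramp n s \<le> 1"
proof -
  consider "s \<le> 0" | "0 \<le> s" "s \<le> 1 / n" | "1 / n \<le> s" by linarith
  then show ?thesis
  proof cases
    case 2
    then have "ramp n s = n * s" by (simp add: ramp_def)
    then show ?thesis using 2 assms by (simp add: field_simps)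
  qed (use assms in \<open>simp_all add: ramp_nonpos ramp_large\<close>)
qed

lemma continuous_ramp: "continuous_on S (\<lambda>t. ramp n (t - a))"
  unfolding ramp_def by (intro continuous_intros)

lemma ramp_LIMSEQ: "(\<lambda>n. ramp (real (Suc n)) s) \<longlonglongrightarrow> (if 0 < s then 1 else 0)"
proof (cases "0 < s")
  case True
  have "\<forall>\<^sub>F n in sequentially. 1 / real (Suc n) < s"
    by (rule order_tendstoD[OF LIMSEQ_Suc[OF lim_1_over_n]]) (rule True)
  then have "\<forall>\<^sub>F n in sequentially. 1 = ramp (real (Suc n)) s"
    by eventually_elim (simp add: ramp_large(1))
  then show ?thesis using True by (simp add: tendsto_eventually eventually_mono)
qed (simp add: ramp_nonpos)

text \<open>The derivatives of the test functions tend to \<open>d - c\<close> times the indicator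
  of (a, b] minus \<open>b - a\<close> times that of (c, d]. This combination has mean zero, so its
  primitive is compactly supported. In the limit, \<open>z\<close> has equal averages over the two
  intervals.\<close>

lemma deriv_zero_interval_averages:
  assumes z: "square_integrable z"
    and weak: "\<And>\<phi>. test_function \<phi> \<Longrightarrow> (LINT x|I. complex_of_real (deriv \<phi> x) * z x) = 0"
    and ab: "0 < a" "a < b" "b < 1" and cd: "0 < c" "c < d" "d < 1"
  shows "complex_of_real (d - c) * (integral {0..b} z - integral {0..a} z) =
         complex_of_real (b - a) * (integral {0..d} z - integral {0..c} z)"
proof -
  define \<phi> where "\<phi> = (\<lambda>n t. (d - c) * (smooth_ramp n (t - a) - smooth_ramp n (t - b))
      - (b - a) * (smooth_ramp n (t - c) - smooth_ramp n (t - d)))"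
  define \<psi> where "\<psi> = (\<lambda>n t. (d - c) * (ramp n (t - a) - ramp n (t - b)) - (b - a) * (ramp n (t - c) - ramp n (t - d)))"
  define \<psi>' where "\<psi>' = (\<lambda>t. (d - c) * ((if t > a then 1 else 0) - (if t > b then 1 else 0))
      - (b - a) * ((if t > c then 1 else 0) - (if t > d then 1 else (0::real))))"
  have der: "(\<phi> n has_real_derivative \<psi> n t) (at t)" for n t
    unfolding \<phi>_def \<psi>_def by (auto intro!: derivative_eq_intros smooth_ramp_deriv)
  have derphi: "deriv (\<phi> n) = \<psi> n" for n using der by (auto intro!: DERIV_imp_deriv)
  have cont: "continuous_on S (\<psi> n)" for S n
    unfolding \<psi>_def by (intro continuous_intros continuous_ramp)
  have [measurable]: "\<psi> n \<in> borel_measurable I" for n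
    by (rule continuous_imp_measurable_on_sets_lebesgue[OF cont]) simp
  have [measurable]: "z \<in> borel_measurable I" by (rule square_integrable_measurable[OF z])
  have test: "test_function (\<phi> n)" if n: "0 < n" "1 / n < 1 - max b d" for n
    unfolding test_function_def
  proof
    show "\<phi> n C1_differentiable_on UNIV"
      unfolding C1_differentiable_on_def
      using der cont by (intro exI[of _ "\<psi> n"]) (auto simp: has_real_derivative_iff_has_vector_derivative)
    have zero: "\<phi> n t = 0" if "t < min a c \<or> max b d + 1 / n < t" for t
      using that
    proof
      assume "t < min a c"
      then show ?thesis using n ab cd by (simp add: \<phi>_def ramp_nonpos)
    next
      \<comment> \<open>Beyond all four ramps the shifts \<open>1 / (2 * n)\<close> cancel in pairs,
        and \<open>(d - c) * (b - a) - (b - a) * (d - c)\<close> remains.\<close>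
      assume t: "max b d + 1 / n < t"
      then show ?thesis using n ab cd by (simp add: \<phi>_def ramp_large algebra_simps)
    qed
    have "{t. \<phi> n t \<noteq> 0} \<subseteq> {min a c..max b d + 1 / n}"
    proof
      fix t assume "t \<in> {t. \<phi> n t \<noteq> 0}"
      then have "\<not> (t < min a c \<or> max b d + 1 / n < t)" using zero[of t] by blast
      then show "t \<in> {min a c..max b d + 1 / n}" by (auto simp: min_le_iff_disj)
    qed
    then have "closure {t. \<phi> n t \<noteq> 0} \<subseteq> {min a c..max b d + 1 / n}" by (rule closure_minimal) simp
    then show "closure {t. \<phi> n t \<noteq> 0} \<subseteq> {0<..<1}" using n ab cd by fastforce
  qed
  have lim: "(\<lambda>n. \<psi> (real (Suc n)) t) \<longlonglongrightarrow> \<psi>' t" for t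
  proof -
    have "(\<lambda>n. ramp (real (Suc n)) (t - e)) \<longlonglongrightarrow> (if t > e then 1 else 0)" for e
      using ramp_LIMSEQ[of "t - e"] by simp
    then show ?thesis unfolding \<psi>_def \<psi>'_def by (intro tendsto_intros)
  qed
  have conv: "(\<lambda>n. LINT t|I. complex_of_real (\<psi> (real (Suc n)) t) * z t) \<longlonglongrightarrow> (LINT t|I. complex_of_real (\<psi>' t) * z t)"
  proof (rule integral_dominated_convergence[where w = "\<lambda>t. 2 * cmod (z t)"])
    show "(\<lambda>t. complex_of_real (\<psi>' t) * z t) \<in> borel_measurable I"
    proof (rule borel_measurable_LIMSEQ_metric)
      show "(\<lambda>t. complex_of_real (\<psi> (real (Suc n)) t) * z t) \<in> borel_measurable I" for n by measurable
      show "(\<lambda>n. complex_of_real (\<psi> (real (Suc n)) t) * z t) \<longlonglongrightarrow> complex_of_real (\<psi>' t) * z t" for t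
        by (intro tendsto_intros lim)
    qed
    show "(\<lambda>t. complex_of_real (\<psi> (real (Suc n)) t) * z t) \<in> borel_measurable I" for n by measurable
    show "integrable I (\<lambda>t. 2 * cmod (z t))" using square_integrable_integrable[OF z] by auto
    show "AE t in I. (\<lambda>n. complex_of_real (\<psi> (real (Suc n)) t) * z t) \<longlonglongrightarrow> complex_of_real (\<psi>' t) * z t"
      by (intro AE_I2 tendsto_intros lim)
    show "AE t in I. norm (complex_of_real (\<psi> (real (Suc n)) t) * z t) \<le> 2 * cmod (z t)" for n
    proof (rule AE_I2)
      fix t
      let ?n = "real (Suc n)"
      have r: "\<bar>ramp ?n s - ramp ?n s'\<bar> \<le> 1" for s s'
        using ramp_bounds[of ?n s] ramp_bounds[of ?n s'] by (simp add: abs_le_iff)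
      have "\<bar>\<psi> ?n t\<bar> \<le> \<bar>d - c\<bar> * \<bar>ramp ?n (t - a) - ramp ?n (t - b)\<bar> + \<bar>b - a\<bar> * \<bar>ramp ?n (t - c) - ramp ?n (t - d)\<bar>"
        unfolding \<psi>_def by (simp only: abs_mult[symmetric] abs_triangle_ineq4)
      also have "\<dots> \<le> 1 * 1 + 1 * 1" using ab cd r by (intro add_mono mult_mono) auto
      finally show "norm (complex_of_real (\<psi> ?n t) * z t) \<le> 2 * cmod (z t)"
        by (simp add: norm_mult mult_right_mono)
    qed
  qed
  have "\<forall>\<^sub>F n in sequentially. (LINT t|I. complex_of_real (\<psi> (real (Suc n)) t) * z t) = 0"
  proof -
    have "\<forall>\<^sub>F n in sequentially. 1 / real (Suc n) < 1 - max b d"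
      by (rule order_tendstoD[OF LIMSEQ_Suc[OF lim_1_over_n]]) (use ab cd in simp)
    then show ?thesis by eventually_elim (use weak[OF test] derphi in simp)
  qed
  then have "(LINT t|I. complex_of_real (\<psi>' t) * z t) = 0"
    by (intro LIMSEQ_unique[OF conv tendsto_eventually])
  moreover have "(LINT t|I. complex_of_real (\<psi>' t) * z t) =
      complex_of_real (d - c) * (integral {0..b} z - integral {0..a} z)
      - complex_of_real (b - a) * (integral {0..d} z - integral {0..c} z)"
  proof -
    let ?c = "\<lambda>e t. if t \<le> e then z t else 0"
    have i: "integrable I (?c e)" for e by (rule square_integrable_integrable[OF square_integrable_cutoff[OF z]])
    have "(LINT t|I. complex_of_real (\<psi>' t) * z t) =
      (LINT t|I. complex_of_real (d - c) * (?c b t - ?c a t) - complex_of_real (b - a) * (?c d t - ?c c t))"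
      using ab cd by (intro Bochner_Integration.integral_cong) (auto simp: \<psi>'_def algebra_simps)
    also have "\<dots> = complex_of_real (d - c) * ((LINT t|I. ?c b t) - (LINT t|I. ?c a t))
        - complex_of_real (b - a) * ((LINT t|I. ?c d t) - (LINT t|I. ?c c t))"
      using i by (simp del: of_real_diff)
    finally show ?thesis using ab cd by (simp add: LINT_cutoff[OF z])
  qed
  ultimately show ?thesis by simp
qed

lemma has_weak_deriv_0_imp_const:
  assumes z: "square_integrable z"
    and weak: "\<And>\<phi>. test_function \<phi> \<Longrightarrow> (LINT x|I. complex_of_real (deriv \<phi> x) * z x) = 0"
  shows "\<exists>m. AE x in I. z x = m"
proof -
  define Z where "Z = (\<lambda>x. integral {0..x} z)"
  \<comment> \<open>The average of \<open>z\<close> over [1/4, 3/4], an interval of length 1/2,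
    whence the factor 2. Comparison with this fixed interval gives \<open>Z\<close> the slope
    \<open>m\<close> on all of (0, 1).\<close>
  define m where "m = 2 * (Z (3/4) - Z (1/4))"
  define H where "H = (\<lambda>x. Z x - complex_of_real x * m)"
  have cont: "continuous_on {0..1} H"
    unfolding H_def Z_def by (intro continuous_intros continuous_primitive z)
  have less: "H a = H b" if "0 < a" "a < b" "b < 1" for a b
  proof -
    have e: "complex_of_real (1/2) * (Z b - Z a) = complex_of_real (b - a) * (Z (3/4) - Z (1/4))"
      using deriv_zero_interval_averages[OF z weak that, of "1/4" "3/4"] by (simp add: Z_def)
    have "Z b - Z a = 2 * (complex_of_real (1/2) * (Z b - Z a))" by simp
    also have "\<dots> = complex_of_real (b - a) * m" unfolding e by (simp add: m_def)
    finally show ?thesis by (simp add: H_def algebra_simps)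
  qed
  have mid: "H x = H (1/2)" if "x \<in> {0<..<1}" for x
  proof (cases x "1/2::real" rule: linorder_cases)
    assume "x < 1/2"
    then show ?thesis using that by (intro less) auto
  next
    assume "1/2 < x"
    then show ?thesis using that by (intro less[symmetric]) auto
  next
    assume "x = 1/2"
    then show ?thesis by (rule arg_cong)
  qed
  have H: "H x = H (1/2)" if "x \<in> {0..1}" for x
  proof (rule continuous_constant_on_closure[of "{0<..<1}" H])
    show "continuous_on (closure {0<..<1}) H" using cont by simp
    show "x \<in> closure {0<..<1}" using that by simp
  qed (rule mid)
  have "H 0 = 0" by (simp add: H_def Z_def)
  then have "H x = 0" if "x \<in> {0..1}" for x
    using trans[OF H[OF that] H[of 0, symmetric]] by simp
  then have "integral {0..x} (\<lambda>t. z t - m) = 0" if "x \<in> {0..1}" for x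
    using that square_integrable_on_subinterval[OF z, of 0 x]
    by (subst Henstock_Kurzweil_Integration.integral_diff) (auto simp: H_def Z_def scaleR_conv_of_real)
  then have "AE x in I. z x - m = 0"
    by (rule AE_zero_if_primitive_zero[OF square_integrable_diff[OF z square_integrable_const]])
  then show ?thesis by auto
qed

text \<open>Subtracting a primitive of \<open>g\<close> from \<open>u\<close> leaves an element with
  weak derivative zero, and such an element is constant. From here on weak differentiability is used
  only through the coordinates \<open>prim c g\<close>.\<close>

lemma has_weak_deriv_iff: "has_weak_deriv u g \<longleftrightarrow> (\<exists>c. u = prim c g)"
proof
  assume w: "has_weak_deriv u g"
  obtain h f where f: "u = abs_L2 h" "square_integrable h" "g = abs_L2 f" "square_integrable f"
    by (metis L2_cases)
  define F where "F = (\<lambda>x. 0 + integral {0..x} f)"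
  have sF: "square_integrable F" unfolding F_def using square_integrable_primitive[OF f(4)] by simp
  have sz: "square_integrable (\<lambda>x. h x - F x)" by (rule square_integrable_diff[OF f(2) sF])
  have "has_weak_deriv (abs_L2 F) g"
    using has_weak_deriv_prim[of 0 g] f prim_abs[OF f(4), of 0] by (simp add: F_def)
  then have F: "\<And>\<phi>. test_function \<phi> \<Longrightarrow>
      (LINT x|I. complex_of_real (deriv \<phi> x) * F x) = - (LINT x|I. complex_of_real (\<phi> x) * f x)"
    using f has_weak_deriv_abs[OF sF f(4)] by simp
  have h: "\<And>\<phi>. test_function \<phi> \<Longrightarrow>
      (LINT x|I. complex_of_real (deriv \<phi> x) * h x) = - (LINT x|I. complex_of_real (\<phi> x) * f x)"
    using w f has_weak_deriv_abs[OF f(2,4)] by simp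
  have "(LINT x|I. complex_of_real (deriv \<phi> x) * (h x - F x)) = 0" if \<phi>: "test_function \<phi>" for \<phi>
  proof -
    have c: "continuous_on {0..1} (\<lambda>x. complex_of_real (deriv \<phi> x))"
      using test_functionD(2)[OF \<phi>] by (intro continuous_intros) (auto intro: continuous_on_subset)
    note s = square_integrable_continuous[OF c]
    show ?thesis
      using F[OF \<phi>] h[OF \<phi>] square_integrable_mult[OF s f(2)] square_integrable_mult[OF s sF]
      by (simp add: right_diff_distrib)
  qed
  then obtain m where "AE x in I. h x - F x = m"
    using has_weak_deriv_0_imp_const[OF sz] by blast
  then have "AE x in I. h x = m + integral {0..x} f"
    by eventually_elim (auto simp: F_def algebra_simps)
  then have "u = prim m g"
    unfolding f(1,3) prim_abs[OF f(4)] using f continuous_prim[OF f(4)]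
    by (subst abs_L2_eq_iff) (auto intro: square_integrable_continuous)
  then show "\<exists>c. u = prim c g" ..
qed (auto simp: has_weak_deriv_prim)

lemma weak_deriv_prim [simp]: "weak_deriv (prim c g) = g"
  unfolding weak_deriv_def
  by (rule the_equality) (auto simp: has_weak_deriv_iff prim_inject)

section \<open>A boundary value problem\<close>

text \<open>Bridge from classical calculus: a continuously differentiable function starting at 0
  becomes an image under \<open>volterra\<close>, after which representatives of \<open>L2\<close>
  elements are no longer needed.\<close>

lemma volterra_eqI:
  assumes f: "continuous_on {0..1} f" and y: "continuous_on {0..1} y" "y 0 = 0"
    and deriv: "\<And>x. x \<in> {0..1} \<Longrightarrow> (y has_vector_derivative f x) (at x within {0..1})"
  shows "abs_L2 y = volterra (abs_L2 f)"
proof -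
  note s = square_integrable_continuous
  have "integral {0..x} f = y x" if "x \<in> {0..1}" for x
  proof -
    have "(f has_integral (y x - y 0)) {0..x}"
    proof (rule fundamental_theorem_of_calculus)
      show "(y has_vector_derivative f t) (at t within {0..x})" if "t \<in> {0..x}" for t
        by (rule has_vector_derivative_within_subset[OF deriv]) (use that \<open>x \<in> {0..1}\<close> in auto)
    qed (use that in simp)
    then show ?thesis using y by (simp add: integral_unique)
  qed
  then show ?thesis
    unfolding volterra_abs[OF s[OF f]]
    using s[OF y(1)] square_integrable_primitive[OF s[OF f]]
    by (subst abs_L2_eq_iff) (auto simp: space_restrict_space intro!: AE_I2)
qed

text \<open>Variation of constants: \<open>y x\<close> is the integral of
  \<open>exp (\<mu> * (x - t)) * f t\<close> over [0, x], factored so that \<open>x\<close> stays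
  outside the integral.\<close>

lemma volterra_first_order:
  assumes f: "continuous_on {0..1} f"
  obtains y where "continuous_on {0..1} y" "abs_L2 y = volterra (of_real \<mu> *\<^sub>C abs_L2 y + abs_L2 f)"
proof -
  define F where "F = (\<lambda>x. integral {0..x} (\<lambda>t. exp (- complex_of_real \<mu> * complex_of_real t) * f t))"
  define y where "y = (\<lambda>x. exp (complex_of_real \<mu> * complex_of_real x) * F x)"
  have c: "continuous_on {0..1} (\<lambda>t. exp (- complex_of_real \<mu> * complex_of_real t) * f t)"
    by (intro continuous_intros f)
  have F: "(F has_vector_derivative exp (- complex_of_real \<mu> * complex_of_real x) * f x) (at x within {0..1})"
    if "x \<in> {0..1}" for x
    unfolding F_def using integral_has_vector_derivative[OF c that] .
  have e: "((\<lambda>x. exp (complex_of_real \<mu> * complex_of_real x)) has_vector_derivative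
      complex_of_real \<mu> * exp (complex_of_real \<mu> * complex_of_real x)) (at x within {0..1})" for x
    by (rule has_vector_derivative_real_field) (auto intro!: derivative_eq_intros)
  have d: "(y has_vector_derivative complex_of_real \<mu> * y x + f x) (at x within {0..1})" if "x \<in> {0..1}" for x
    using has_vector_derivative_mult[OF e F[OF that]]
    by (simp add: y_def algebra_simps exp_minus_inverse flip: mult.assoc exp_add)
  have yc: "continuous_on {0..1} y"
    using d by (intro continuous_on_vector_derivative) auto
  have "abs_L2 y = volterra (abs_L2 (\<lambda>x. complex_of_real \<mu> * y x + f x))"
    by (rule volterra_eqI) (use yc f d in \<open>auto intro!: continuous_intros simp: y_def F_def\<close>)
  moreover have "of_real \<mu> *\<^sub>C abs_L2 y + abs_L2 f = abs_L2 (\<lambda>x. complex_of_real \<mu> * y x + f x)"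
    using square_integrable_continuous[OF yc] square_integrable_continuous[OF f]
    by (simp add: abs_L2_ops square_integrable_scale)
  ultimately have "abs_L2 y = volterra (of_real \<mu> *\<^sub>C abs_L2 y + abs_L2 f)" by (simp only:)
  then show ?thesis using yc that by blast
qed

text \<open>Factor \<open>D\<^sup>2 - \<mu>\<^sup>2 = (D - \<mu>) (D + \<mu>)\<close>.\<close>

lemma volterra_second_order:
  assumes f: "continuous_on {0..1} f"
  obtains p q where "p = volterra q" "q = volterra (of_real (\<mu>\<^sup>2) *\<^sub>C p + abs_L2 f)"
proof -
  obtain z where z: "continuous_on {0..1} z"
      "abs_L2 z = volterra (of_real \<mu> *\<^sub>C abs_L2 z + abs_L2 f)"
    using volterra_first_order[OF f] by blast
  obtain y where y: "abs_L2 y = volterra (of_real (- \<mu>) *\<^sub>C abs_L2 y + abs_L2 z)"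
    using volterra_first_order[OF z(1)] by blast
  \<comment> \<open>\<open>q\<close> is the derivative of \<open>p = abs_L2 y\<close>.
    Differentiating once more gives \<open>\<mu> z + f - \<mu> q\<close>, and
    \<open>z - q = \<mu> p\<close>.\<close>
  define q where "q = of_real (- \<mu>) *\<^sub>C abs_L2 y + abs_L2 z"
  let ?m = "complex_of_real \<mu>"
  have p: "abs_L2 y = volterra q" using y by (simp add: q_def)
  have "q = (- ?m) *\<^sub>C volterra q + volterra (?m *\<^sub>C abs_L2 z + abs_L2 f)"
    unfolding p[symmetric] z(2)[symmetric] by (simp add: q_def)
  also have "\<dots> = volterra ((- ?m) *\<^sub>C q + (?m *\<^sub>C abs_L2 z + abs_L2 f))"
    by (simp only: volterra_add volterra_scale)
  also have "(- ?m) *\<^sub>C q + (?m *\<^sub>C abs_L2 z + abs_L2 f) = of_real (\<mu>\<^sup>2) *\<^sub>C abs_L2 y + abs_L2 f"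
    by (simp add: q_def cvec.scale_right_distrib cvec.scale_right_diff_distrib power2_eq_square)
  finally show ?thesis using that[OF p] by simp
qed

text \<open>\<open>c + L2_ip g one_L2\<close> and \<open>d + L2_ip h one_L2\<close> are the values
  at 1 of \<open>prim c g\<close> and \<open>prim d h\<close>, while \<open>c\<close> and
  \<open>d\<close> are those at 0, so the right side is the boundary term at 1 minus the one at
  0.\<close>

lemma L2_ip_parts:
  "L2_ip g (prim d h) + L2_ip (prim c g) h = (c + L2_ip g one_L2) * cnj (d + L2_ip h one_L2) - c * cnj d"
  using L2_ip_volterra[of g h] L2_ip_commute[of h one_L2]
  by (simp add: prim_def L2_ip_add_left L2_ip_add_right L2_ip_scale_left L2_ip_scale_right algebra_simps)

lemma norm_prim_le: "norm (prim c g) \<le> cmod c + norm g"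
  using norm_triangle_ineq[of "c *\<^sub>C one_L2" "volterra g"] norm_volterra_le[of g]
  by (simp add: prim_def norm_scaleC norm_one_L2)

lemma cmod_prim_le: "cmod c \<le> norm (prim c g) + norm g"
  using norm_triangle_ineq4[of "prim c g" "volterra g"] norm_volterra_le[of g]
  by (simp add: prim_def norm_scaleC norm_one_L2)

text \<open>Trace estimate: the value at 0 costs \<open>norm (prim c g) + norm g\<close>, and
  integrating \<open>g\<close> up to 1 costs another \<open>norm g\<close>.\<close>

lemma cmod_prim_1_le: "cmod (c + L2_ip g one_L2) \<le> norm (prim c g) + 2 * norm g"
  using norm_triangle_ineq[of c "L2_ip g one_L2"] cmod_prim_le[of c g] L2_cauchy_schwarz[of g one_L2]
  by (simp add: norm_one_L2)

text \<open>Shooting from 0: \<open>p1\<close> solves the inhomogeneous equation with zero data,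
  \<open>prim 1 q0\<close> the homogeneous one with value 1 and slope 0, and the multiple
  \<open>s\<close> of the latter adjusts the slope at 1. The second conclusion prescribes that
  slope, since \<open>q\<close> is a primitive starting at 0.\<close>

lemma boundary_value_problem:
  assumes G: "continuous_on {0..1} f" and \<mu>: "\<mu> \<noteq> 0"
  obtains c q where "q = volterra (of_real (\<mu>\<^sup>2) *\<^sub>C prim c q + abs_L2 f)"
    "L2_ip (of_real (\<mu>\<^sup>2) *\<^sub>C prim c q + abs_L2 f) one_L2 = b"
proof -
  let ?m = "complex_of_real (\<mu>\<^sup>2)"
  obtain p1 q1 where 1: "p1 = volterra q1" "q1 = volterra (?m *\<^sub>C p1 + abs_L2 f)"
    using volterra_second_order[OF G] by blast
  \<comment> \<open>The constant forcing shifts the unknown by 1: \<open>1 + p0\<close> solves the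
    homogeneous equation.\<close>
  obtain p0 q0 where 0: "p0 = volterra q0" "q0 = volterra (?m *\<^sub>C p0 + abs_L2 (\<lambda>_. ?m))"
    using volterra_second_order[OF continuous_on_const] by blast
  have "abs_L2 (\<lambda>_. ?m) = ?m *\<^sub>C one_L2"
    using abs_L2_ops(2)[OF square_integrable_const square_integrable_const, of ?m 1] by (simp add: one_L2_def)
  then have r0: "?m *\<^sub>C p0 + abs_L2 (\<lambda>_. ?m) = ?m *\<^sub>C prim 1 q0"
    using 0(1) by (simp add: prim_def cvec.scale_right_distrib add.commute)
  define a0 where "a0 = L2_ip (?m *\<^sub>C prim 1 q0) one_L2"
  \<comment> \<open>If the slope at 1 vanished, pairing the homogeneous equation with its solution
    would leave no boundary term, so \<open>\<mu>^2 * (norm (prim 1 q0))^2 + (norm q0)^2\<close>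
    would be 0, against the value 1 at 0.\<close>
  have a0: "a0 \<noteq> 0"
  proof
    assume "a0 = 0"
    then have "L2_ip (?m *\<^sub>C prim 1 q0) (prim 1 q0) + L2_ip q0 q0 = 0"
      using L2_ip_parts[of "?m *\<^sub>C prim 1 q0" 1 q0 0] 0(2) r0 by (simp add: a0_def prim_def)
    then have "complex_of_real (\<mu>\<^sup>2 * (norm (prim 1 q0))\<^sup>2 + (norm q0)\<^sup>2) = 0"
      by (simp add: L2_ip_scale_left L2_ip_eq_norm_sq)
    then have "\<mu>\<^sup>2 * (norm (prim 1 q0))\<^sup>2 + (norm q0)\<^sup>2 = 0" by (simp only: of_real_eq_0_iff)
    then have "prim 1 q0 = 0" using \<mu> by (auto simp: add_nonneg_eq_0_iff)
    moreover have "prim 0 0 = 0" by (simp add: prim_def)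
    ultimately show False using prim_inject[of 1 q0 0 0] by simp
  qed
  define a1 where "a1 = L2_ip (?m *\<^sub>C p1 + abs_L2 f) one_L2"
  define s where "s = (b - a1) / a0"
  define q where "q = q1 + s *\<^sub>C q0"
  have "prim s q = p1 + s *\<^sub>C prim 1 q0"
    by (simp add: q_def 1(1) prim_def volterra_add volterra_scale cvec.scale_right_distrib)
  then have r: "?m *\<^sub>C prim s q + abs_L2 f = (?m *\<^sub>C p1 + abs_L2 f) + s *\<^sub>C (?m *\<^sub>C prim 1 q0)"
    by (simp add: cvec.scale_right_distrib mult.commute add.commute add.left_commute)
  show ?thesis
  proof (rule that)
    show "q = volterra (?m *\<^sub>C prim s q + abs_L2 f)"
    proof -
      have lin: "volterra (u + s *\<^sub>C v) = volterra u + s *\<^sub>C volterra v" for u v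
        by (simp only: volterra_add volterra_scale)
      show ?thesis
        unfolding r lin 1(2)[symmetric] 0(2)[unfolded r0, symmetric] by (rule q_def)
    qed
    show "L2_ip (?m *\<^sub>C prim s q + abs_L2 f) one_L2 = b"
      unfolding r using a0 by (simp only: L2_ip_add_left[of "_ + _"] L2_ip_scale_left[of s] a1_def[symmetric] a0_def[symmetric])
        (simp add: s_def)
  qed
qed

section \<open>The state space\<close>

lemma mem_sobolev_H_Suc: "u \<in> sobolev_H (Suc k) \<longleftrightarrow> (\<exists>c g. u = prim c g \<and> g \<in> sobolev_H k)"
  by (auto simp: has_weak_deriv_iff)

lemma sobolev_H0_1_iff: "w \<in> sobolev_H0 1 \<longleftrightarrow> (\<exists>p. w = prim 0 p)"
  using mem_sobolev_H_Suc[of w 0] by (auto simp: sobolev_H0_def point_value_prim_0)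

lemma sobolev_H_2_iff: "w \<in> sobolev_H 2 \<longleftrightarrow> (\<exists>a c q. w = prim a (prim c q))"
proof -
  have "w \<in> sobolev_H (Suc (Suc 0)) \<longleftrightarrow> (\<exists>a c q. w = prim a (prim c q))"
    unfolding mem_sobolev_H_Suc sobolev_H.simps(1) by blast
  then show ?thesis by (simp only: numeral_2_eq_2)
qed

lemma sobolev_H0_2_iff: "w \<in> sobolev_H0 2 \<longleftrightarrow> (\<exists>c q. w = prim 0 (prim c q))"
  unfolding sobolev_H0_def mem_Collect_eq sobolev_H_2_iff by (metis point_value_prim_0)

lemma sobolev_H_4_iff: "w \<in> sobolev_H 4 \<longleftrightarrow> (\<exists>a c b e k. w = prim a (prim c (prim b (prim e k))))"
proof -
  have "w \<in> sobolev_H (Suc (Suc (Suc (Suc 0)))) \<longleftrightarrow> (\<exists>a c b e k. w = prim a (prim c (prim b (prim e k))))"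
    unfolding mem_sobolev_H_Suc sobolev_H.simps(1) by blast
  moreover have "(4::nat) = Suc (Suc (Suc (Suc 0)))" by simp
  ultimately show ?thesis by (simp only:)
qed

lemma state_space_iff: "x \<in> state_space \<longleftrightarrow> (\<exists>c q v. x = (prim 0 (prim c q), v))"
  by (cases x) (auto simp: state_space_def sobolev_H0_2_iff)

lemma state_cases:
  assumes "x \<in> state_space"
  obtains c q v where "x = (prim 0 (prim c q), v)"
  using assms state_space_iff by blast

lemma state_ops:
  "(prim 0 (prim c q), v) + (prim 0 (prim d s), u) = (prim 0 (prim (c + d) (q + s)), v + u)"
  "a *\<^sub>C (prim 0 (prim c q), v) = (prim 0 (prim (a * c) (a *\<^sub>C q)), a *\<^sub>C v)"
  "(prim 0 (prim c q), v) - (prim 0 (prim d s), u) = (prim 0 (prim (c - d) (q - s)), v - u)"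
proof -
  show add: "(prim 0 (prim c q), v) + (prim 0 (prim d s), u) = (prim 0 (prim (c + d) (q + s)), v + u)" for c q v d s u
    by (simp add: prim_add)
  show "a *\<^sub>C (prim 0 (prim c q), v) = (prim 0 (prim (a * c) (a *\<^sub>C q)), a *\<^sub>C v)"
    by (simp add: scaleC_prod_def prim_scale)
  show "(prim 0 (prim c q), v) - (prim 0 (prim d s), u) = (prim 0 (prim (c - d) (q - s)), v - u)"
    by (simp add: prim_diff)
qed

locale beam =
  fixes \<beta> \<eta> \<kappa> \<gamma> :: real
  assumes nonneg: "0 \<le> \<beta>" "0 \<le> \<eta>" "0 \<le> \<kappa>" and \<gamma>: "\<eta>\<^sup>2 < \<gamma>"
begin

definition g :: real where "g = \<gamma> - \<eta>\<^sup>2"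

lemma g_pos: "0 < g"
  using \<gamma> by (simp add: g_def)

abbreviation ip where "ip \<equiv> state_ip \<gamma> \<eta>"

lemma ip_prim:
  "ip (prim 0 (prim c q), v) (prim 0 (prim d s), u) =
    L2_ip q s + complex_of_real g * L2_ip (prim c q) (prim d s) + L2_ip v u"
  by (simp add: state_ip_def g_def numeral_2_eq_2)

lemma ip_norm_sq:
  "(ip_norm ip (prim 0 (prim c q), v))\<^sup>2 = (norm q)\<^sup>2 + g * (norm (prim c q))\<^sup>2 + (norm v)\<^sup>2"
proof -
  have "Re (ip (prim 0 (prim c q), v) (prim 0 (prim c q), v)) = (norm q)\<^sup>2 + g * (norm (prim c q))\<^sup>2 + (norm v)\<^sup>2"
    by (simp add: ip_prim L2_ip_eq_norm_sq flip: of_real_power)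
  then show ?thesis using g_pos by (simp add: ip_norm_def)
qed

lemma ip_norm_nonneg: "0 \<le> ip_norm ip (prim 0 (prim c q), v)"
proof -
  have "Re (ip (prim 0 (prim c q), v) (prim 0 (prim c q), v)) = (norm q)\<^sup>2 + g * (norm (prim c q))\<^sup>2 + (norm v)\<^sup>2"
    by (simp add: ip_prim L2_ip_eq_norm_sq flip: of_real_power)
  then show ?thesis using g_pos by (simp add: ip_norm_def)
qed

lemma components_le_ip_norm:
  shows "norm q \<le> ip_norm ip (prim 0 (prim c q), v)"
    and "sqrt g * norm (prim c q) \<le> ip_norm ip (prim 0 (prim c q), v)"
    and "norm v \<le> ip_norm ip (prim 0 (prim c q), v)"
  using ip_norm_sq[of c q v] ip_norm_nonneg[of c q v] g_pos
  by (auto intro!: power2_le_imp_le[where y = "ip_norm ip (prim 0 (prim c q), v)"] simp: power_mult_distrib)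

lemma ip_norm_le:
  "ip_norm ip (prim 0 (prim c q), v) \<le> norm q + sqrt g * norm (prim c q) + norm v"
proof (rule power2_le_imp_le)
  have "a\<^sup>2 + b\<^sup>2 + c\<^sup>2 \<le> (a + b + c)\<^sup>2" if "0 \<le> a" "0 \<le> b" "0 \<le> c" for a b c :: real
    using that by (simp add: power2_eq_square algebra_simps)
  from this[of "norm q" "sqrt g * norm (prim c q)" "norm v"]
  show "(ip_norm ip (prim 0 (prim c q), v))\<^sup>2 \<le> (norm q + sqrt g * norm (prim c q) + norm v)\<^sup>2"
    using g_pos by (simp add: ip_norm_sq power_mult_distrib)
qed (use g_pos in auto)

text \<open>Convergence of w'(0), w'' and v controls w' as well, because w' is
  \<open>prim c q\<close> and \<open>norm_prim_le\<close> applies. Completeness and compactness are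
  both reduced to these three coordinates.\<close>

lemma state_tendsto:
  assumes c: "c \<longlonglongrightarrow> c'" and q: "q \<longlonglongrightarrow> q'" and v: "v \<longlonglongrightarrow> v'"
  shows "(\<lambda>n. ip_norm ip ((prim 0 (prim (c n) (q n)), v n) - (prim 0 (prim c' q'), v'))) \<longlonglongrightarrow> 0"
proof (rule Lim_null_comparison)
  show "\<forall>\<^sub>F n in sequentially. norm (ip_norm ip ((prim 0 (prim (c n) (q n)), v n) - (prim 0 (prim c' q'), v')))
      \<le> norm (q n - q') + sqrt g * (cmod (c n - c') + norm (q n - q')) + norm (v n - v')"
  proof (rule always_eventually, rule allI)
    fix n
    have "ip_norm ip (prim 0 (prim (c n - c') (q n - q')), v n - v') \<le>
        norm (q n - q') + sqrt g * norm (prim (c n - c') (q n - q')) + norm (v n - v')" by (rule ip_norm_le)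
    also have "\<dots> \<le> norm (q n - q') + sqrt g * (cmod (c n - c') + norm (q n - q')) + norm (v n - v')"
      using g_pos by (intro add_mono mult_left_mono norm_prim_le) auto
    finally show "norm (ip_norm ip ((prim 0 (prim (c n) (q n)), v n) - (prim 0 (prim c' q'), v')))
      \<le> norm (q n - q') + sqrt g * (cmod (c n - c') + norm (q n - q')) + norm (v n - v')"
      by (simp only: state_ops(3) real_norm_def abs_of_nonneg[OF ip_norm_nonneg])
  qed
  have "(\<lambda>n. norm (q n - q') + sqrt g * (cmod (c n - c') + norm (q n - q')) + norm (v n - v')) \<longlonglongrightarrow>
      norm (q' - q') + sqrt g * (cmod (c' - c') + norm (q' - q')) + norm (v' - v')"
    by (intro tendsto_intros c q v)
  then show "(\<lambda>n. norm (q n - q') + sqrt g * (cmod (c n - c') + norm (q n - q')) + norm (v n - v')) \<longlonglongrightarrow> 0"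
    by simp
qed

lemma hilbert_carrier_state_space: "hilbert_carrier state_space ip"
proof
  show "csubspace state_space"
    unfolding csubspace_iff
  proof (intro conjI ballI allI)
    show "0 \<in> state_space" unfolding state_space_iff zero_prod_def by (metis prim_0_0)
    show "x + y \<in> state_space" if "x \<in> state_space" "y \<in> state_space" for x y
      using that by (metis state_ops(1) state_space_iff)
    show "c *\<^sub>C x \<in> state_space" if "x \<in> state_space" for x c
      using that by (metis state_ops(2) state_space_iff)
  qed
next
  fix x y z :: "L2 \<times> L2" assume "x \<in> state_space" "y \<in> state_space" "z \<in> state_space"
  then show "ip (x + y) z = ip x z + ip y z"
    by (elim state_cases, simp only: state_ops ip_prim)
      (simp add: prim_add[symmetric] L2_ip_add_left algebra_simps)
next
  fix x y :: "L2 \<times> L2" and c assume "x \<in> state_space" "y \<in> state_space"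
  then show "ip (c *\<^sub>C x) y = c * ip x y"
    by (elim state_cases, simp only: state_ops ip_prim)
      (simp add: prim_scale[symmetric] L2_ip_scale_left distrib_left mult.left_commute)
next
  fix x y :: "L2 \<times> L2" assume x: "x \<in> state_space" "y \<in> state_space"
  then obtain c q v d s u where e: "x = (prim 0 (prim c q), v)" "y = (prim 0 (prim d s), u)"
    by (metis state_space_iff)
  show "ip y x = cnj (ip x y)"
    unfolding e ip_prim
    using L2_ip_commute[of q s] L2_ip_commute[of "prim c q" "prim d s"] L2_ip_commute[of v u] by simp
next
  fix x :: "L2 \<times> L2" assume x: "x \<in> state_space" "x \<noteq> 0"
  then obtain c q v where e: "x = (prim 0 (prim c q), v)" by (metis state_space_iff)
  have "0 < (norm q)\<^sup>2 + g * (norm (prim c q))\<^sup>2 + (norm v)\<^sup>2"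
  proof (cases "v = 0")
    case True
    then have "prim c q \<noteq> 0" using x(2) e prim_0_0 by (auto simp: zero_prod_def)
    then have "0 < g * (norm (prim c q))\<^sup>2" using g_pos by simp
    then show ?thesis using zero_le_power2[of "norm q"] zero_le_power2[of "norm v"] by linarith
  qed (use g_pos in \<open>auto intro!: add_nonneg_pos\<close>)
  then show "0 < Re (ip x x)" unfolding e
    by (simp add: ip_prim L2_ip_eq_norm_sq flip: of_real_power)
next
  fix f :: "nat \<Rightarrow> L2 \<times> L2"
  assume f: "\<And>n. f n \<in> state_space" and C: "\<And>e. 0 < e \<Longrightarrow> \<exists>M. \<forall>m\<ge>M. \<forall>n\<ge>M. ip_norm ip (f m - f n) < e"
  have "\<forall>n. \<exists>c q v. f n = (prim 0 (prim c q), v)" using f state_space_iff by blast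
  then obtain c q v where e: "\<And>n. f n = (prim 0 (prim (c n) (q n)), v n)" by metis
  have diff: "f m - f n = (prim 0 (prim (c m - c n) (q m - q n)), v m - v n)" for m n
    by (simp add: e prim_diff)
  have pdiff: "prim (c m - c n) (q m - q n) = prim (c m) (q m) - prim (c n) (q n)" for m n
    by (simp add: prim_diff)
  have Cq: "Cauchy q"
    unfolding Cauchy_def dist_norm
    using C components_le_ip_norm(1) by (metis diff le_less_trans)
  then obtain q' where q': "q \<longlonglongrightarrow> q'" by (auto simp: Cauchy_convergent_iff convergent_def)
  have "Cauchy v"
    unfolding Cauchy_def dist_norm
    using C components_le_ip_norm(3) by (metis diff le_less_trans)
  then obtain v' where v': "v \<longlonglongrightarrow> v'" by (auto simp: Cauchy_convergent_iff convergent_def)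
  have Cp: "Cauchy (\<lambda>n. prim (c n) (q n))"
    unfolding Cauchy_def dist_norm
  proof (intro allI impI)
    fix \<epsilon> :: real assume "0 < \<epsilon>"
    then have "0 < sqrt g * \<epsilon>" using g_pos by simp
    then obtain M where M: "\<And>m n. \<lbrakk>m \<ge> M; n \<ge> M\<rbrakk> \<Longrightarrow> ip_norm ip (f m - f n) < sqrt g * \<epsilon>" using C by blast
    have "norm (prim (c m) (q m) - prim (c n) (q n)) < \<epsilon>" if "m \<ge> M" "n \<ge> M" for m n
      using le_less_trans[OF components_le_ip_norm(2) M[OF that, unfolded diff]] g_pos by (simp add: pdiff)
    then show "\<exists>M. \<forall>m\<ge>M. \<forall>n\<ge>M. norm (prim (c m) (q m) - prim (c n) (q n)) < \<epsilon>" by blast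
  qed
  \<comment> \<open>The slope w'(0) is not a term of the norm; it is recovered from w' and w'' by
    \<open>cmod_prim_le\<close>.\<close>
  have "Cauchy c"
    unfolding Cauchy_def dist_norm
  proof (intro allI impI)
    fix \<epsilon> :: real assume "0 < \<epsilon>"
    then have "0 < \<epsilon> / 2" by simp
    from metric_CauchyD[OF Cp this] metric_CauchyD[OF Cq this]
    obtain M M' where M: "\<forall>m\<ge>M. \<forall>n\<ge>M. norm (prim (c m) (q m) - prim (c n) (q n)) < \<epsilon> / 2"
      "\<forall>m\<ge>M'. \<forall>n\<ge>M'. norm (q m - q n) < \<epsilon> / 2"
      unfolding dist_norm by blast
    have "cmod (c m - c n) < \<epsilon>" if "m \<ge> max M M'" "n \<ge> max M M'" for m n
    proof -
      have "norm (prim (c m) (q m) - prim (c n) (q n)) < \<epsilon> / 2" "norm (q m - q n) < \<epsilon> / 2"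
        using M that by auto
      then show ?thesis using cmod_prim_le[of "c m - c n" "q m - q n"] by (simp add: pdiff)
    qed
    then show "\<exists>M. \<forall>m\<ge>M. \<forall>n\<ge>M. cmod (c m - c n) < \<epsilon>" by blast
  qed
  then obtain c' where c': "c \<longlonglongrightarrow> c'" by (auto simp: Cauchy_convergent_iff convergent_def)
  show "\<exists>l\<in>state_space. (\<lambda>n. ip_norm ip (f n - l)) \<longlonglongrightarrow> 0"
    using state_tendsto[OF c' q' v'] by (intro bexI[of _ "(prim 0 (prim c' q'), v')"]) (auto simp: e state_space_iff)
qed

end

section \<open>The closed-loop operator\<close>

context beam
begin

abbreviation T where "T \<equiv> op_T \<beta> \<gamma> \<eta> \<kappa>"

text \<open>For \<open>w = disp c e k\<close> and \<open>v = prim 0 (prim d s)\<close> one has \<open>w(0) = w''(0) = 0\<close>, \<open>w'(0) = c\<close>, \<open>w'''(0) = e\<close>,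
  \<open>w'''' = k\<close>, \<open>v'(0) = d\<close>, \<open>v'' = s\<close>, and values at \<open>1\<close> are obtained from those at \<open>0\<close> by adding the
  inner product of the derivative with \<open>1\<close>.\<close>

abbreviation disp :: "complex \<Rightarrow> complex \<Rightarrow> L2 \<Rightarrow> L2"
  where "disp c e k \<equiv> prim 0 (prim c (prim 0 (prim e k)))"

abbreviation accel :: "complex \<Rightarrow> L2 \<Rightarrow> complex \<Rightarrow> L2 \<Rightarrow> L2"
  where "accel e k d s \<equiv> - k + of_real g *\<^sub>C prim 0 (prim e k) - of_real (2 * \<beta> * \<eta>) *\<^sub>C prim d s"

abbreviation moment_bc :: "complex \<Rightarrow> L2 \<Rightarrow> complex \<Rightarrow> L2 \<Rightarrow> bool"
  where "moment_bc e k d s \<equiv> L2_ip (prim e k) one_L2 + complex_of_real \<kappa> * (d + L2_ip s one_L2) = 0"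

abbreviation shear_bc :: "complex \<Rightarrow> complex \<Rightarrow> L2 \<Rightarrow> bool"
  where "shear_bc c e k \<equiv> e + L2_ip k one_L2 = complex_of_real g * (c + L2_ip (prim 0 (prim e k)) one_L2)"

text \<open>The bounded quantities are w', w'', w''', w'(0) and v'. Those on w''' and v' go one
  derivative beyond the state norm, which is the gain behind compactness.\<close>

abbreviation energy_le :: "complex \<Rightarrow> complex \<Rightarrow> L2 \<Rightarrow> complex \<Rightarrow> L2 \<Rightarrow> real \<Rightarrow> bool"
  where "energy_le c e k d s b \<equiv> norm (prim c (prim 0 (prim e k))) \<le> b \<and> norm (prim 0 (prim e k)) \<le> b \<and>
    norm (prim e k) \<le> b \<and> cmod c \<le> b \<and> norm (prim d s) \<le> b"

section \<open>Coordinates of the domain, linearity of the operator\<close>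

lemma dom_A_iff: "(w, v) \<in> dom_A \<gamma> \<eta> \<kappa> \<longleftrightarrow>
  (\<exists>c e k d s. w = disp c e k \<and> v = prim 0 (prim d s) \<and> moment_bc e k d s \<and> shear_bc c e k)" (is "_ \<longleftrightarrow> ?R")
proof
  assume D: "(w, v) \<in> dom_A \<gamma> \<eta> \<kappa>"
  then have mem: "w \<in> sobolev_H 4" "w \<in> sobolev_H0 2" "v \<in> sobolev_H0 2" by (auto simp: dom_A_def)
  obtain a c b e k where w: "w = prim a (prim c (prim b (prim e k)))" using mem(1) sobolev_H_4_iff by blast
  obtain d s where v: "v = prim 0 (prim d s)" using mem(3) sobolev_H0_2_iff by blast
  have "a = 0" using mem(2) w by (simp add: sobolev_H0_def point_value_prim_0)
  moreover have "b = 0" using D w by (simp add: dom_A_def numeral_2_eq_2 point_value_prim_0)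
  moreover have "moment_bc e k d s"
    using D w v \<open>b = 0\<close> by (simp add: dom_A_def numeral_2_eq_2 point_value_prim_1)
  moreover have "shear_bc c e k"
    using D w \<open>b = 0\<close> by (simp add: dom_A_def numeral_2_eq_2 numeral_3_eq_3 point_value_prim_1 g_def)
  ultimately show ?R using w v by blast
next
  assume ?R
  then obtain c e k d s where *: "w = disp c e k" "v = prim 0 (prim d s)" "moment_bc e k d s" "shear_bc c e k"
    by blast
  have "w \<in> sobolev_H 4" "w \<in> sobolev_H0 2" "v \<in> sobolev_H0 2" "(w, v) \<in> state_space"
    using * sobolev_H_4_iff sobolev_H0_2_iff state_space_iff by blast+
  then show "(w, v) \<in> dom_A \<gamma> \<eta> \<kappa>"
    using * by (simp add: dom_A_def numeral_2_eq_2 numeral_3_eq_3 point_value_prim_0 point_value_prim_1 g_def)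
qed

lemma T_iff: "(x, u) \<in> T \<longleftrightarrow> (\<exists>c e k d s. x = (disp c e k, prim 0 (prim d s)) \<and>
    u = (prim 0 (prim d s), accel e k d s) \<and> moment_bc e k d s \<and> shear_bc c e k)" (is "_ \<longleftrightarrow> ?R")
proof -
  define f where "f = (\<lambda>w v. - (weak_deriv ^^ 4) w + of_real g *\<^sub>C (weak_deriv ^^ 2) w
    - of_real (2 * \<beta> * \<eta>) *\<^sub>C weak_deriv v)"
  have f: "f (disp c e k) (prim 0 (prim d s)) = accel e k d s" for c e k d s
    by (simp add: f_def eval_nat_numeral)
  have "sobolev_H0 2 \<subseteq> sobolev_H0 1" using sobolev_H0_1_iff sobolev_H0_2_iff by blast
  then have "dom_A \<gamma> \<eta> \<kappa> \<subseteq> sobolev_H0 2 \<times> sobolev_H0 1" by (auto simp: dom_A_def)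
  then have "(x, u) \<in> T \<longleftrightarrow> (\<exists>w v. x = (w, v) \<and> (w, v) \<in> dom_A \<gamma> \<eta> \<kappa> \<and> u = (v, f w v))"
    by (cases x) (auto simp: op_T_def op_sum_def op_A_def op_B_def op_graph_def g_def f_def)
  also have "\<dots> \<longleftrightarrow> ?R" unfolding dom_A_iff using f by metis
  finally show ?thesis .
qed

lemma T_cases:
  assumes "(x, u) \<in> T"
  obtains c e k d s where "x = (disp c e k, prim 0 (prim d s))"
    "u = (prim 0 (prim d s), accel e k d s)"
    "moment_bc e k d s"
    "shear_bc c e k"
  using assms T_iff by blast

lemma linear_T: "linear_operator state_space T"
  unfolding linear_operator_def
proof (intro conjI)
  show "T \<subseteq> state_space \<times> state_space"
  proof clarify
    fix x u assume "(x, u) \<in> T"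
    then show "x \<in> state_space \<and> u \<in> state_space" unfolding state_space_iff T_iff by blast
  qed
  show "single_valued T"
    unfolding single_valued_def by (intro allI impI) (elim T_cases, simp add: prim_inject)
  have mem: "((disp c e k, prim 0 (prim d s)), u) \<in> T"
    if "u = (prim 0 (prim d s), accel e k d s)"
      "moment_bc e k d s"
      "shear_bc c e k" for c e k d s u
    using that T_iff by blast
  show "csubspace T"
    unfolding csubspace_iff
  proof (intro conjI ballI allI)
    have "((prim 0 (prim 0 (prim 0 (prim 0 0))), prim 0 (prim 0 0)), (0, 0)) \<in> T"
      by (rule mem) (simp_all add: prim_0_0 L2_ip_scale_left[of 0 0 one_L2, simplified])
    then show "0 \<in> T" by (simp add: prim_0_0 zero_prod_def)
  next
    fix a b assume "a \<in> T" "b \<in> T"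
    obtain x u where a: "a = (x, u)" "(x, u) \<in> T" using \<open>a \<in> T\<close> by (cases a) auto
    obtain y v where b: "b = (y, v)" "(y, v) \<in> T" using \<open>b \<in> T\<close> by (cases b) auto
    obtain c e k d s where 1: "x = (disp c e k, prim 0 (prim d s))"
      "u = (prim 0 (prim d s), accel e k d s)"
      "moment_bc e k d s"
      "shear_bc c e k" using a(2) by (rule T_cases)
    obtain c' e' k' d' s' where 2: "y = (disp c' e' k', prim 0 (prim d' s'))"
      "v = (prim 0 (prim d' s'), accel e' k' d' s')"
      "moment_bc e' k' d' s'"
      "shear_bc c' e' k'" using b(2) by (rule T_cases)
    have "((prim 0 (prim (c + c') (prim 0 (prim (e + e') (k + k')))), prim 0 (prim (d + d') (s + s'))), u + v) \<in> T"
    proof (rule mem)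
      show "u + v = (prim 0 (prim (d + d') (s + s')), - (k + k') + of_real g *\<^sub>C prim 0 (prim (e + e') (k + k'))
          - of_real (2 * \<beta> * \<eta>) *\<^sub>C prim (d + d') (s + s'))"
        by (simp add: 1(2) 2(2) prim_add[symmetric] prim_0_add cvec.scale_right_distrib)
      show "L2_ip (prim (e + e') (k + k')) one_L2 + complex_of_real \<kappa> * (d + d' + L2_ip (s + s') one_L2) = 0"
        using 1(3) 2(3) by (simp add: prim_add[symmetric] L2_ip_add_left algebra_simps) (metis add.assoc add.commute add_0)
      show "e + e' + L2_ip (k + k') one_L2 =
          complex_of_real g * (c + c' + L2_ip (prim 0 (prim (e + e') (k + k'))) one_L2)"
        using 1(4) 2(4)
        by (simp add: prim_add[symmetric] prim_0_add L2_ip_add_left algebra_simps)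
    qed
    then show "a + b \<in> T" by (simp add: a(1) b(1) 1(1) 2(1) prim_add)
  next
    fix z a assume "a \<in> T"
    obtain x u where a: "a = (x, u)" "(x, u) \<in> T" using \<open>a \<in> T\<close> by (cases a) auto
    obtain c e k d s where 1: "x = (disp c e k, prim 0 (prim d s))"
      "u = (prim 0 (prim d s), accel e k d s)"
      "moment_bc e k d s"
      "shear_bc c e k" using a(2) by (rule T_cases)
    have "((prim 0 (prim (z * c) (prim 0 (prim (z * e) (z *\<^sub>C k)))), prim 0 (prim (z * d) (z *\<^sub>C s))), z *\<^sub>C u) \<in> T"
    proof (rule mem)
      show "z *\<^sub>C u = (prim 0 (prim (z * d) (z *\<^sub>C s)), - (z *\<^sub>C k) + of_real g *\<^sub>C prim 0 (prim (z * e) (z *\<^sub>C k))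
          - of_real (2 * \<beta> * \<eta>) *\<^sub>C prim (z * d) (z *\<^sub>C s))"
        unfolding 1(2) prim_scale[symmetric] prim_0_scale scaleC_prod_def
        by (simp add: cvec.scale_right_distrib cvec.scale_right_diff_distrib mult.commute)
      have "z * (L2_ip (prim e k) one_L2 + complex_of_real \<kappa> * (d + L2_ip s one_L2)) = 0" using 1(3) by simp
      then show "L2_ip (prim (z * e) (z *\<^sub>C k)) one_L2 + complex_of_real \<kappa> * (z * d + L2_ip (z *\<^sub>C s) one_L2) = 0"
        by (simp only: prim_scale[symmetric] L2_ip_scale_left) (simp only: algebra_simps)
      have "z * (e + L2_ip k one_L2) = z * (complex_of_real g * (c + L2_ip (prim 0 (prim e k)) one_L2))" using 1(4) by simp
      then show "z * e + L2_ip (z *\<^sub>C k) one_L2 =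
          complex_of_real g * (z * c + L2_ip (prim 0 (prim (z * e) (z *\<^sub>C k))) one_L2)"
        by (simp only: prim_scale[symmetric] prim_0_scale L2_ip_scale_left) (simp only: algebra_simps)
    qed
    then show "z *\<^sub>C a \<in> T" by (simp add: a(1) 1(1) scaleC_prod_def prim_scale)
  qed
qed

text \<open>Here \<open>a\<close> is v'(1) and \<open>b\<close> is v(1). Among the boundary terms of
  four integrations by parts, the moment condition turns one into
  \<open>- \<kappa> * a * cnj a\<close>, and the shear condition cancels those with
  \<open>g * cnj b\<close>. The pairings left over are differences of conjugates, hence imaginary,
  except for the \<beta>-term: twice the real part of \<open>L2_ip v' v\<close> is
  \<open>(cmod b)^2\<close>, since v(0) = 0.\<close>

lemma Re_T:
  assumes "(x, u) \<in> T"
  obtains a b where "Re (ip u x) = - \<kappa> * (cmod a)\<^sup>2 - \<beta> * \<eta> * (cmod b)\<^sup>2"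
proof -
  obtain c e k d s where
    x: "x = (disp c e k, prim 0 (prim d s))" and
    u: "u = (prim 0 (prim d s), accel e k d s)" and
    b1: "moment_bc e k d s" and
    b2: "shear_bc c e k"
    using assms by (rule T_cases)
  define r q p v' v where "r = prim e k" and "q = prim 0 r" and "p = prim c q" and "v' = prim d s" and "v = prim 0 v'"
  define a b where "a = d + L2_ip s one_L2" and "b = L2_ip v' one_L2"
  have 1: "L2_ip k v + L2_ip r v' = (e + L2_ip k one_L2) * cnj b"
    using L2_ip_parts[of k 0 v' e] by (simp add: r_def v_def b_def)
  have 2: "L2_ip r v' + L2_ip q s = L2_ip r one_L2 * cnj a"
    using L2_ip_parts[of r d s 0] by (simp add: q_def v'_def a_def)
  have 3: "L2_ip q v + L2_ip p v' = (c + L2_ip q one_L2) * cnj b"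
    using L2_ip_parts[of q 0 v' c] by (simp add: p_def v_def b_def)
  have 4: "L2_ip v' v + L2_ip v v' = b * cnj b"
    using L2_ip_parts[of v' 0 v' 0] by (simp add: v_def b_def)
  have r1: "L2_ip r one_L2 = - complex_of_real \<kappa> * a"
    using b1 by (simp add: r_def a_def add_eq_0_iff2)
  have k1: "e + L2_ip k one_L2 = complex_of_real g * (c + L2_ip q one_L2)"
    using b2 by (simp add: q_def r_def)
  have "ip u x = L2_ip s q + complex_of_real g * L2_ip v' p
      + L2_ip (- k + of_real g *\<^sub>C q - of_real (2 * \<beta> * \<eta>) *\<^sub>C v') v"
    unfolding x u by (simp only: ip_prim r_def q_def p_def v'_def v_def)
  also have "\<dots> = L2_ip s q + complex_of_real g * L2_ip v' p
      + (- L2_ip k v + complex_of_real g * L2_ip q v - complex_of_real (2 * \<beta> * \<eta>) * L2_ip v' v)"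
    by (simp only: L2_ip_add_left L2_ip_diff_left L2_ip_uminus_left L2_ip_scale_left)
  also have "L2_ip k v = complex_of_real g * (c + L2_ip q one_L2) * cnj b - L2_ip r v'"
    using 1 k1 by (simp add: eq_diff_eq)
  also have "L2_ip r v' = - complex_of_real \<kappa> * a * cnj a - L2_ip q s"
    using 2 r1 by (simp add: eq_diff_eq)
  also have "L2_ip q v = (c + L2_ip q one_L2) * cnj b - L2_ip p v'"
    using 3 by (simp add: eq_diff_eq)
  finally have e: "ip u x = (L2_ip s q - L2_ip q s) + complex_of_real g * (L2_ip v' p - L2_ip p v')
      - complex_of_real \<kappa> * (a * cnj a) - complex_of_real (2 * \<beta> * \<eta>) * L2_ip v' v"
    by (simp add: algebra_simps)
  have sym: "Re (L2_ip y z) = Re (L2_ip z y)" for y z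
    using L2_ip_commute[of y z] by simp
  have "2 * Re (L2_ip v' v) = (cmod b)\<^sup>2"
    using arg_cong[OF 4, of Re] sym[of v v'] by (simp add: complex_norm_square[symmetric] del: of_real_power)
  then have "2 * \<beta> * \<eta> * Re (L2_ip v' v) = \<beta> * \<eta> * (cmod b)\<^sup>2" by (simp add: algebra_simps)
  moreover have "Re (ip u x) = - \<kappa> * (cmod a)\<^sup>2 - 2 * \<beta> * \<eta> * Re (L2_ip v' v)"
    unfolding e using sym[of s q] sym[of v' p]
    by (simp add: complex_norm_square[symmetric] del: of_real_power of_real_mult)
  ultimately have "Re (ip u x) = - \<kappa> * (cmod a)\<^sup>2 - \<beta> * \<eta> * (cmod b)\<^sup>2" by linarith
  then show ?thesis by (rule that)
qed

lemma dissipative_T: "dissipative ip T"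
  unfolding dissipative_def
proof (clarify)
  fix w v w' v' assume "((w, v), (w', v')) \<in> T"
  then obtain a b where "Re (ip (w', v') (w, v)) = - \<kappa> * (cmod a)\<^sup>2 - \<beta> * \<eta> * (cmod b)\<^sup>2" by (rule Re_T)
  moreover have "0 \<le> \<kappa> * (cmod a)\<^sup>2" "0 \<le> \<beta> * \<eta> * (cmod b)\<^sup>2" using nonneg by simp_all
  ultimately show "Re (ip (w', v') (w, v)) \<le> 0" by simp
qed

text \<open>Integrating \<open>w'''' - g w'' = - (y + 2 \<beta> \<eta> v')\<close> once with \<open>w'''(1) = g w'(1)\<close> leaves the boundary value
  problem \<open>p'' - g p = G\<close>, \<open>p'(0) = 0\<close>, \<open>p'(1) = - \<kappa> v'(1)\<close> for \<open>p = w'\<close>.\<close>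

lemma surjective_T: "Range T = state_space"
proof
  show "Range T \<subseteq> state_space" using linear_T by (auto simp: linear_operator_def)
  show "state_space \<subseteq> Range T"
  proof
    fix u assume "u \<in> state_space"
    then obtain d s y where u: "u = (prim 0 (prim d s), y)" by (rule state_cases)
    define m where "m = - (y + of_real (2 * \<beta> * \<eta>) *\<^sub>C prim d s)"
    obtain f where f: "m = abs_L2 f" "square_integrable f" by (rule L2_cases)
    \<comment> \<open>\<open>G\<close> stands for w''' - g w'; its constant makes it vanish at 1,
      which is the shear condition.\<close>
    define G where "G = prim (- L2_ip m one_L2) m"
    have G: "G = abs_L2 (\<lambda>x. - L2_ip m one_L2 + integral {0..x} f)"
      unfolding G_def f by (rule prim_abs[OF f(2)])
    have g: "(sqrt g)\<^sup>2 = g" "sqrt g \<noteq> 0" using g_pos by simp_all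
    obtain c q where q: "q = volterra (of_real g *\<^sub>C prim c q + G)"
      "L2_ip (of_real g *\<^sub>C prim c q + G) one_L2 = - complex_of_real \<kappa> * (d + L2_ip s one_L2)"
      using boundary_value_problem[OF continuous_prim[OF f(2)] g(2)] unfolding g(1) G by metis
    \<comment> \<open>\<open>prim e k\<close> is to be w''' = g w' + G; \<open>e\<close> is its
      value at 0 and \<open>k\<close> its derivative.\<close>
    define e k where "e = complex_of_real g * c - L2_ip m one_L2" and "k = of_real g *\<^sub>C q + m"
    have r: "of_real g *\<^sub>C prim c q + G = prim e k"
      by (simp add: G_def prim_scale prim_add e_def k_def)
    have q': "q = prim 0 (prim e k)" using q(1) r by (simp add: prim_def)
    have "((disp c e k, prim 0 (prim d s)), u) \<in> T"
      unfolding T_iff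
    proof (intro exI conjI)
      show "u = (prim 0 (prim d s), accel e k d s)"
        unfolding q'[symmetric] by (simp add: u k_def m_def)
      show "moment_bc e k d s"
        using q(2) unfolding r by simp
      show "shear_bc c e k"
        unfolding q'[symmetric] by (simp add: e_def k_def L2_ip_add_left L2_ip_scale_left distrib_left)
    qed (rule refl)
    then show "u \<in> Range T" by blast
  qed
qed

text \<open>Pairing \<open>r = g * p + G\<close> with \<open>p = w'\<close> expresses
  \<open>g * (norm p)^2 + (norm q)^2\<close> by \<open>G\<close> and the product of v'(1) with the
  trace of w'. The velocity is part of the datum \<open>u\<close>, so v'(1) is controlled, and the
  trace is linear in \<open>norm p + norm q\<close>. A quadratic quantity is thus bounded by a
  linear one, and \<open>r = g * p + G\<close> then bounds w'''.\<close>

lemma energy_bound: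
  obtains A where "0 \<le> A" "\<And>c e k d s u.
    \<lbrakk>((disp c e k, prim 0 (prim d s)), u) \<in> T\<rbrakk> \<Longrightarrow>
      energy_le c e k d s (A * ip_norm ip u)"
proof -
  \<comment> \<open>\<open>B\<close> bounds v', whose square has weight \<open>g\<close> in the norm
    of \<open>u\<close>; \<open>K1\<close> bounds \<open>2 * norm m\<close> and hence
    \<open>norm G\<close>; \<open>K\<close> adds the boundary product; \<open>t\<close> bounds
    \<open>norm p + norm q\<close>, with \<open>min g 1\<close> from comparing the two weights;
    \<open>A\<close> dominates all five bounds.\<close>
  define B where "B = 1 / sqrt g"
  define K1 where "K1 = 2 * (1 + 2 * \<beta> * \<eta> * B)"
  define K where "K = K1 + 2 * \<kappa> * (B + 2)"
  define t where "t = 2 * K / min g 1"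
  define A where "A = 2 * t + g * t + K1 + B"
  have B: "0 \<le> B" and K1: "0 \<le> K1" using g_pos nonneg by (auto simp: B_def K1_def)
  have K: "0 \<le> K" using B K1 nonneg by (simp add: K_def)
  have t: "0 \<le> t" using K g_pos by (simp add: t_def)
  have A: "0 \<le> A" using t B K1 g_pos by (simp add: A_def)
  have "energy_le c e k d s (A * ip_norm ip u)"
    if T: "((disp c e k, prim 0 (prim d s)), u) \<in> T" for c e k d s u
  proof -
    define r q p v' where "r = prim e k" and "q = prim 0 r" and "p = prim c q" and "v' = prim d s"
    define y where "y = - k + of_real g *\<^sub>C q - of_real (2 * \<beta> * \<eta>) *\<^sub>C v'"
    define n where "n = ip_norm ip u"
    have u: "u = (prim 0 (prim d s), y)"
      and b1: "L2_ip r one_L2 = - complex_of_real \<kappa> * (d + L2_ip s one_L2)"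
      and b2: "e + L2_ip k one_L2 = complex_of_real g * (c + L2_ip q one_L2)"
      using T unfolding T_iff by (auto simp: prim_inject y_def r_def q_def v'_def add_eq_0_iff2)
    have n: "0 \<le> n" unfolding n_def u by (rule ip_norm_nonneg)
    have s: "norm s \<le> n" and y: "norm y \<le> n" and v': "norm v' \<le> B * n"
      using components_le_ip_norm[where c = d and q = s and v = y] g_pos
      by (auto simp: n_def u v'_def B_def field_simps)
    define a where "a = d + L2_ip s one_L2"
    have a: "cmod a \<le> (B + 2) * n"
      using cmod_prim_1_le[of d s] s v' by (simp add: a_def v'_def algebra_simps)
    define G where "G = r - of_real g *\<^sub>C p"
    define m where "m = k - of_real g *\<^sub>C q"
    have "m = - (y + of_real (2 * \<beta> * \<eta>) *\<^sub>C v')" by (simp add: m_def y_def)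
    then have "norm m \<le> norm y + 2 * \<beta> * \<eta> * norm v'"
      using norm_triangle_ineq[of y "of_real (2 * \<beta> * \<eta>) *\<^sub>C v'"] nonneg
      by (simp only: norm_minus_cancel norm_scaleC norm_of_real) simp
    also have "\<dots> \<le> n + 2 * \<beta> * \<eta> * (B * n)"
      using nonneg y v' by (intro add_mono mult_left_mono) auto
    finally have m: "2 * norm m \<le> K1 * n" by (simp add: K1_def algebra_simps)
    have Gm: "G = prim (- L2_ip m one_L2) m"
    proof -
      have "e - complex_of_real g * c = - L2_ip m one_L2"
        using b2 by (simp add: m_def L2_ip_diff_left L2_ip_scale_left algebra_simps)
      then show ?thesis by (simp add: G_def r_def p_def prim_scale prim_diff m_def)
    qed
    have G: "norm G \<le> K1 * n"
      using norm_prim_le[of "- L2_ip m one_L2" m] L2_cauchy_schwarz[of m one_L2] m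
      by (simp add: Gm norm_one_L2)
    have "L2_ip r p + L2_ip q q = L2_ip r one_L2 * cnj (c + L2_ip q one_L2)"
      using L2_ip_parts[of r c q 0] by (simp add: q_def p_def)
    moreover have "L2_ip r p = L2_ip G p + complex_of_real g * L2_ip p p"
      by (simp add: G_def L2_ip_diff_left L2_ip_scale_left)
    ultimately have "complex_of_real (g * (norm p)\<^sup>2 + (norm q)\<^sup>2) =
        - complex_of_real \<kappa> * a * cnj (c + L2_ip q one_L2) - L2_ip G p"
      using b1 by (simp add: L2_ip_eq_norm_sq a_def algebra_simps)
    then have "cmod (complex_of_real (g * (norm p)\<^sup>2 + (norm q)\<^sup>2)) \<le>
        cmod (- complex_of_real \<kappa> * a * cnj (c + L2_ip q one_L2)) + cmod (L2_ip G p)"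
      by (simp only: norm_triangle_ineq4)
    moreover have "0 \<le> g * (norm p)\<^sup>2 + (norm q)\<^sup>2" using g_pos by simp
    ultimately have "g * (norm p)\<^sup>2 + (norm q)\<^sup>2 \<le> \<kappa> * cmod a * cmod (c + L2_ip q one_L2) + cmod (L2_ip G p)"
      using nonneg by (simp only: norm_of_real norm_mult norm_minus_cancel complex_mod_cnj abs_of_nonneg)
    also have "\<dots> \<le> \<kappa> * ((B + 2) * n) * (norm p + 2 * norm q) + K1 * n * norm p"
    proof (intro add_mono mult_mono)
      show "cmod (c + L2_ip q one_L2) \<le> norm p + 2 * norm q" unfolding p_def by (rule cmod_prim_1_le)
      show "cmod (L2_ip G p) \<le> K1 * n * norm p"
        using L2_cauchy_schwarz[of G p] mult_right_mono[OF G norm_ge_zero[of p]] by linarith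
    qed (use nonneg a B n in auto)
    also have "\<dots> \<le> K * n * (norm p + norm q)"
    proof -
      have "\<kappa> * ((B + 2) * n) * (norm p + 2 * norm q) \<le> \<kappa> * ((B + 2) * n) * (2 * (norm p + norm q))"
        using nonneg B n by (intro mult_left_mono) auto
      moreover have "K1 * n * norm p \<le> K1 * n * (norm p + norm q)"
        using K1 n by (intro mult_left_mono) auto
      ultimately show ?thesis by (simp add: K_def algebra_simps)
    qed
    finally have en: "g * (norm p)\<^sup>2 + (norm q)\<^sup>2 \<le> K * n * (norm p + norm q)" .
    define N where "N = norm p + norm q"
    have "min g 1 * N\<^sup>2 \<le> 2 * K * n * N"
    proof -
      have "N\<^sup>2 \<le> 2 * ((norm p)\<^sup>2 + (norm q)\<^sup>2)"
        using sum_squares_bound[of "norm p" "norm q"] by (simp add: N_def power2_sum)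
      then have "min g 1 * N\<^sup>2 \<le> min g 1 * (2 * ((norm p)\<^sup>2 + (norm q)\<^sup>2))"
        using g_pos by (intro mult_left_mono) auto
      also have "\<dots> \<le> 2 * (g * (norm p)\<^sup>2 + (norm q)\<^sup>2)"
        using mult_right_mono[of "min g 1" g "(norm p)\<^sup>2"] mult_right_mono[of "min g 1" 1 "(norm q)\<^sup>2"]
        by (simp add: algebra_simps)
      finally show ?thesis using en by (simp add: N_def)
    qed
    have N: "N \<le> t * n"
    proof (cases "N = 0")
      case False
      then have "0 < N" by (simp add: N_def less_le)
      then have "min g 1 * N \<le> 2 * K * n"
        using \<open>min g 1 * N\<^sup>2 \<le> 2 * K * n * N\<close> by (simp add: power2_eq_square mult.assoc[symmetric])
      then show ?thesis using g_pos by (simp add: t_def field_simps)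
    qed (use t n in simp)
    have tA: "t * n \<le> A * n" "B * n \<le> A * n" "(g * t + K1) * n \<le> A * n"
      using t B K1 n g_pos by (auto intro!: mult_right_mono simp: A_def)
    have "norm p \<le> N" "norm q \<le> N" by (simp_all add: N_def)
    moreover have "norm r \<le> g * norm p + norm G"
      using norm_triangle_ineq[of "of_real g *\<^sub>C p" G] g_pos by (simp add: G_def norm_scaleC)
    moreover have "g * norm p \<le> g * (t * n)"
      using g_pos N \<open>norm p \<le> N\<close> by (intro mult_left_mono) auto
    moreover have "cmod c \<le> N" using cmod_prim_le[of c q] by (simp add: N_def p_def)
    ultimately have "norm p \<le> A * n \<and> norm q \<le> A * n \<and> norm r \<le> A * n \<and> cmod c \<le> A * n \<and> norm v' \<le> A * n"
      using N tA G v' by (simp add: algebra_simps)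
    then show ?thesis by (simp add: r_def q_def p_def v'_def n_def)
  qed
  then show ?thesis using A that by blast
qed

lemma bounded_inverse_T: "\<exists>C. \<forall>(x, u)\<in>T. ip_norm ip x \<le> C * ip_norm ip u"
proof -
  obtain A where A: "0 \<le> A" "\<And>c e k d s u.
    \<lbrakk>((disp c e k, prim 0 (prim d s)), u) \<in> T\<rbrakk> \<Longrightarrow>
      energy_le c e k d s (A * ip_norm ip u)"
    by (rule energy_bound) blast
  have "ip_norm ip x \<le> (A + sqrt g * A + A) * ip_norm ip u" if T: "(x, u) \<in> T" for x u
  proof -
    obtain c e k d s where x: "x = (disp c e k, prim 0 (prim d s))"
      using T by (rule T_cases)
    note b = A(2)[OF T[unfolded x]]
    have "ip_norm ip x \<le> norm (prim 0 (prim e k)) + sqrt g * norm (prim c (prim 0 (prim e k))) + norm (prim 0 (prim d s))"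
      unfolding x by (rule ip_norm_le)
    also have "\<dots> \<le> A * ip_norm ip u + sqrt g * (A * ip_norm ip u) + A * ip_norm ip u"
      using b norm_prim_le[of 0 "prim d s"] g_pos by (intro add_mono mult_left_mono) auto
    finally show ?thesis by (simp add: algebra_simps)
  qed
  then show ?thesis by blast
qed

sublocale dissipative_onto state_space ip T
  by (intro dissipative_onto.intro hilbert_carrier_state_space dissipative_onto_axioms.intro
      linear_T dissipative_T surjective_T bounded_inverse_T)

text \<open>The elements w'' and v are images under \<open>volterra\<close> of the bounded w''' and
  v', and w'(0) is a bounded scalar. Three successive subsequences make these coordinates converge,
  and \<open>state_tendsto\<close> assembles the limit.\<close>

lemma compact_inverse_T: "has_compact_inverse state_space ip T"
  unfolding has_compact_inverse_def compact_operator_def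
proof (intro conjI allI impI)
  show "linear_operator state_space T" by (rule linear_T)
  show "Domain (T\<inverse>) = state_space" using surjective_T by simp
  show "linear_operator state_space (T\<inverse>)"
    unfolding linear_operator_def
  proof (intro conjI)
    show "T\<inverse> \<subseteq> state_space \<times> state_space" using T_mem by auto
    show "single_valued (T\<inverse>)"
    proof (rule single_valuedI)
      fix u x y assume "(u, x) \<in> T\<inverse>" "(u, y) \<in> T\<inverse>"
      then have "(x - y, u - u) \<in> T" by (intro T_diff) auto
      then show "x = y" using T_kernel[of "x - y"] by simp
    qed
    have "(0, 0) \<in> T" using linear_T by (auto simp: linear_operator_def csubspace_iff zero_prod_def)
    then show "csubspace (T\<inverse>)"
      using T_add T_scale by (auto simp: csubspace_iff scaleC_prod_def zero_prod_def)
  qed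
next
  fix u x :: "nat \<Rightarrow> L2 \<times> L2"
  assume a: "(\<forall>n. (u n, x n) \<in> T\<inverse>) \<and> (\<exists>C. \<forall>n. ip_norm ip (u n) \<le> C)"
  then have T: "\<And>n. (x n, u n) \<in> T" by auto
  obtain C where C: "\<And>n. ip_norm ip (u n) \<le> C" using a by auto
  obtain A where A: "0 \<le> A" "\<And>c e k d s u.
    \<lbrakk>((disp c e k, prim 0 (prim d s)), u) \<in> T\<rbrakk> \<Longrightarrow>
      energy_le c e k d s (A * ip_norm ip u)"
    by (rule energy_bound) blast
  have "\<forall>n. \<exists>c e k d s. x n = (disp c e k, prim 0 (prim d s))"
    using T T_iff by blast
  then obtain c e k d s where x: "\<And>n. x n = (prim 0 (prim (c n) (prim 0 (prim (e n) (k n)))), prim 0 (prim (d n) (s n)))"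
    by metis
  have AC: "A * ip_norm ip (u n) \<le> A * C" for n using A(1) C by (intro mult_left_mono) auto
  have b: "norm (prim (e n) (k n)) \<le> A * C" "cmod (c n) \<le> A * C" "norm (prim (d n) (s n)) \<le> A * C" for n
    using A(2)[OF T[of n, unfolded x]] AC[of n] by auto
  obtain r1 q where r1: "strict_mono r1" "(\<lambda>n. volterra (prim (e (r1 n)) (k (r1 n)))) \<longlonglongrightarrow> q"
    using volterra_compact[of "\<lambda>n. prim (e n) (k n)" "A * C"] b by blast
  obtain r2 v where r2: "strict_mono r2" "(\<lambda>n. volterra (prim (d (r1 (r2 n))) (s (r1 (r2 n))))) \<longlonglongrightarrow> v"
    using volterra_compact[of "\<lambda>n. prim (d (r1 n)) (s (r1 n))" "A * C"] b by blast
  have "bounded (range (\<lambda>n. c (r1 (r2 n))))" using b(2) by (auto simp: bounded_iff)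
  then obtain r3 c' where r3: "strict_mono r3" "(\<lambda>n. c (r1 (r2 (r3 n)))) \<longlonglongrightarrow> c'"
    using bounded_imp_convergent_subsequence unfolding o_def by blast
  define r where "r = (\<lambda>n. r1 (r2 (r3 n)))"
  have "strict_mono r" using r1(1) r2(1) r3(1) by (simp add: r_def strict_mono_def)
  have "(\<lambda>n. volterra (prim (e (r n)) (k (r n)))) \<longlonglongrightarrow> q"
    using LIMSEQ_subseq_LIMSEQ[OF LIMSEQ_subseq_LIMSEQ[OF r1(2) r2(1)] r3(1)] by (simp add: r_def o_def)
  moreover have "(\<lambda>n. volterra (prim (d (r n)) (s (r n)))) \<longlonglongrightarrow> v"
    using LIMSEQ_subseq_LIMSEQ[OF r2(2) r3(1)] by (simp add: r_def o_def)
  moreover have "(\<lambda>n. c (r n)) \<longlonglongrightarrow> c'" using r3(2) by (simp add: r_def)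
  moreover have "prim 0 p = volterra p" for p by (simp add: prim_def)
  ultimately have "(\<lambda>n. ip_norm ip (x (r n) - (prim 0 (prim c' q), v))) \<longlonglongrightarrow> 0"
    using state_tendsto[of "\<lambda>n. c (r n)" c' "\<lambda>n. prim 0 (prim (e (r n)) (k (r n)))" q "\<lambda>n. prim 0 (prim (d (r n)) (s (r n)))" v]
    unfolding x by simp
  then show "\<exists>r l. strict_mono (r :: nat \<Rightarrow> nat) \<and> l \<in> state_space \<and> (\<lambda>n. ip_norm ip (x (r n) - l)) \<longlonglongrightarrow> 0"
    using \<open>strict_mono r\<close> state_space_iff by blast
qed

end

theorem theorem2p1:
  fixes \<beta> \<eta> \<kappa> \<gamma> :: real
  assumes "0 < \<beta>" "\<beta> < 1" and "0 \<le> \<eta>" and "0 \<le> \<kappa>" and "\<eta>\<^sup>2 < \<gamma>"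
  shows "has_compact_inverse state_space (state_ip \<gamma> \<eta>) (op_T \<beta> \<gamma> \<eta> \<kappa>) \<and>
    (0 < \<eta> \<and> 0 < \<kappa> \<longrightarrow>
      maximal_dissipative state_space (state_ip \<gamma> \<eta>) (op_T \<beta> \<gamma> \<eta> \<kappa>)) \<and>
    (\<eta> = 0 \<and> \<kappa> = 0 \<longrightarrow>
      skewadjoint state_space (state_ip \<gamma> \<eta>) (op_T \<beta> \<gamma> \<eta> \<kappa>)) \<and>
    (\<exists>S. contraction_C0_semigroup state_space (state_ip \<gamma> \<eta>) S \<and>
      semigroup_generator state_space (state_ip \<gamma> \<eta>) S = op_T \<beta> \<gamma> \<eta> \<kappa>)"
proof -
  interpret beam \<beta> \<eta> \<kappa> \<gamma> using assms by unfold_locales auto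
  have "skewadjoint state_space ip T" if "\<eta> = 0 \<and> \<kappa> = 0"
  proof (rule skewadjoint_if_conservative)
    fix x u assume "(x, u) \<in> T"
    then obtain a b where "Re (ip u x) = - \<kappa> * (cmod a)\<^sup>2 - \<beta> * \<eta> * (cmod b)\<^sup>2" by (rule Re_T)
    then show "Re (ip u x) = 0" using that by simp
  qed
  then show ?thesis
    using compact_inverse_T maximal semigroup_is_contraction_C0 generator_eq by blast
qed

end
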